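(* Let $\psi\in\mathcal{D}$, let $\varphi$ be an analytic self-map of the unit disk $\mathbb{D}$ and let $g$ be analytic on $\mathbb{D}$. Then $V_{\varphi}^{g}: AL_{\psi}^{2}(\mathbb{D})\rightarrow B_{\psi,0}(\mathbb{D})$ is compact if and only if $V_{\varphi}^{g}: AL_{\psi}^{2}(\mathbb{D})\rightarrow B_{\psi,0}(\mathbb{D})$ is bounded and $$\lim_{|z|\rightarrow 1}e^{\psi(\varphi(z))-2\psi(z)}\sqrt{\Delta\psi(\varphi(z))}\,|g'(z)|=0.$$
   Context: $\mathbb{D}$ is the open unit disk and $dA$ the normalized area measure on it. For a real function $\psi\in C^{2}(\mathbb{D})$ with $\Delta\psi>0$ ($\Delta$ the Laplacian), put $\tau(z)=(\Delta\psi(z))^{-1/2}$. We write $\psi\in\mathcal{D}$ if: (1) there is $C_1>0$ with $|\tau(z)-\tau(\xi)|\le C_1|z-\xi|$ for all $z,\xi\in\mathbb{D}$; (2) there is $C_2>0$ with $\tau(z)\le C_2(1-|z|)$ for $z\in\mathbb{D}$; (3) there are constants $0<C_3<1$ and $a>0$ with $\tau(z)\le\tau(\xi)+C_3(1-|z|)$ whenever $|z-\xi|>a\tau(\xi)$. The weighted Bergman space $AL^{2}_{\psi}(\mathbb{D})$ is the space of analytic $f$ on $\mathbb{D}$ with $\|f\|_{L^2_\psi}=(\int_{\mathbb{D}}|f|^{2}e^{-2\psi}dA)^{1/2}<\infty$. The Bloch-type space $B_{\psi}(\mathbb{D})$ consists of analytic $f$ with $\sup_{z\in\mathbb{D}}e^{-2\psi(z)}|f'(z)|<\infty$,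 normed by $\|f\|_{B_\psi}=|f(0)|+\sup_{z\in\mathbb{D}}e^{-2\psi(z)}|f'(z)|$; the little Bloch-type space $B_{\psi,0}(\mathbb{D})$ is the subspace of $f\in B_\psi(\mathbb{D})$ with $\lim_{|z|\to1}e^{-2\psi(z)}|f'(z)|=0$, with the same norm. The Volterra-composition operator is $V_{\varphi}^{g}f(z)=\int_{0}^{z}f(\varphi(t))g'(t)\,dt$, so $(V_\varphi^g f)'=(f\circ\varphi)g'$. Standing assumption of the paper: $H^\infty_\psi(\mathbb{D})=\{f \text{ analytic}: e^{-\psi}f\in L^\infty\}$ and the set of polynomials are dense in $AL^2_\psi(\mathbb{D})$. *)

theory Defs
  imports "HOL-Complex_Analysis.Complex_Analysis"
begin

abbreviation disc :: "complex set" where "disc \<equiv> ball 0 1"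

abbreviation to_boundary :: "complex filter" where
  "to_boundary \<equiv> filtercomap cmod (at_left 1)"

definition C2_on :: "complex set \<Rightarrow> (complex \<Rightarrow> real) \<Rightarrow> bool" where
  "C2_on S f \<longleftrightarrow> (\<exists>(f1 :: complex \<Rightarrow> (complex \<Rightarrow>\<^sub>L real))
        (f2 :: complex \<Rightarrow> (complex \<Rightarrow>\<^sub>L (complex \<Rightarrow>\<^sub>L real))).
      (\<forall>z\<in>S. (f has_derivative blinfun_apply (f1 z)) (at z)) \<and>
      (\<forall>z\<in>S. (f1 has_derivative blinfun_apply (f2 z)) (at z)) \<and>
      continuous_on S f2)"

definition laplacian :: "(complex \<Rightarrow> real) \<Rightarrow> complex \<Rightarrow> real" where
  "laplacian f z =
     deriv (\<lambda>t. deriv (\<lambda>s. f (Complex s (Im z))) t) (Re z) +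
     deriv (\<lambda>t. deriv (\<lambda>s. f (Complex (Re z) s)) t) (Im z)"

definition tau :: "(complex \<Rightarrow> real) \<Rightarrow> complex \<Rightarrow> real" where
  "tau psi z = 1 / sqrt (laplacian psi z)"

definition classD :: "(complex \<Rightarrow> real) \<Rightarrow> bool" where
  "classD psi \<longleftrightarrow>
     C2_on disc psi \<and> (\<forall>z\<in>disc. laplacian psi z > 0) \<and>
     (\<exists>C1>0. \<forall>z\<in>disc. \<forall>\<xi>\<in>disc. \<bar>tau psi z - tau psi \<xi>\<bar> \<le> C1 * cmod (z - \<xi>)) \<and>
     (\<exists>C2>0. \<forall>z\<in>disc. tau psi z \<le> C2 * (1 - cmod z)) \<and>
     (\<exists>C3 a. 0 < C3 \<and> C3 < 1 \<and> a > 0 \<and>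
        (\<forall>z\<in>disc. \<forall>\<xi>\<in>disc. cmod (z - \<xi>) > a * tau psi \<xi> \<longrightarrow>
            tau psi z \<le> tau psi \<xi> + C3 * (1 - cmod z)))"

text \<open>Weighted Bergman space with respect to normalized area measure dA = dx dy / pi.\<close>
definition AL2 :: "(complex \<Rightarrow> real) \<Rightarrow> (complex \<Rightarrow> complex) set" where
  "AL2 psi = {f. f holomorphic_on disc \<and>
      (\<lambda>z. (cmod (f z))\<^sup>2 * exp (-2 * psi z)) integrable_on disc}"

definition L2norm :: "(complex \<Rightarrow> real) \<Rightarrow> (complex \<Rightarrow> complex) \<Rightarrow> real" where
  "L2norm psi f = sqrt ((1 / pi) * integral disc (\<lambda>z. (cmod (f z))\<^sup>2 * exp (-2 * psi z)))"

definition Bloch :: "(complex \<Rightarrow> real) \<Rightarrow> (complex \<Rightarrow> complex) set" where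
  "Bloch psi = {f. f holomorphic_on disc \<and>
      bdd_above ((\<lambda>z. exp (-2 * psi z) * cmod (deriv f z)) ` disc)}"

definition Bloch0 :: "(complex \<Rightarrow> real) \<Rightarrow> (complex \<Rightarrow> complex) set" where
  "Bloch0 psi = {f. f \<in> Bloch psi \<and>
      ((\<lambda>z. exp (-2 * psi z) * cmod (deriv f z)) \<longlongrightarrow> 0) to_boundary}"

definition Bnorm :: "(complex \<Rightarrow> real) \<Rightarrow> (complex \<Rightarrow> complex) \<Rightarrow> real" where
  "Bnorm psi f = cmod (f 0) + (SUP z\<in>disc. exp (-2 * psi z) * cmod (deriv f z))"

definition Volterra :: "(complex \<Rightarrow> complex) \<Rightarrow> (complex \<Rightarrow> complex) \<Rightarrow>
    (complex \<Rightarrow> complex) \<Rightarrow> complex \<Rightarrow> complex" where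
  "Volterra \<phi> g f z = contour_integral (linepath 0 z) (\<lambda>t. f (\<phi> t) * deriv g t)"

definition bounded_AL2_B0 :: "(complex \<Rightarrow> real) \<Rightarrow> ((complex \<Rightarrow> complex) \<Rightarrow> (complex \<Rightarrow> complex)) \<Rightarrow> bool" where
  "bounded_AL2_B0 psi T \<longleftrightarrow> (\<forall>f\<in>AL2 psi. T f \<in> Bloch0 psi) \<and>
     (\<exists>C. \<forall>f\<in>AL2 psi. Bnorm psi (T f) \<le> C * L2norm psi f)"

definition compact_AL2_B0 :: "(complex \<Rightarrow> real) \<Rightarrow> ((complex \<Rightarrow> complex) \<Rightarrow> (complex \<Rightarrow> complex)) \<Rightarrow> bool" where
  "compact_AL2_B0 psi T \<longleftrightarrow> (\<forall>f\<in>AL2 psi. T f \<in> Bloch0 psi) \<and>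
     (\<forall>F :: nat \<Rightarrow> complex \<Rightarrow> complex. (\<forall>n. F n \<in> AL2 psi \<and> L2norm psi (F n) \<le> 1) \<longrightarrow>
        (\<exists>r h. strict_mono r \<and> h \<in> Bloch0 psi \<and>
           (\<lambda>n. Bnorm psi (\<lambda>z. T (F (r n)) z - h z)) \<longlonglongrightarrow> 0))"

definition standing_density :: "(complex \<Rightarrow> real) \<Rightarrow> bool" where
  "standing_density psi \<longleftrightarrow>
     (\<forall>f\<in>AL2 psi. \<forall>\<epsilon>>0. \<exists>h. h holomorphic_on disc \<and>
         bounded ((\<lambda>z. exp (- psi z) * cmod (h z)) ` disc) \<and> h \<in> AL2 psi \<and>
         L2norm psi (\<lambda>z. f z - h z) < \<epsilon>) \<and>
     (\<forall>f\<in>AL2 psi. \<forall>\<epsilon>>0. \<exists>(c :: nat \<Rightarrow> complex) N.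
         (\<lambda>z. \<Sum>k\<le>N. c k * z ^ k) \<in> AL2 psi \<and>
         L2norm psi (\<lambda>z. f z - (\<Sum>k\<le>N. c k * z ^ k)) < \<epsilon>)"

end

(* Since V f has derivative f(phi) g', compactness into the little Bloch-type space amounts to
   norm decay, as |z| -> 1, of the functionals f |-> exp(-2 psi(z)) f(phi(z)) g'(z). Everything
   therefore rests on the two-sided estimate
     sup {|f(w)| : norm f <= 1} ~ exp(psi(w)) / tau(w).
   Upper bound: on a disc of radius comparable to tau(w), psi differs by a bounded amount from the
   real part of a holomorphic h (the Dirichlet problem on a circle, approximately, together with the
   maximum principle), and the mean value inequality applies to f exp(-h).
   Lower bound: f = chi exp(h) + (z - w) v with a cut-off chi, where v solves a weighted dbar
   equation and the factor z - w preserves the value at w. The a priori inequality of Hoermander is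
   used with 2 psi lowered by a slowly growing logarithm centred at w, which pays for the factor
   |z - w|^2 in the norm; v is a limit of mollified Riesz approximants. *)
theory Submission
  imports Defs
begin

text \<open>The weighted dbar equation yields its solution u only as a limit of functionals, so no
  regularity of u is available. It is compared with an explicit solution of the same equation, G =
  -(1 - chi) exp(h) / (z - w): the difference G - u is weakly holomorphic, and mollifying it at a
  fixed radius r gives a genuinely holomorphic function. Mollification needs room and uniform
  continuity, hence takes place on a disc of radius s < 1; r depends on s but the norm bound does
  not, and a normal family argument lets s tend to 1.

  The logarithm is affordable because tau(z) <= tau(w) + C1 |z - w| makes the Laplacian of psi at
  least 1 / (2 (1 + C1^2) T (1 + X)), where T = tau(w)^2 and X = |z - w|^2 / T. The Laplacian of the
  logarithm has an upper bound of the same form 1 / (T (1 + X)) with a coefficient proportional to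
  eps, so for small eps it stays below that of psi on the whole disc, not only near w.\<close>

section \<open>Calculus of compactly supported functions on the plane\<close>

abbreviation pderivs :: "(complex \<Rightarrow> 'b::real_normed_vector) \<Rightarrow> 'b \<Rightarrow> 'b \<Rightarrow> complex \<Rightarrow> bool" where
  "pderivs f fx fy z \<equiv> (f has_derivative (\<lambda>t. Re t *\<^sub>R fx + Im t *\<^sub>R fy)) (at z)"

lemma continuous_zero_extension:
  assumes "open S" "compact K" "K \<subseteq> S" "continuous_on S f" "\<And>z. z \<notin> K \<Longrightarrow> f z = 0"
  shows "continuous_on UNIV (f :: 'a::t2_space \<Rightarrow> 'b::{zero,topological_space})"
proof -
  have o: "open (- K)" using assms(2) compact_imp_closed by blast
  have "continuous_on (- K) f"
    using assms(5) by (subst continuous_on_cong[OF refl, where g="\<lambda>_. 0"]) auto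
  then have "continuous_on (S \<union> - K) f" by (intro continuous_on_open_Un assms o)
  moreover have "S \<union> - K = UNIV" using assms(3) by auto
  ultimately show ?thesis by simp
qed

lemma integrable_compact_support:
  fixes f :: "'a::euclidean_space \<Rightarrow> 'b::{banach,second_countable_topology}"
  assumes "continuous_on UNIV f" "compact K" "\<And>z. z \<notin> K \<Longrightarrow> f z = 0"
  shows "integrable lborel f"
proof -
  have "integrable lborel (\<lambda>x. indicator K x *\<^sub>R f x)"
    using assms(2) continuous_on_subset[OF assms(1)] by (intro borel_integrable_compact) auto
  moreover have "(\<lambda>x. indicator K x *\<^sub>R f x) = f"
    using assms(3) by (auto simp: indicator_def fun_eq_iff)
  ultimately show ?thesis by simp
qed

lemma uniformly_continuous_compact_support:
  fixes f :: "'a::euclidean_space \<Rightarrow> 'b::real_normed_vector"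
  assumes "continuous_on UNIV f" "compact K" "\<And>z. z \<notin> K \<Longrightarrow> f z = 0" "e > 0"
  obtains d where "d > 0" "\<And>x y. dist x y < d \<Longrightarrow> dist (f x) (f y) < e"
proof -
  define K' where "K' = {x + y | x y. x \<in> K \<and> y \<in> cball 0 1}"
  have "compact K'" unfolding K'_def by (intro compact_sums assms compact_cball)
  then have "uniformly_continuous_on K' f"
    using assms(1) compact_uniformly_continuous continuous_on_subset by blast
  then obtain d where d: "d > 0" "\<And>x y. x \<in> K' \<Longrightarrow> y \<in> K' \<Longrightarrow> dist y x < d \<Longrightarrow> dist (f y) (f x) < e"
    using assms(4) unfolding uniformly_continuous_on_def by metis
  have K': "y \<in> K'" if "x \<in> K" "dist x y < 1" for x y
  proof -
    have "y = x + (y - x)" "y - x \<in> cball 0 1"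
      using that by (auto simp: dist_norm norm_minus_commute)
    with that(1) show ?thesis unfolding K'_def by blast
  qed
  show ?thesis
  proof (rule that)
    show "min d 1 > 0" using d by simp
    fix x y :: 'a assume a: "dist x y < min d 1"
    show "dist (f x) (f y) < e"
    proof (cases "x \<in> K \<or> y \<in> K")
      case True
      then have "x \<in> K' \<and> y \<in> K'" using K' a by (metis dist_self dist_commute min_less_iff_conj zero_less_one)
      then show ?thesis using d(2)[of y x] a by (simp)
    next
      case False then show ?thesis using assms(3,4) by simp
    qed
  qed
qed

text \<open>Compact support makes the partials uniformly continuous, so one d serves all z. This
  uniformity is what later allows differentiation under an integral
  (\<open>integral_pderiv_eq_0\<close>) and under a sup-norm bounded functional
  (\<open>weakly_holomorphic\<close>).\<close>

lemma uniform_linearization: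
  fixes f :: "complex \<Rightarrow> 'b::real_normed_vector"
  assumes der: "\<And>z. pderivs f (fx z) (fy z) z"
    and c: "continuous_on UNIV fx" "continuous_on UNIV fy"
    and K: "compact K" "\<And>z. z \<notin> K \<Longrightarrow> fx z = 0" "\<And>z. z \<notin> K \<Longrightarrow> fy z = 0"
    and e: "e > 0"
  obtains d where "d > 0" "\<And>z t. norm t < d \<Longrightarrow>
    norm (f (z + t) - f z - (Re t *\<^sub>R fx z + Im t *\<^sub>R fy z)) \<le> e * norm t"
proof -
  obtain d1 where d1: "d1 > 0" "\<And>x y. dist x y < d1 \<Longrightarrow> dist (fx x) (fx y) < e / 2"
    using uniformly_continuous_compact_support[OF c(1) K(1,2), of "e/2"] e by auto
  obtain d2 where d2: "d2 > 0" "\<And>x y. dist x y < d2 \<Longrightarrow> dist (fy x) (fy y) < e / 2"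
    using uniformly_continuous_compact_support[OF c(2) K(1,3), of "e/2"] e by auto
  show ?thesis
  proof (rule that)
    show "min d1 d2 > 0" using d1 d2 by simp
    fix z t :: complex assume t: "norm t < min d1 d2"
    define g where "g s = f (z + s) - (Re s *\<^sub>R fx z + Im s *\<^sub>R fy z)" for s
    \<comment> \<open>With the linear part at z removed, the partials of g are differences of
      partials of f at two nearby points, each at most e/2.\<close>
    have "norm (g t - g 0) \<le> e * norm (t - 0)"
    proof (rule differentiable_bound[where S="ball 0 (min d1 d2)"
          and f'="\<lambda>s u. Re u *\<^sub>R (fx (z+s) - fx z) + Im u *\<^sub>R (fy (z+s) - fy z)"])
      fix s :: complex assume s: "s \<in> ball 0 (min d1 d2)"
      have "((\<lambda>s. f (z + s)) has_derivative (\<lambda>u. Re u *\<^sub>R fx (z+s) + Im u *\<^sub>R fy (z+s))) (at s)"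
      proof -
        have "((\<lambda>s. z + s) has_derivative (\<lambda>u. u)) (at s)" by (auto intro!: derivative_eq_intros)
        from has_derivative_compose[OF this der] show ?thesis .
      qed
      then have "(g has_derivative (\<lambda>u. Re u *\<^sub>R (fx (z+s) - fx z) + Im u *\<^sub>R (fy (z+s) - fy z))) (at s)"
        unfolding g_def by (auto intro!: derivative_eq_intros simp: algebra_simps)
      then show "(g has_derivative (\<lambda>u. Re u *\<^sub>R (fx (z+s) - fx z) + Im u *\<^sub>R (fy (z+s) - fy z)))
         (at s within ball 0 (min d1 d2))"
        by (rule has_derivative_at_withinI)
      show "onorm (\<lambda>u. Re u *\<^sub>R (fx (z+s) - fx z) + Im u *\<^sub>R (fy (z+s) - fy z)) \<le> e"
      proof (rule onorm_le)
        fix u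
        have a: "norm (fx (z+s) - fx z) \<le> e/2" "norm (fy (z+s) - fy z) \<le> e/2"
          using s d1(2)[of "z+s" z] d2(2)[of "z+s" z] by (auto simp: dist_norm)
        have "norm (Re u *\<^sub>R (fx (z+s) - fx z) + Im u *\<^sub>R (fy (z+s) - fy z))
          \<le> \<bar>Re u\<bar> * norm (fx (z+s) - fx z) + \<bar>Im u\<bar> * norm (fy (z+s) - fy z)"
          by (metis norm_triangle_ineq norm_scaleR)
        also have "\<dots> \<le> norm u * (e/2) + norm u * (e/2)"
          using a abs_Re_le_cmod[of u] abs_Im_le_cmod[of u] by (intro add_mono mult_mono) auto
        finally show "norm (Re u *\<^sub>R (fx (z+s) - fx z) + Im u *\<^sub>R (fy (z+s) - fy z)) \<le> e * norm u"
          by (simp add: algebra_simps)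
      qed
    qed (use t d1 d2 in auto)
    then show "norm (f (z + t) - f z - (Re t *\<^sub>R fx z + Im t *\<^sub>R fy z)) \<le> e * norm t"
      by (simp add: g_def algebra_simps)
  qed
qed

lemma lborel_integral_translation:
  fixes f :: "'a::euclidean_space \<Rightarrow> 'b::{banach,second_countable_topology}"
  assumes "f \<in> borel_measurable borel"
  shows "(LINT x|lborel. f (a + x)) = (LINT x|lborel. f x)"
proof -
  have "(LINT x|distr lborel borel ((+) a). f x) = (LINT x|lborel. f (a + x))"
    using assms by (intro integral_distr) auto
  then show ?thesis by (simp add: lborel_distr_plus)
qed

text \<open>Integration by parts without boundary terms. By translation invariance every difference
  quotient of f has integral 0, and the quotients converge uniformly to the directional derivative
  inside a fixed compact set.\<close>

lemma integral_pderiv_eq_0: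
  fixes f :: "complex \<Rightarrow> 'b::{banach,second_countable_topology}"
  assumes S: "open S" "compact K" "K \<subseteq> S"
    and der: "\<And>z. z \<in> S \<Longrightarrow> pderivs f (fx z) (fy z) z"
    and c: "continuous_on S fx" "continuous_on S fy"
    and z: "\<And>z. z \<notin> K \<Longrightarrow> f z = 0" "\<And>z. z \<notin> K \<Longrightarrow> fx z = 0" "\<And>z. z \<notin> K \<Longrightarrow> fy z = 0"
  shows "integral\<^sup>L lborel fx = 0" "integral\<^sup>L lborel fy = 0"
proof -
  have der': "pderivs f (fx z) (fy z) z" for z
  proof (cases "z \<in> S")
    case False
    then have zK: "z \<in> - K" "open (- K)" using S compact_imp_closed by auto
    have "((\<lambda>_. 0) has_derivative (\<lambda>t. Re t *\<^sub>R fx z + Im t *\<^sub>R fy z)) (at z)"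
      using zK z by (auto)
    from has_derivative_transform_within_open[OF this zK(2,1)] z show ?thesis by auto
  qed (use der in auto)
  have cU: "continuous_on UNIV fx" "continuous_on UNIV fy"
    using continuous_zero_extension[OF S] c z by auto
  have cf: "continuous_on UNIV f"
    using der' has_derivative_continuous continuous_at_imp_continuous_on by blast
  \<comment> \<open>Translating by a vector of length at most 1 keeps the support inside R, so the
    error integral is at most e times the area of R.\<close>
  define R where "R = {x + y | x y. x \<in> K \<and> y \<in> cball (0::complex) 1}"
  have "compact R" unfolding R_def by (intro compact_sums S compact_cball)
  define M where "M = measure lborel R"
  have Rm: "R \<in> sets lborel" "emeasure lborel R < \<infinity>" 
    using \<open>compact R\<close> emeasure_bounded_finite[of R] by (auto simp: compact_imp_closed compact_imp_bounded)
  have main: "norm (integral\<^sup>L lborel g) \<le> e * M"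
    if e: "e > 0" and v: "norm v = 1" and g: "\<And>z. g z = Re v *\<^sub>R fx z + Im v *\<^sub>R fy z" for e v g
  proof -
    obtain d where d: "d > 0" "\<And>z t. norm t < d \<Longrightarrow>
      norm (f (z + t) - f z - (Re t *\<^sub>R fx z + Im t *\<^sub>R fy z)) \<le> e * norm t"
      using uniform_linearization[OF der' cU S(2) z(2,3) e] by blast
    define t where "t = min 1 (d/2)"
    have t: "0 < t" "t \<le> 1" "t < d" using d by (auto simp: t_def)
    define k where "k z = (1/t) *\<^sub>R (f (of_real t * v + z) - f z) - g z" for z
    have cg: "continuous_on UNIV g" unfolding g[abs_def] using cU by (intro continuous_intros)
    have ig: "integrable lborel g"
      by (rule integrable_compact_support[OF cg S(2)]) (simp add: g z)
    have iF: "integrable lborel f" by (rule integrable_compact_support[OF cf S(2)]) (simp add: z)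
    have inR: "z + y \<in> R" if "z \<in> K" "norm y \<le> 1" for z y
      unfolding R_def using that mem_cball_0 by blast
    have tvn: "norm (of_real t * v) \<le> 1" using t v by (simp add: norm_mult)
    have vanish: "f (of_real t * v + z) = 0" if "z \<notin> R" for z
      using inR[of "of_real t * v + z" "- (of_real t * v)"] tvn that z(1) by fastforce
    have KR: "K \<subseteq> R" using inR[of _ 0] by auto
    have cft: "continuous_on UNIV (\<lambda>z. f (of_real t * v + z))"
      by (intro continuous_on_compose2[OF cf]) (auto intro!: continuous_intros)
    have iFt: "integrable lborel (\<lambda>z. f (of_real t * v + z))"
      by (rule integrable_compact_support[OF cft \<open>compact R\<close>]) (simp add: vanish)
    have "integral\<^sup>L lborel k = (1/t) *\<^sub>R ((LINT z|lborel. f (of_real t * v + z)) - (LINT z|lborel. f z)) - integral\<^sup>L lborel g"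
      unfolding k_def using iF iFt ig by simp
    also have "(LINT z|lborel. f (of_real t * v + z)) = (LINT z|lborel. f z)"
      using cf by (intro lborel_integral_translation borel_measurable_continuous_onI)
    finally have "norm (integral\<^sup>L lborel g) = norm (integral\<^sup>L lborel k)" by simp
    also have "\<dots> \<le> integral\<^sup>L lborel (\<lambda>z. e * indicator R z)"
    proof (rule Bochner_Integration.integral_norm_bound_integral)
      show "integrable lborel k" unfolding k_def using iF iFt ig by simp
      show "integrable lborel (\<lambda>z. e * indicator R z)" using Rm by simp
      fix z
      show "norm (k z) \<le> e * indicator R z"
      proof (cases "z \<in> R")
        case True
        have "k z = (1/t) *\<^sub>R (f (z + of_real t * v) - f z - (Re (of_real t * v) *\<^sub>R fx z + Im (of_real t * v) *\<^sub>R fy z))"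
          using t by (simp add: k_def g scaleR_diff_right scaleR_add_right add.commute)
        also have "norm \<dots> \<le> (1/t) * (e * norm (of_real t * v))"
          using d(2)[of "of_real t * v" z] t v by (simp add: norm_mult divide_simps)
        finally show ?thesis using True t v by (simp add: norm_mult)
      next
        case False
        then have "z \<notin> K" using KR by auto
        then show ?thesis using vanish[OF False] False z[of z] by (simp add: k_def g)
      qed
    qed
    also have "\<dots> = e * M" by (simp add: M_def)
    finally show ?thesis .
  qed
  have M0: "M \<ge> 0" by (simp add: M_def)
  have lim: "x = 0" if "\<And>e. e > 0 \<Longrightarrow> norm (x::'b) \<le> e * M" for x
  proof (rule ccontr)
    assume "x \<noteq> 0"
    then have "norm x / (2 * (M+1)) > 0" using M0 by simp
    from that[OF this] M0 \<open>x \<noteq> 0\<close> show False by (simp add: field_simps) (smt (verit) mult_nonneg_nonneg norm_ge_zero zero_less_norm_iff)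
  qed
  show "integral\<^sup>L lborel fx = 0" by (rule lim, rule main[where v=1]) auto
  show "integral\<^sup>L lborel fy = 0" by (rule lim, rule main[where v=\<i>]) auto
qed

lemma Cauchy_Schwarz_integral:
  fixes f g :: "'a \<Rightarrow> real"
  assumes "integrable M (\<lambda>x. (f x)\<^sup>2)" "integrable M (\<lambda>x. (g x)\<^sup>2)" "integrable M (\<lambda>x. f x * g x)"
  shows "(LINT x|M. f x * g x)\<^sup>2 \<le> (LINT x|M. (f x)\<^sup>2) * (LINT x|M. (g x)\<^sup>2)"
proof -
  define a b c where "a = (LINT x|M. (f x)\<^sup>2)" and "b = (LINT x|M. f x * g x)" and "c = (LINT x|M. (g x)\<^sup>2)"
  have q: "0 \<le> a + 2 * s * b + s\<^sup>2 * c" for s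
  proof -
    have "0 \<le> (LINT x|M. (f x + s * g x)\<^sup>2)" by (intro integral_nonneg_AE) auto
    also have "\<dots> = (LINT x|M. (f x)\<^sup>2 + 2 * s * (f x * g x) + s\<^sup>2 * (g x)\<^sup>2)"
      by (intro Bochner_Integration.integral_cong) (auto simp: power2_eq_square algebra_simps)
    also have "\<dots> = a + 2 * s * b + s\<^sup>2 * c"
      using assms by (simp add: a_def b_def c_def)
    finally show ?thesis .
  qed
  have "b\<^sup>2 \<le> a * c"
  proof (cases "c = 0")
    case True
    have "b = 0"
    proof (rule ccontr)
      assume "b \<noteq> 0"
      \<comment> \<open>At this s the affine function a + 2 s b would equal -1.\<close>
      with q[of "-(a+1)/(2*b)"] True show False by (simp add: field_simps)
    qed
    then show ?thesis using True by simp
  next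
    case False
    have "c \<ge> 0" unfolding c_def by (intro integral_nonneg_AE) auto
    with False have "c > 0" by simp
    with q[of "-b/c"] show ?thesis by (simp add: field_simps power2_eq_square)
  qed
  then show ?thesis by (simp add: a_def b_def c_def)
qed

lemma DERIV_max_power:
  "((\<lambda>t::real. max 0 t ^ Suc (Suc n)) has_real_derivative real (Suc (Suc n)) * max 0 t ^ Suc n) (at t)"
proof -
  consider "t > 0" | "t < 0" | "t = 0" by linarith
  then show ?thesis
  proof cases
    case 1
    have "((\<lambda>t::real. t ^ Suc (Suc n)) has_real_derivative real (Suc (Suc n)) * max 0 t ^ Suc n) (at t)"
      using DERIV_pow[of "Suc (Suc n)" t] 1 by simp
    then show ?thesis
      by (rule has_field_derivative_transform_within_open[where S="{0<..}"]) (use 1 in auto)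
  next
    case 2
    have "((\<lambda>t::real. 0) has_real_derivative real (Suc (Suc n)) * max 0 t ^ Suc n) (at t)"
      using 2 by auto
    then show ?thesis
      by (rule has_field_derivative_transform_within_open[where S="{..<0}"]) (use 2 in auto)
  next
    case 3
    have "(\<lambda>h::real. max 0 h ^ Suc (Suc n) / h) \<midarrow>0\<rightarrow> 0"
    proof (rule Lim_null_comparison)
      have "norm (max 0 h ^ Suc (Suc n) / h) \<le> \<bar>h\<bar> ^ Suc n" for h :: real
        by (cases "h > 0") (simp_all add: max_absorb1 max_absorb2 mult_nonpos_nonneg)
      then show "\<forall>\<^sub>F h in at 0. norm (max 0 h ^ Suc (Suc n) / h) \<le> \<bar>h\<bar> ^ Suc n"
        by (intro always_eventually allI)
      show "(\<lambda>h::real. \<bar>h\<bar> ^ Suc n) \<midarrow>0\<rightarrow> 0" by (rule tendsto_eq_intros refl | simp)+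
    qed
    then show ?thesis using 3 by (simp add: DERIV_def)
  qed
qed

section \<open>Polynomial bumps and the mean value property\<close>

text \<open>The function (1 - |y|^2 / r^2)_+^k, of class C^(k-1) for k at least 1. Limited
  smoothness is accepted because the gradient is then explicit: y times a multiple of the bump with
  exponent k - 1.\<close>

definition bump :: "real \<Rightarrow> nat \<Rightarrow> complex \<Rightarrow> real" where
  "bump r k y = max 0 (1 - ((Re y)\<^sup>2 + (Im y)\<^sup>2) / r\<^sup>2) ^ k"

lemma bump_nonneg: "bump r k y \<ge> 0" by (simp add: bump_def)

lemma bump_le_1: "bump r k y \<le> 1"
  unfolding bump_def by (intro power_le_one) (auto simp: max_def)

lemma bump_eq_0: 
  assumes "r > 0" "k > 0" "cmod y \<ge> r"
  shows "bump r k y = 0"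
proof -
  have "(cmod y)\<^sup>2 \<ge> r\<^sup>2" using assms by (intro power_mono) auto
  then show ?thesis using assms by (simp add: bump_def cmod_power2 max_def)
qed

lemma bump_minus: "bump r k (- y) = bump r k y" by (simp add: bump_def)

lemma continuous_on_bump [continuous_intros]:
  "continuous_on S f \<Longrightarrow> continuous_on S (\<lambda>z. bump r k (f z))"
  unfolding bump_def divide_inverse by (intro continuous_intros)

lemma bump_pderivs:
  "pderivs (bump r (Suc (Suc n))) (- real (Suc (Suc n)) * 2 / r\<^sup>2 * Re y * bump r (Suc n) y)
      (- real (Suc (Suc n)) * 2 / r\<^sup>2 * Im y * bump r (Suc n) y) y"
proof -
  have "((\<lambda>y. 1 - ((Re y)\<^sup>2 + (Im y)\<^sup>2) / r\<^sup>2) has_derivative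
     (\<lambda>t. - (2 * Re y * Re t + 2 * Im y * Im t) / r\<^sup>2)) (at y)"
    unfolding divide_inverse by (auto intro!: derivative_eq_intros simp: algebra_simps)
  from has_derivative_compose[OF this DERIV_max_power[of n, THEN has_field_derivative_imp_has_derivative]]
  show ?thesis unfolding bump_def
    by (rule has_derivative_eq_rhs) (auto simp: fun_eq_iff divide_inverse algebra_simps)
qed

lemma integral_bump_ge:
  assumes "r > 0" "k > 0"
  shows "integrable lborel (\<lambda>z. bump r k (z - w))" "(3/4) ^ k * (pi * (r/2)\<^sup>2) \<le> (LINT z|lborel. bump r k (z - w))"
proof -
  show i: "integrable lborel (\<lambda>z. bump r k (z - w))"
    by (rule integrable_compact_support[of _ "cball w r"])
       (auto intro!: continuous_intros bump_eq_0 assms simp: dist_norm norm_minus_commute)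
  have "(3/4) ^ k * (pi * (r/2)\<^sup>2) = (LINT z|lborel. (3/4) ^ k * indicator (cball w (r/2)) z)"
    using assms by (simp add: content_cball unit_ball_vol_2)
  also have "\<dots> \<le> (LINT z|lborel. bump r k (z - w))"
  proof (rule integral_mono[OF _ i])
    show "integrable lborel (\<lambda>z. (3/4) ^ k * indicator (cball w (r/2)) z :: real)"
      using emeasure_bounded_finite[of "cball w (r/2)"] by simp
    fix z
    show "(3/4) ^ k * indicator (cball w (r/2)) z \<le> bump r k (z - w)"
    proof (cases "z \<in> cball w (r/2)")
      case True
      then have "(cmod (z - w))\<^sup>2 \<le> (r/2)\<^sup>2" by (intro power_mono) (auto simp: dist_norm norm_minus_commute)
      then have "((Re (z-w))\<^sup>2 + (Im (z-w))\<^sup>2) / r\<^sup>2 \<le> (r/2)\<^sup>2 / r\<^sup>2"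
        unfolding cmod_power2 by (intro divide_right_mono) auto
      then have "3/4 \<le> 1 - ((Re (z-w))\<^sup>2 + (Im (z-w))\<^sup>2) / r\<^sup>2"
        using assms by (simp add: power2_eq_square)
      then have "(3/4) ^ k \<le> bump r k (z - w)" unfolding bump_def by (intro power_mono[OF order_trans[OF _ max.cobounded2]]) auto
      then show ?thesis using True by simp
    qed (simp add: bump_nonneg)
  qed
  finally show "(3/4) ^ k * (pi * (r/2)\<^sup>2) \<le> (LINT z|lborel. bump r k (z - w))" .
qed

lemma integral_bump_2_ge:
  assumes "r > 0"
  shows "r\<^sup>2 / 4 \<le> (LINT z|lborel. bump r 2 (z - w))"
proof -
  have "r\<^sup>2 / 4 \<le> (3/4) ^ 2 * (pi * (r/2)\<^sup>2)" using pi_ge_two assms by (simp add: power2_eq_square field_simps)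
  then show ?thesis using integral_bump_ge(2)[OF assms, of 2 w] by linarith
qed

lemma has_field_derivative_pderivs:
  "(f has_field_derivative D) (at z) \<Longrightarrow> pderivs f D (\<i> * D) z"
  unfolding has_field_derivative_def
  by (erule has_derivative_eq_rhs) (auto simp: fun_eq_iff complex_eq_iff algebra_simps)

lemma holomorphic_pderivs:
  "f holomorphic_on S \<Longrightarrow> open S \<Longrightarrow> z \<in> S \<Longrightarrow> pderivs f (deriv f z) (\<i> * deriv f z) z"
  using has_field_derivative_pderivs holomorphic_derivI by blast

text \<open>Let k(z) = (g(z) - g(w)) / (z - w). Since (d_x + i d_y) of the cubic bump is -6/r^2 (z -
  w) times the quadratic one, and k is holomorphic, (d_x + i d_y) of bump times k is -6/r^2 times
  the integrand here. Its integral therefore vanishes.\<close>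

lemma holomorphic_mean_value:
  assumes g: "g holomorphic_on S" and S: "open S" "cball w r \<subseteq> S" and r: "r > 0"
  shows "(LINT z|lborel. bump r 2 (z - w) *\<^sub>R (g z - g w)) = 0"
proof -
  have wS: "w \<in> S" using S r by auto
  \<comment> \<open>The removable singularity at w is filled in, so that k is holomorphic on all of
    S.\<close>
  define k where "k z = (if z = w then deriv g w else (g z - g w) / (z - w))" for z
  have k: "k holomorphic_on S" unfolding k_def using pole_lemma_open[OF g S(1)] .
  define b2 b3 where "b2 z = bump r 2 (z - w)" and "b3 z = bump r 3 (z - w)" for z
  define f where "f z = b3 z *\<^sub>R k z" for z
  define bX bY where "bX z = - 6 / r\<^sup>2 * Re (z - w) * b2 z" and "bY z = - 6 / r\<^sup>2 * Im (z - w) * b2 z" for z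
  define fx fy where "fx z = bX z *\<^sub>R k z + b3 z *\<^sub>R deriv k z" 
    and "fy z = bY z *\<^sub>R k z + b3 z *\<^sub>R (\<i> * deriv k z)" for z
  have b3: "pderivs b3 (bX z) (bY z) z" for z
  proof -
    have "((\<lambda>z. z - w) has_derivative (\<lambda>t. t)) (at z)" by (auto intro!: derivative_eq_intros)
    from has_derivative_compose[OF this bump_pderivs[of r 1]]
    show ?thesis by (simp add: b3_def[abs_def] bX_def bY_def b2_def numeral_2_eq_2 numeral_3_eq_3)
  qed
  have z: "b2 z = 0" "b3 z = 0" if "z \<notin> cball w r" for z
    using that r by (auto simp: b2_def b3_def dist_norm norm_minus_commute intro!: bump_eq_0)
  have ck: "continuous_on S k" "continuous_on S (deriv k)"
    using k S holomorphic_on_imp_continuous_on holomorphic_deriv by auto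
  have cb: "continuous_on A b2" "continuous_on A b3" for A
    unfolding b2_def[abs_def] b3_def[abs_def] by (auto intro!: continuous_intros)
  have cf: "continuous_on S fx" "continuous_on S fy"
    unfolding fx_def[abs_def] fy_def[abs_def] bX_def bY_def by (intro continuous_intros ck cb)+
  have zf: "f z = 0" "fx z = 0" "fy z = 0" if "z \<notin> cball w r" for z
    using z[OF that] by (simp_all add: f_def fx_def fy_def bX_def bY_def)
  have d: "pderivs f (fx z) (fy z) z" if "z \<in> S" for z
    unfolding f_def fx_def fy_def
    by (rule has_derivative_eq_rhs[OF has_derivative_scaleR[OF b3 holomorphic_pderivs[OF k S(1) that]]])
       (auto simp: fun_eq_iff algebra_simps)
  note I = integral_pderiv_eq_0[OF S(1) compact_cball S(2) d cf zf]
  have int: "integrable lborel fx" "integrable lborel fy"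
    using integrable_compact_support[OF continuous_zero_extension[OF S(1) compact_cball S(2) cf(1) zf(2)] compact_cball zf(2)]
      integrable_compact_support[OF continuous_zero_extension[OF S(1) compact_cball S(2) cf(2) zf(3)] compact_cball zf(3)] by auto
  have "0 = integral\<^sup>L lborel fx + \<i> * integral\<^sup>L lborel fy" using I by simp
  also have "\<dots> = (LINT z|lborel. fx z + \<i> * fy z)" using int by simp
  also have "\<dots> = (LINT z|lborel. (- 6 / r\<^sup>2) *\<^sub>R (b2 z *\<^sub>R (g z - g w)))"
  proof (rule Bochner_Integration.integral_cong)
    fix z
    have "fx z + \<i> * fy z = (- 6 / r\<^sup>2 * b2 z) *\<^sub>R ((z - w) * k z)"
      by (simp add: fx_def fy_def bX_def bY_def scaleR_conv_of_real complex_eq_iff divide_inverse algebra_simps)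
    also have "(z - w) * k z = g z - g w" by (simp add: k_def)
    finally show "fx z + \<i> * fy z = (- 6 / r\<^sup>2) *\<^sub>R (b2 z *\<^sub>R (g z - g w))" by simp
  qed simp
  also have "\<dots> = (- 6 / r\<^sup>2) *\<^sub>R (LINT z|lborel. b2 z *\<^sub>R (g z - g w))"
    by (rule Bochner_Integration.integral_scaleR_right)
  finally show ?thesis using r by (simp add: b2_def)
qed

text \<open>The mean value identity is applied to the square of g; the bump lies between 0 and the
  indicator of the disc, and its integral is at least r^2 / 4.\<close>

lemma L2_mean_value_inequality:
  assumes g: "g holomorphic_on S" and S: "open S" "cball w r \<subseteq> S" and r: "r > 0"
  shows "r\<^sup>2 / 4 * (cmod (g w))\<^sup>2 \<le> (LINT z|lborel. indicator (cball w r) z * (cmod (g z))\<^sup>2)"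
proof -
  have hol: "(\<lambda>z. (g z)\<^sup>2) holomorphic_on S" using g by (intro holomorphic_intros)
  have cg: "continuous_on S (\<lambda>z. (g z)\<^sup>2)" using hol holomorphic_on_imp_continuous_on by blast
  let ?b = "\<lambda>z. bump r 2 (z - w)"
  have z: "?b z = 0" if "z \<notin> cball w r" for z
    using that r by (auto simp: dist_norm norm_minus_commute intro!: bump_eq_0)
  have i1: "integrable lborel (\<lambda>z. ?b z *\<^sub>R (g z)\<^sup>2)"
    by (rule integrable_compact_support[OF continuous_zero_extension[OF S(1) compact_cball S(2)] compact_cball])
       (auto intro!: continuous_intros cg z)
  have i2: "integrable lborel (\<lambda>z. ?b z *\<^sub>R (g w)\<^sup>2)" using integral_bump_ge(1)[OF r] by auto
  have i3: "integrable lborel (\<lambda>z. indicator (cball w r) z *\<^sub>R (cmod (g z))\<^sup>2)"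
    using holomorphic_on_imp_continuous_on[OF g] S(2)
    by (intro borel_integrable_compact continuous_intros) (auto intro: continuous_on_subset)
  have "(LINT z|lborel. ?b z *\<^sub>R (g w)\<^sup>2) = (LINT z|lborel. ?b z *\<^sub>R (g z)\<^sup>2)"
    using holomorphic_mean_value[OF hol S r] i1 i2 by (simp add: scaleR_diff_right)
  then have eq: "(LINT z|lborel. ?b z) *\<^sub>R (g w)\<^sup>2 = (LINT z|lborel. ?b z *\<^sub>R (g z)\<^sup>2)" 
    using integral_scaleR_left[of "(g w)\<^sup>2" lborel ?b] integral_bump_ge(1)[OF r, of 2] by simp
  have "r\<^sup>2 / 4 * (cmod (g w))\<^sup>2 \<le> (LINT z|lborel. ?b z) * (cmod (g w))\<^sup>2"
    using integral_bump_2_ge[OF r] by (intro mult_right_mono) auto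
  also have "\<dots> = norm ((LINT z|lborel. ?b z) *\<^sub>R (g w)\<^sup>2)"
    using integral_bump_2_ge[OF r, of w] r 
    by (simp add: norm_power) (smt (verit) zero_le_power2 zero_le_divide_iff)
  also have "\<dots> \<le> (LINT z|lborel. indicator (cball w r) z *\<^sub>R (cmod (g z))\<^sup>2)"
    unfolding eq
  proof (rule Bochner_Integration.integral_norm_bound_integral[OF i1 i3])
    fix x show "norm (?b x *\<^sub>R (g x)\<^sup>2) \<le> indicator (cball w r) x *\<^sub>R (cmod (g x))\<^sup>2"
      using z[of x] bump_nonneg[of r 2 "x - w"] bump_le_1[of r 2 "x - w"]
      by (cases "x \<in> cball w r") (auto simp: norm_power intro!: mult_left_le_one_le)
  qed
  finally show ?thesis by simp
qed

section \<open>The a priori estimate\<close>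

text \<open>Hoermander's identity. Pointwise, |b_x - i b_y|^2 e^\<phi> equals the Laplacian of
  \<phi> times |b|^2 e^\<phi>, plus |2 e^(-\<phi>) dbar(e^\<phi> b)|^2 e^\<phi>, plus a divergence.
  The square is dropped and the divergence integrates to 0. The function b carries a single mixed
  derivative \<open>bxy\<close> for both orders, since the second-order terms of b have to cancel in
  the divergence.\<close>

lemma a_priori_estimate:
  fixes \<phi> :: "complex \<Rightarrow> real" and b :: "complex \<Rightarrow> complex"
  assumes S: "open S" "compact K" "K \<subseteq> S"
    and p: "\<And>z. z \<in> S \<Longrightarrow> pderivs \<phi> (px z) (py z) z"
       "\<And>z. z \<in> S \<Longrightarrow> pderivs px (pxx z) (pxy z) z" "\<And>z. z \<in> S \<Longrightarrow> pderivs py (pyx z) (pyy z) z"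
    and pc: "continuous_on S pxx" "continuous_on S pxy" "continuous_on S pyx" "continuous_on S pyy"
    and b: "\<And>z. pderivs b (bX z) (bY z) z" "\<And>z. pderivs bX (bxx z) (bxy z) z" "\<And>z. pderivs bY (bxy z) (byy z) z"
    and bc: "continuous_on UNIV bxx" "continuous_on UNIV bxy" "continuous_on UNIV byy"
    and bz: "\<And>z. z \<notin> K \<Longrightarrow> b z = 0" "\<And>z. z \<notin> K \<Longrightarrow> bX z = 0" "\<And>z. z \<notin> K \<Longrightarrow> bY z = 0"
       "\<And>z. z \<notin> K \<Longrightarrow> bxx z = 0" "\<And>z. z \<notin> K \<Longrightarrow> bxy z = 0" "\<And>z. z \<notin> K \<Longrightarrow> byy z = 0"
  shows "(LINT z|lborel. (pxx z + pyy z) * (cmod (b z))\<^sup>2 * exp (\<phi> z))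
       \<le> (LINT z|lborel. (cmod (bX z - \<i> * bY z))\<^sup>2 * exp (\<phi> z))"
proof -
  define a c where "a z = Re (b z)" and "c z = Im (b z)" for z
  define ax ay cx cy where "ax z = Re (bX z)" and "ay z = Re (bY z)" and "cx z = Im (bX z)" and "cy z = Im (bY z)" for z
  define axx axy ayy cxx cxy cyy where "axx z = Re (bxx z)" and "axy z = Re (bxy z)" and "ayy z = Re (byy z)"
    and "cxx z = Im (bxx z)" and "cxy z = Im (bxy z)" and "cyy z = Im (byy z)" for z
  have d1: "(a has_derivative (\<lambda>t. Re t * ax z + Im t * ay z)) (at z)" 
     "(ax has_derivative (\<lambda>t. Re t * axx z + Im t * axy z)) (at z)"
     "(ay has_derivative (\<lambda>t. Re t * axy z + Im t * ayy z)) (at z)" for z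
    using has_derivative_Re[OF b(1)[of z]] has_derivative_Re[OF b(2)[of z]] has_derivative_Re[OF b(3)[of z]]
    by (simp_all add: a_def[abs_def] ax_def[abs_def] ay_def[abs_def] axx_def axy_def ayy_def)
  have d2: "(c has_derivative (\<lambda>t. Re t * cx z + Im t * cy z)) (at z)" 
     "(cx has_derivative (\<lambda>t. Re t * cxx z + Im t * cxy z)) (at z)"
     "(cy has_derivative (\<lambda>t. Re t * cxy z + Im t * cyy z)) (at z)" for z
    using has_derivative_Im[OF b(1)[of z]] has_derivative_Im[OF b(2)[of z]] has_derivative_Im[OF b(3)[of z]]
    by (simp_all add: c_def[abs_def] cx_def[abs_def] cy_def[abs_def] cxx_def cxy_def cyy_def)
  have d3: "(\<phi> has_derivative (\<lambda>t. Re t * px z + Im t * py z)) (at z)" 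
     "(px has_derivative (\<lambda>t. Re t * pxx z + Im t * pxy z)) (at z)"
     "(py has_derivative (\<lambda>t. Re t * pyx z + Im t * pyy z)) (at z)" if "z \<in> S" for z
    using p[OF that] by simp_all
  have cont: "continuous_on S f" if "\<And>z. z \<in> S \<Longrightarrow> (f has_derivative f' z) (at z)" for f :: "complex \<Rightarrow> real" and f'
    using that has_derivative_continuous continuous_at_imp_continuous_on by blast
  have cS: "continuous_on S a" "continuous_on S ax" "continuous_on S ay" "continuous_on S c" "continuous_on S cx" "continuous_on S cy"
    "continuous_on S \<phi>" "continuous_on S px" "continuous_on S py"
    by (rule cont, rule d1 d2 d3, assumption?)+
  have cS2: "continuous_on S axx" "continuous_on S axy" "continuous_on S ayy" "continuous_on S cxx" "continuous_on S cxy" "continuous_on S cyy"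
    unfolding axx_def[abs_def] axy_def[abs_def] ayy_def[abs_def] cxx_def[abs_def] cxy_def[abs_def] cyy_def[abs_def]
    by (intro continuous_intros continuous_on_subset[OF bc(1)] continuous_on_subset[OF bc(2)] continuous_on_subset[OF bc(3)]; simp)+
  have zK: "a z = 0" "ax z = 0" "ay z = 0" "axx z = 0" "axy z = 0" "ayy z = 0"
     "c z = 0" "cx z = 0" "cy z = 0" "cxx z = 0" "cxy z = 0" "cyy z = 0" if "z \<notin> K" for z
    using bz that by (simp_all add: a_def c_def ax_def ay_def cx_def cy_def axx_def axy_def ayy_def cxx_def cxy_def cyy_def)
  \<comment> \<open>The vector field whose divergence is the exact term of the identity; a and c are
    the real and imaginary parts of b.\<close>
  define X Y where "X z = exp (\<phi> z) * (2 * (a z * cy z - c z * ay z) - px z * (a z * a z + c z * c z))"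
    and "Y z = - exp (\<phi> z) * (2 * (a z * cx z - c z * ax z) + py z * (a z * a z + c z * c z))" for z
  define Xx where "Xx z = exp (\<phi> z) * (px z * (2 * (a z * cy z - c z * ay z) - px z * (a z * a z + c z * c z))
      + 2 * (ax z * cy z + a z * cxy z - cx z * ay z - c z * axy z)
      - pxx z * (a z * a z + c z * c z) - 2 * px z * (a z * ax z + c z * cx z))" for z
  define Xy where "Xy z = exp (\<phi> z) * (py z * (2 * (a z * cy z - c z * ay z) - px z * (a z * a z + c z * c z))
      + 2 * (ay z * cy z + a z * cyy z - cy z * ay z - c z * ayy z)
      - pxy z * (a z * a z + c z * c z) - 2 * px z * (a z * ay z + c z * cy z))" for z
  define Yx where "Yx z = - exp (\<phi> z) * (px z * (2 * (a z * cx z - c z * ax z) + py z * (a z * a z + c z * c z))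
      + 2 * (ax z * cx z + a z * cxx z - cx z * ax z - c z * axx z)
      + pyx z * (a z * a z + c z * c z) + 2 * py z * (a z * ax z + c z * cx z))" for z
  define Yy where "Yy z = - exp (\<phi> z) * (py z * (2 * (a z * cx z - c z * ax z) + py z * (a z * a z + c z * c z))
      + 2 * (ay z * cx z + a z * cxy z - cy z * ax z - c z * axy z)
      + pyy z * (a z * a z + c z * c z) + 2 * py z * (a z * ay z + c z * cy z))" for z
  have dX: "pderivs X (Xx z) (Xy z) z" if "z \<in> S" for z
    unfolding X_def[abs_def] 
    by (rule has_derivative_eq_rhs, (rule d1 d2 d3[OF that] has_derivative_mult has_derivative_diff has_derivative_add
          has_derivative_minus has_derivative_exp has_derivative_power has_derivative_const)+)
       (rule ext, simp only: Xx_def Xy_def Yx_def Yy_def real_scaleR_def, algebra)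
  have dY: "pderivs Y (Yx z) (Yy z) z" if "z \<in> S" for z
    unfolding Y_def[abs_def] 
    by (rule has_derivative_eq_rhs, (rule d1 d2 d3[OF that] has_derivative_mult has_derivative_diff has_derivative_add
          has_derivative_minus has_derivative_exp has_derivative_power has_derivative_const)+)
       (rule ext, simp only: Xx_def Xy_def Yx_def Yy_def real_scaleR_def, algebra)
  have cX: "continuous_on S Xx" "continuous_on S Xy" "continuous_on S Yx" "continuous_on S Yy"
    unfolding Xx_def[abs_def] Xy_def[abs_def] Yx_def[abs_def] Yy_def[abs_def]
    by (intro continuous_intros cS cS2 pc)+
  have zX: "X z = 0" "Xx z = 0" "Xy z = 0" "Y z = 0" "Yx z = 0" "Yy z = 0" if "z \<notin> K" for z
    using zK[OF that] by (simp_all add: X_def Y_def Xx_def Xy_def Yx_def Yy_def)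
  have int: "integrable lborel f" if "continuous_on S f" "\<And>z. z \<notin> K \<Longrightarrow> f z = 0" for f :: "complex \<Rightarrow> real"
    using integrable_compact_support[OF continuous_zero_extension[OF S that] S(2) that(2)] .
  have IX: "integral\<^sup>L lborel Xx = 0" using integral_pderiv_eq_0(1)[OF S dX cX(1,2) zX(1,2,3)] .
  have IY: "integral\<^sup>L lborel Yy = 0" using integral_pderiv_eq_0(2)[OF S dY cX(3,4) zX(4,5,6)] .
  define P where "P z = (pxx z + pyy z) * (cmod (b z))\<^sup>2 * exp (\<phi> z)" for z
  define Q where "Q z = (cmod (bX z - \<i> * bY z))\<^sup>2 * exp (\<phi> z)" for z
  have P: "P z = (pxx z + pyy z) * (a z * a z + c z * c z) * exp (\<phi> z)" for z
    using cmod_power2[of "b z"] by (simp add: P_def a_def c_def power2_eq_square)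
  have Q: "Q z = ((ax z + cy z)\<^sup>2 + (cx z - ay z)\<^sup>2) * exp (\<phi> z)" for z
    by (simp add: Q_def cmod_power2 ax_def ay_def cx_def cy_def)
  have iP: "integrable lborel P"
    by (rule int) (auto simp: P[abs_def] zK intro!: continuous_intros cS pc)
  have iQ: "integrable lborel Q"
    by (rule int) (auto simp: Q[abs_def] zK intro!: continuous_intros cS)
  \<comment> \<open>The bracket is |(d_x + i d_y) b + (px + i py) b|^2, that is |2 e^(-\<phi>)
    dbar(e^\<phi> b)|^2.\<close>
  have "0 \<le> (LINT z|lborel. ((ax z - cy z + px z * a z - py z * c z)\<^sup>2 + (cx z + ay z + px z * c z + py z * a z)\<^sup>2) * exp (\<phi> z))"
    by (intro integral_nonneg_AE) auto
  also have "\<dots> = (LINT z|lborel. Q z - P z - (Xx z + Yy z))"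
    by (rule Bochner_Integration.integral_cong, rule refl)
       (simp only: P Q Xx_def Yy_def, algebra)
  also have "\<dots> = integral\<^sup>L lborel Q - integral\<^sup>L lborel P"
    using iP iQ int[OF cX(1) zX(2)] int[OF cX(4) zX(6)] IX IY by simp
  finally show ?thesis by (simp add: P_def[abs_def] Q_def[abs_def])
qed

section \<open>Local harmonic approximation of the weight\<close>

lemma second_derivative_local_max:
  fixes f f' :: "real \<Rightarrow> real"
  assumes d: "d > 0" and f: "\<And>t. \<bar>t\<bar> < d \<Longrightarrow> (f has_real_derivative f' t) (at t)"
    and f': "(f' has_real_derivative D) (at 0)" and m: "\<And>t. \<bar>t\<bar> < d \<Longrightarrow> f t \<le> f 0"
  shows "D \<le> 0"
proof (rule ccontr)
  assume "\<not> D \<le> 0"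
  then have D: "D > 0" by simp
  have 0: "f' 0 = 0"
    using DERIV_local_max[OF f[of 0] d] m d by simp
  obtain e where e: "e > 0" "\<And>h. 0 < h \<Longrightarrow> h < e \<Longrightarrow> f' 0 < f' (0 + h)"
    using DERIV_pos_inc_right[OF f' D] by blast
  define h where "h = min d e / 2"
  have h: "0 < h" "h < d" "h < e" using d e by (auto simp: h_def)
  obtain z where z: "0 < z" "z < h" "f h - f 0 = (h - 0) * f' z"
    using MVT2[of 0 h f f'] f h by auto
  have "f' z > 0" using e(2)[of z] z h 0 by simp
  then have "f h > f 0" using z h by (smt (verit) mult_pos_pos)
  with m[of h] h show False by simp
qed

lemma pderivs_lines:
  assumes "pderivs f (fx :: real) fy (z + of_real t * v)"
  shows "((\<lambda>t. f (z + of_real t * v)) has_real_derivative (Re v * fx + Im v * fy)) (at t)"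
proof -
  have "((\<lambda>t. z + of_real t * v) has_derivative (\<lambda>s. of_real s * v)) (at t)"
    by (auto intro!: derivative_eq_intros)
  from has_derivative_compose[OF this assms]
  show ?thesis unfolding has_field_derivative_def
    by (rule has_derivative_eq_rhs) (auto simp: fun_eq_iff algebra_simps)
qed

text \<open>At an interior maximum both pure second derivatives are at most 0, which a positive
  Laplacian forbids. Strict positivity spares the usual perturbation; the later uses arrange for
  it.\<close>

lemma strict_maximum_principle:
  fixes G :: "complex \<Rightarrow> real"
  assumes R: "R > 0" and c: "continuous_on (cball w R) G"
    and d: "\<And>z. z \<in> ball w R \<Longrightarrow> pderivs G (Gx z) (Gy z) z"
      "\<And>z. z \<in> ball w R \<Longrightarrow> pderivs Gx (Gxx z) (Gxy z) z" "\<And>z. z \<in> ball w R \<Longrightarrow> pderivs Gy (Gyx z) (Gyy z) z"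
    and pos: "\<And>z. z \<in> ball w R \<Longrightarrow> Gxx z + Gyy z > 0"
    and b: "\<And>z. z \<in> sphere w R \<Longrightarrow> G z \<le> M" and z: "z \<in> cball w R"
  shows "G z \<le> M"
proof -
  have "cball w R \<noteq> {}" using R by auto
  then obtain z0 where z0: "z0 \<in> cball w R" "\<And>z. z \<in> cball w R \<Longrightarrow> G z \<le> G z0"
    using continuous_attains_sup[OF compact_cball _ c] by blast
  show ?thesis
  proof (cases "z0 \<in> sphere w R")
    case True then show ?thesis using b[of z0] z0(2)[OF z] by simp
  next
    case False
    then have "z0 \<in> ball w R" using z0(1) by auto
    then obtain e where e: "e > 0" "ball z0 e \<subseteq> ball w R"
      using open_ball open_contains_ball by blast
    have inb: "z0 + of_real t * v \<in> ball w R" if "\<bar>t\<bar> < e" "norm v = 1" for t v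
      using e(2) that by (auto simp: dist_norm norm_mult subset_iff)
    have le: "G (z0 + of_real t * v) \<le> G (z0 + of_real 0 * v)" if "\<bar>t\<bar> < e" "norm v = 1" for t v
      using z0(2)[of "z0 + of_real t * v"] inb[OF that] by auto
    have D: "((\<lambda>t. G (z0 + of_real t * 1)) has_real_derivative Gx (z0 + of_real t * 1)) (at t)"
            "((\<lambda>t. G (z0 + of_real t * \<i>)) has_real_derivative Gy (z0 + of_real t * \<i>)) (at t)" if "\<bar>t\<bar> < e" for t
      using pderivs_lines[OF d(1)[OF inb[OF that, of 1]]] pderivs_lines[OF d(1)[OF inb[OF that, of \<i>]]] by simp_all
    have D2: "((\<lambda>t. Gx (z0 + of_real t * 1)) has_real_derivative Gxx z0) (at 0)"
             "((\<lambda>t. Gy (z0 + of_real t * \<i>)) has_real_derivative Gyy z0) (at 0)"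
      using pderivs_lines[OF d(2)[OF inb[of 0 1]]] pderivs_lines[OF d(3)[OF inb[of 0 \<i>]]] e by simp_all
    have "Gxx z0 \<le> 0"
      by (rule second_derivative_local_max[OF e(1) D(1) D2(1)]) (use le[of _ 1] in auto)
    moreover have "Gyy z0 \<le> 0"
      by (rule second_derivative_local_max[OF e(1) D(2) D2(2)]) (use le[of _ \<i>] in auto)
    ultimately show ?thesis using pos[OF \<open>z0 \<in> ball w R\<close>] by simp
  qed
qed

text \<open>On the circle of radius \<open>R\<close> the conjugate of \<open>y\<close> is \<open>R\<^sup>2 / y\<close>, so products of real parts of
  polynomials are again real parts of polynomials.\<close>

lemma Re_poly_mult_cnj_on_circle:
  "\<exists>s. \<forall>y. cmod y = R \<longrightarrow> Re (poly p y * cnj (poly q y)) = Re (poly s y)"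
proof (induction p arbitrary: q)
  case 0
  show ?case by (intro exI[of _ 0]) simp
next
  case (pCons a p)
  obtain b q' where q: "q = pCons b q'" by (cases q)
  obtain s where s: "\<And>y. cmod y = R \<Longrightarrow> Re (poly p y * cnj (poly q' y)) = Re (poly s y)"
    using pCons.IH by blast
  show ?case
  proof (intro exI allI impI)
    fix y assume y: "cmod y = R"
    have yy: "Re y * Re y + Im y * Im y = R\<^sup>2"
      using y cmod_power2[of y] by (simp add: power2_eq_square)
    have "Re (poly (pCons a p) y * cnj (poly q y)) =
       Re (a * cnj b + cnj a * (y * poly q' y) + cnj b * (y * poly p y)) + (Re y * Re y + Im y * Im y) * Re (poly p y * cnj (poly q' y))"
      by (simp add: q algebra_simps)
    also have "\<dots> = Re (poly ([:a * cnj b:] + smult (cnj a) (pCons 0 q') + smult (cnj b) (pCons 0 p) + smult (of_real (R\<^sup>2)) s) y)"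
      unfolding yy s[OF y] by (simp add: algebra_simps)
    finally show "Re (poly (pCons a p) y * cnj (poly q y)) =
      Re (poly ([:a * cnj b:] + smult (cnj a) (pCons 0 q') + smult (cnj b) (pCons 0 p) + smult (of_real (R\<^sup>2)) s) y)" .
  qed
qed

lemma Re_poly_mult_on_circle:
  "\<exists>s. \<forall>y. cmod y = R \<longrightarrow> Re (poly p y) * Re (poly q y) = Re (poly s y)"
proof -
  obtain s where s: "\<And>y. cmod y = R \<Longrightarrow> Re (poly p y * cnj (poly q y)) = Re (poly s y)"
    using Re_poly_mult_cnj_on_circle by blast
  \<comment> \<open>Re a * Re b is half the real part of a b + a * cnj b.\<close>
  have "Re (poly p y) * Re (poly q y) = Re (poly (smult (1/2) (p * q + s)) y)" if "cmod y = R" for y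
    using s[OF that] by (simp add: field_simps)
  then show ?thesis by blast
qed

text \<open>Stone-Weierstrass for real parts of polynomials. It replaces solving the Dirichlet
  problem: the polynomial approximates the boundary values on the circle, its real part is harmonic
  inside, and a bounded error is harmless because the weight is only needed up to constant
  factors.\<close>

lemma Re_poly_approximation_on_circle:
  fixes \<psi> :: "complex \<Rightarrow> real"
  assumes c: "continuous_on (sphere w R) \<psi>" and e: "e > 0"
  obtains p where "\<And>z. z \<in> sphere w R \<Longrightarrow> \<bar>\<psi> z - Re (poly p (z - w))\<bar> < e"
proof -
  define P where "P = {f. continuous_on (sphere w R) f \<and> (\<exists>p. \<forall>z\<in>sphere w R. f z = Re (poly p (z - w)))}"
  have n: "cmod (z - w) = R" if "z \<in> sphere w R" for z
    using that by (simp add: dist_norm norm_minus_commute)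
  have in_P: "(\<lambda>z. Re (poly p (z - w))) \<in> P" for p
    unfolding P_def by (auto intro!: continuous_intros)
  interpret function_ring_on P "sphere w R"
  proof
    show "compact (sphere w R)" by simp
    show "continuous_on (sphere w R) f" if "f \<in> P" for f using that by (simp add: P_def)
    show "(\<lambda>x. f x + g x) \<in> P" if fg: "f \<in> P" "g \<in> P" for f g
    proof -
      obtain p q where "\<forall>z\<in>sphere w R. f z = Re (poly p (z - w))" "\<forall>z\<in>sphere w R. g z = Re (poly q (z - w))"
        using fg by (auto simp: P_def)
      then have "\<forall>z\<in>sphere w R. f z + g z = Re (poly (p + q) (z - w))" by simp
      then show ?thesis using fg unfolding P_def by (blast intro: continuous_on_add)
    qed
    show "(\<lambda>x. f x * g x) \<in> P" if fg: "f \<in> P" "g \<in> P" for f g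
    proof -
      obtain p q where "\<forall>z\<in>sphere w R. f z = Re (poly p (z - w))" "\<forall>z\<in>sphere w R. g z = Re (poly q (z - w))"
        using fg by (auto simp: P_def)
      moreover obtain s where "\<And>y. cmod y = R \<Longrightarrow> Re (poly p y) * Re (poly q y) = Re (poly s y)"
        using Re_poly_mult_on_circle by blast
      ultimately have "\<forall>z\<in>sphere w R. f z * g z = Re (poly s (z - w))" using n by simp
      then show ?thesis using fg unfolding P_def by (blast intro: continuous_on_mult)
    qed
    show "(\<lambda>_. c) \<in> P" for c using in_P[of "[:of_real c:]"] by simp
    show "\<exists>f\<in>P. f x \<noteq> f y" if "x \<noteq> y" for x y
    proof (cases "Re x = Re y")
      case False then show ?thesis using in_P[of "[:0, 1:]"] by (intro bexI[of _ "\<lambda>z. Re (poly [:0, 1:] (z - w))"]) auto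
    next
      case True
      then have "Im x \<noteq> Im y" using that complex_eqI by blast
      then show ?thesis using in_P[of "[:0, \<i>:]"] by (intro bexI[of _ "\<lambda>z. Re (poly [:0, \<i>:] (z - w))"]) auto
    qed
  qed
  obtain g where "g \<in> P" "\<forall>x\<in>sphere w R. \<bar>\<psi> x - g x\<bar> < e" using Stone_Weierstrass_basic[OF c e] by blast
  moreover then obtain p where "\<forall>z\<in>sphere w R. g z = Re (poly p (z - w))" unfolding P_def by blast
  ultimately show ?thesis by (intro that[of p]) simp
qed

text \<open>The factor c takes the values 1 and \<i>, because the partials of Re h are Re h' and Re
  (\<i> h'). The lemma can thus be iterated for second derivatives.\<close>

lemma Re_holomorphic_pderivs:
  assumes "h holomorphic_on UNIV"
  shows "pderivs (\<lambda>z. Re (c * h z)) (Re (c * deriv h z)) (Re (c * \<i> * deriv h z)) z"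
proof -
  have "(h has_field_derivative deriv h z) (at z)"
    using assms by (auto intro!: holomorphic_derivI[where S=UNIV])
  then have "((\<lambda>z. c * h z) has_field_derivative c * deriv h z) (at z)" by (rule DERIV_cmult)
  from has_derivative_Re[OF has_field_derivative_pderivs[OF this]]
  show ?thesis by (rule has_derivative_eq_rhs) (auto simp: fun_eq_iff algebra_simps)
qed

text \<open>The Laplacian is always read off as \<open>fxx + fyy\<close>. The two mixed derivatives
  are separate functions because that is how they come out of the second derivative in
  \<open>C2_on\<close>.\<close>

definition C2_data where
  "C2_data S (f :: complex \<Rightarrow> real) fx fy fxx fxy fyx fyy \<longleftrightarrow>
     (\<forall>z\<in>S. pderivs f (fx z) (fy z) z \<and> pderivs fx (fxx z) (fxy z) z \<and> pderivs fy (fyx z) (fyy z) z) \<and>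
     continuous_on S fxx \<and> continuous_on S fxy \<and> continuous_on S fyx \<and> continuous_on S fyy"

lemma C2_data_continuous:
  assumes "C2_data S f fx fy fxx fxy fyx fyy"
  shows "continuous_on S f" "continuous_on S fx" "continuous_on S fy"
  using assms unfolding C2_data_def
  by (meson has_derivative_continuous continuous_at_imp_continuous_on)+

text \<open>Both \<psi> - Re h and Re h - \<psi> + A/4 |z - w|^2 have positive Laplacian, so each is
  bounded by its values on the circle, where |\<psi> - Re h| < 1.\<close>

lemma local_harmonic_majorant:
  fixes \<psi> :: "complex \<Rightarrow> real"
  assumes C: "C2_data S \<psi> px py pxx pxy pyx pyy" and S: "cball w R \<subseteq> S" "R > 0"
    and pos: "\<And>z. z \<in> cball w R \<Longrightarrow> 0 < pxx z + pyy z" "\<And>z. z \<in> cball w R \<Longrightarrow> pxx z + pyy z < A"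
  obtains h where "h holomorphic_on UNIV" 
    "\<And>z. z \<in> cball w R \<Longrightarrow> - 1 \<le> Re (h z) - \<psi> z"
    "\<And>z. z \<in> cball w R \<Longrightarrow> Re (h z) - \<psi> z \<le> 1 + A * R\<^sup>2 / 4"
proof -
  have cc: "continuous_on (cball w R) \<psi>" using C2_data_continuous(1)[OF C] S continuous_on_subset by blast
  then have "continuous_on (sphere w R) \<psi>" using continuous_on_subset sphere_cball by blast
  then obtain p where p: "\<And>z. z \<in> sphere w R \<Longrightarrow> \<bar>\<psi> z - Re (poly p (z - w))\<bar> < 1"
    using Re_poly_approximation_on_circle[of w R \<psi> 1] by auto
  define h where "h z = poly p (z - w)" for z
  have h: "h holomorphic_on UNIV" unfolding h_def by (intro holomorphic_intros)
  have h': "deriv h holomorphic_on UNIV" using h by (intro holomorphic_deriv) auto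
  have ch: "continuous_on A h" for A
    using holomorphic_on_imp_continuous_on[OF h] continuous_on_subset by blast
  note H = Re_holomorphic_pderivs[OF h, of 1, simplified] Re_holomorphic_pderivs[OF h', of 1, simplified]
      Re_holomorphic_pderivs[OF h', of \<i>, simplified]
  have P: "pderivs \<psi> (px z) (py z) z" "pderivs px (pxx z) (pxy z) z" "pderivs py (pyx z) (pyy z) z" if "z \<in> ball w R" for z
    using C S that unfolding C2_data_def by (auto simp: subset_iff)
  show ?thesis
  proof (rule that[OF h])
    fix z assume z: "z \<in> cball w R"
    have "\<psi> z - Re (h z) \<le> 1"
    proof (rule strict_maximum_principle[where w=w and R=R and G="\<lambda>z. \<psi> z - Re (h z)"])
      show "pderivs (\<lambda>z. \<psi> z - Re (h z)) (px z - Re (deriv h z)) (py z - Re (\<i> * deriv h z)) z" if "z \<in> ball w R" for z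
        by (rule has_derivative_eq_rhs[OF has_derivative_diff[OF P(1)[OF that] H(1)]]) (auto simp: algebra_simps)
      show "pderivs (\<lambda>z. px z - Re (deriv h z)) (pxx z - Re (deriv (deriv h) z)) (pxy z - Re (\<i> * deriv (deriv h) z)) z" if "z \<in> ball w R" for z
        by (rule has_derivative_eq_rhs[OF has_derivative_diff[OF P(2)[OF that] H(2)]]) (auto simp: algebra_simps)
      show "pderivs (\<lambda>z. py z - Re (\<i> * deriv h z)) (pyx z - Re (\<i> * deriv (deriv h) z)) (pyy z + Re (deriv (deriv h) z)) z" if "z \<in> ball w R" for z
        by (rule has_derivative_eq_rhs[OF has_derivative_diff[OF P(3)[OF that] Re_holomorphic_pderivs[OF h', of \<i>]]]) (auto simp: algebra_simps)
      show "\<psi> z - Re (h z) \<le> 1" if "z \<in> sphere w R" for z using p[OF that] by (simp add: h_def)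
    qed (use z pos S in \<open>auto intro!: continuous_intros cc ch\<close>)
    then show "- 1 \<le> Re (h z) - \<psi> z" by simp
    \<comment> \<open>Its Laplacian is the constant A, which exceeds that of \<psi>; on the circle
      it equals A R^2 / 4.\<close>
    define N where "N z = A / 4 * ((Re (z - w))\<^sup>2 + (Im (z - w))\<^sup>2)" for z
    have N: "pderivs N (A / 2 * Re (z - w)) (A / 2 * Im (z - w)) z" for z
      unfolding N_def[abs_def] by (auto intro!: derivative_eq_intros simp: fun_eq_iff field_simps)
    have N2: "pderivs (\<lambda>z. A / 2 * Re (z - w)) (A/2) 0 z" "pderivs (\<lambda>z. A / 2 * Im (z - w)) 0 (A/2) z" for z
      by (auto intro!: derivative_eq_intros simp: algebra_simps)
    have N3: "N z = A / 4 * (cmod (z - w))\<^sup>2" for z by (simp add: N_def cmod_power2)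
    have "Re (h z) - \<psi> z + N z \<le> 1 + A / 4 * R\<^sup>2"
    proof (rule strict_maximum_principle[where w=w and R=R and G="\<lambda>z. Re (h z) - \<psi> z + N z"])
      show "pderivs (\<lambda>z. Re (h z) - \<psi> z + N z) (Re (deriv h z) - px z + A / 2 * Re (z - w)) (Re (\<i> * deriv h z) - py z + A / 2 * Im (z - w)) z" if "z \<in> ball w R" for z
        by (rule has_derivative_eq_rhs[OF has_derivative_add[OF has_derivative_diff[OF H(1) P(1)[OF that]] N]]) (auto simp: algebra_simps)
      show "pderivs (\<lambda>z. Re (deriv h z) - px z + A / 2 * Re (z - w)) (Re (deriv (deriv h) z) - pxx z + A/2) (Re (\<i> * deriv (deriv h) z) - pxy z) z" if "z \<in> ball w R" for z
        by (rule has_derivative_eq_rhs[OF has_derivative_add[OF has_derivative_diff[OF H(2) P(2)[OF that]] N2(1)]]) (auto simp: algebra_simps)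
      show "pderivs (\<lambda>z. Re (\<i> * deriv h z) - py z + A / 2 * Im (z - w)) (Re (\<i> * deriv (deriv h) z) - pyx z) (- Re (deriv (deriv h) z) - pyy z + A/2) z" if "z \<in> ball w R" for z
        by (rule has_derivative_eq_rhs[OF has_derivative_add[OF has_derivative_diff[OF Re_holomorphic_pderivs[OF h', of \<i>] P(3)[OF that]] N2(2)]]) (auto simp: algebra_simps)
      show "Re (deriv (deriv h) z) - pxx z + A / 2 + (- Re (deriv (deriv h) z) - pyy z + A / 2) > 0" if "z \<in> ball w R" for z
        using pos(2)[of z] that by auto
      show "Re (h z) - \<psi> z + N z \<le> 1 + A / 4 * R\<^sup>2" if "z \<in> sphere w R" for z 
        using p[OF that] that by (simp add: h_def N3 dist_norm norm_minus_commute)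
      show "continuous_on (cball w R) (\<lambda>z. Re (h z) - \<psi> z + N z)"
        unfolding N_def by (intro continuous_intros cc ch)
    qed (use z S in auto)
    moreover have "A > 0" using pos[of w] S by (auto intro: less_trans)
    then have "N z \<ge> 0" by (simp add: N3)
    ultimately show "Re (h z) - \<psi> z \<le> 1 + A * R\<^sup>2 / 4" by simp
  qed
qed

section \<open>Riesz approximants, Cauchy-Schwarz and test functions\<close>

text \<open>A substitute for the Riesz representation theorem in a space that need not be complete:
  the functional \<open>l\<close> is represented by a Cauchy sequence.\<close>

lemma Riesz_approximants:
  fixes B :: "'a \<Rightarrow> 'a \<Rightarrow> real" and l :: "'a \<Rightarrow> real" and comb :: "real \<Rightarrow> 'a \<Rightarrow> 'a \<Rightarrow> 'a"
  assumes W: "x0 \<in> W" "\<And>s x y. x \<in> W \<Longrightarrow> y \<in> W \<Longrightarrow> comb s x y \<in> W"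
    and sym: "\<And>x y. x \<in> W \<Longrightarrow> y \<in> W \<Longrightarrow> B x y = B y x"
    and lin: "\<And>s x y z. x \<in> W \<Longrightarrow> y \<in> W \<Longrightarrow> z \<in> W \<Longrightarrow> B (comb s x y) z = B x z + s * B y z"
    and l: "\<And>s x y. x \<in> W \<Longrightarrow> y \<in> W \<Longrightarrow> l (comb s x y) = l x + s * l y"
    and pos: "\<And>x. x \<in> W \<Longrightarrow> B x x \<ge> 0"
    and bd: "\<And>x. x \<in> W \<Longrightarrow> (l x)\<^sup>2 \<le> A\<^sup>2 * B x x" and A: "A \<ge> 0"
  obtains X :: "nat \<Rightarrow> 'a" where "\<And>n. X n \<in> W" "\<And>n. B (X n) (X n) \<le> (A + 1)\<^sup>2"
    "\<And>e. e > 0 \<Longrightarrow> \<exists>N. \<forall>m\<ge>N. \<forall>n\<ge>N. B (comb (-1) (X m) (X n)) (comb (-1) (X m) (X n)) < e"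
    "\<And>y. y \<in> W \<Longrightarrow> (\<lambda>n. B (X n) y) \<longlonglongrightarrow> l y"
proof -
  \<comment> \<open>The energy functional whose minimiser would represent l; X is a minimising
    sequence.\<close>
  define J where "J x = B x x - 2 * l x" for x
  have labs: "\<bar>l x\<bar> \<le> A * sqrt (B x x)" if "x \<in> W" for x
    using real_sqrt_le_mono[OF bd[OF that]] A by (simp add: real_sqrt_mult)
  have Jge: "J x \<ge> - A\<^sup>2" if "x \<in> W" for x
  proof -
    have "0 \<le> (sqrt (B x x) - A)\<^sup>2" by simp
    also have "\<dots> = B x x - 2 * (A * sqrt (B x x)) + A\<^sup>2" 
      using pos[OF that] by (simp add: power2_diff algebra_simps)
    finally show ?thesis using labs[OF that] by (simp add: J_def)
  qed
  have bdd: "bdd_below (J ` W)" using Jge by (intro bdd_belowI[of _ "- A\<^sup>2"]) auto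
  define m where "m = Inf (J ` W)"
  have mle: "m \<le> J x" if "x \<in> W" for x unfolding m_def using bdd that by (intro cInf_lower) auto
  \<comment> \<open>The excess is a square because \<open>key\<close> extracts its square root,
    which gives the error 1 / (n + 1).\<close>
  have "\<exists>x\<in>W. J x < m + 1 / (real n + 1)\<^sup>2" for n :: nat
  proof -
    have "Inf (J ` W) < m + 1 / (real n + 1)\<^sup>2" by (simp add: m_def)
    then show ?thesis using cInf_lessD[of "J ` W"] W(1) by blast
  qed
  then obtain X where X: "\<And>n. X n \<in> W" "\<And>n::nat. J (X n) < m + 1 / (real n + 1)\<^sup>2" by metis
  \<comment> \<open>An approximate Euler equation: moving from X n by s times y cannot lower J below
    m, so a quadratic in s is nonnegative and its discriminant bounds
    \<open>B (X n) y - l y\<close>.\<close>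
  have key: "\<bar>B (X n) y - l y\<bar> \<le> sqrt (B y y) / (real n + 1)" if y: "y \<in> W" for n y
  proof -
    define c where "c = B (X n) y - l y"
    define \<delta> where "\<delta> = 1 / (real n + 1)\<^sup>2"
    have q: "0 \<le> 2 * s * c + s\<^sup>2 * B y y + \<delta>" for s
    proof -
      have "J (comb s (X n) y) = J (X n) + 2 * s * c + s\<^sup>2 * B y y"
        using X(1)[of n] y W(2) sym[of y "comb s (X n) y"] sym[of "X n" "comb s (X n) y"] sym[of y "X n"]
        by (simp add: J_def lin l c_def power2_eq_square algebra_simps)
      moreover have "m \<le> J (comb s (X n) y)" using mle W X y by blast
      ultimately show ?thesis using X(2)[of n] by (simp add: \<delta>_def)
    qed
    have "c\<^sup>2 \<le> B y y * \<delta>"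
    proof (cases "B y y = 0")
      case True
      have "c = 0"
      proof (rule ccontr)
        assume "c \<noteq> 0"
        with q[of "-(\<delta>+1)/(2*c)"] True show False by (simp add: field_simps)
      qed
      then show ?thesis using True by simp
    next
      case False
      with pos[OF y] have "B y y > 0" by simp
      with q[of "-c / B y y"] show ?thesis by (simp add: field_simps power2_eq_square)
    qed
    then have "sqrt (c\<^sup>2) \<le> sqrt (B y y * \<delta>)" by (rule real_sqrt_le_mono)
    then show ?thesis by (simp add: c_def \<delta>_def real_sqrt_mult real_sqrt_divide)
  qed
  show ?thesis
  proof (rule that[OF X(1)])
    fix n
    show "B (X n) (X n) \<le> (A + 1)\<^sup>2"
    proof -
      \<comment> \<open>The summand 1 in A + 1 is the slack of \<open>key\<close> at y = X n, where
        the factor 1 / (n + 1) is estimated by 1.\<close>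
      define r where "r = sqrt (B (X n) (X n))"
      have r: "r \<ge> 0" "r\<^sup>2 = B (X n) (X n)" using pos[OF X(1)] by (auto simp: r_def)
      have "r / (real n + 1) \<le> r" using r by (simp add: field_simps)
      then have "r\<^sup>2 \<le> A * r + r" using key[OF X(1), of n n] labs[OF X(1), of n] r by (simp add: r_def[symmetric])
      then have "r * r \<le> (A + 1) * r" by (simp add: power2_eq_square algebra_simps)
      then have "r \<le> A + 1" using r A by (cases "r = 0") auto
      then show ?thesis using r power_mono[of r "A + 1" 2] by simp
    qed
  next
    fix e :: real assume e: "e > 0"
    obtain N :: nat where N: "4 / e < N" using reals_Archimedean2 by blast
    show "\<exists>N. \<forall>m\<ge>N. \<forall>n\<ge>N. B (comb (-1) (X m) (X n)) (comb (-1) (X m) (X n)) < e"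
    proof (intro exI allI impI)
      fix m n assume mn: "N \<le> m" "N \<le> n"
      define d where "d = comb (-1) (X m) (X n)"
      have dW: "d \<in> W" using W X by (simp add: d_def)
      define r where "r = sqrt (B d d)"
      have r: "r \<ge> 0" "r\<^sup>2 = B d d" using pos[OF dW] by (auto simp: r_def)
      have "B d d = (B (X m) d - l d) - (B (X n) d - l d)"
        using lin[OF X(1) X(1) dW, of "-1" m n] by (simp add: d_def[symmetric])
      also have "\<dots> \<le> r / (real m + 1) + r / (real n + 1)"
        using key[OF dW, of m] key[OF dW, of n] by (simp add: r_def)
      also have "\<dots> \<le> r / (real N + 1) + r / (real N + 1)"
        using mn r by (intro add_mono divide_left_mono) auto
      finally have "r * r \<le> 2 / (real N + 1) * r" using r by (simp add: power2_eq_square)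
      then have "r = 0 \<or> r \<le> 2 / (real N + 1)" using r mult_right_le_imp_le[of r r "2 / (real N + 1)"] by linarith
      then have rr: "r \<le> 2 / (real N + 1)" by auto
      have "r * r \<le> (2 / (real N + 1)) * (2 / (real N + 1))" using rr r by (intro mult_mono) auto
      also have "\<dots> = 4 / (real N + 1) * (1 / (real N + 1))" by simp
      also have "\<dots> \<le> 4 / (real N + 1)" by (intro mult_right_le_one_le) auto
      also have "\<dots> < e"
      proof -
        have "4 < e * real N" using N e by (simp add: field_simps)
        also have "\<dots> \<le> e * (real N + 1)" using e by simp
        finally show ?thesis by (simp add: field_simps)
      qed
      finally show "B (comb (-1) (X m) (X n)) (comb (-1) (X m) (X n)) < e"
        using r by (simp add: d_def power2_eq_square)
    qed
  next
    fix y assume y: "y \<in> W"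
    have "(\<lambda>n. sqrt (B y y) / (real n + 1)) \<longlonglongrightarrow> 0"
      using tendsto_mult[OF tendsto_const[of "sqrt (B y y)"] LIMSEQ_inverse_real_of_nat]
      by (simp add: divide_inverse add.commute)
    then have "(\<lambda>n. B (X n) y - l y) \<longlonglongrightarrow> 0"
      by (rule Lim_null_comparison[rotated]) (use key[OF y] in auto)
    then show "(\<lambda>n. B (X n) y) \<longlonglongrightarrow> l y" using LIM_zero_iff by blast
  qed
qed

lemma norm_integral_Cauchy_Schwarz:
  fixes f :: "'a \<Rightarrow> 'b::{banach,second_countable_topology}"
  assumes "integrable M (\<lambda>x. (a x)\<^sup>2)" "integrable M (\<lambda>x. (b x)\<^sup>2)" "integrable M (\<lambda>x. a x * b x :: real)"
    and "integrable M f" "\<And>x. norm (f x) \<le> a x * b x"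
  shows "(norm (integral\<^sup>L M f))\<^sup>2 \<le> (LINT x|M. (a x)\<^sup>2) * (LINT x|M. (b x)\<^sup>2)"
proof -
  have "norm (integral\<^sup>L M f) \<le> (LINT x|M. a x * b x)"
    by (rule order_trans[OF Bochner_Integration.integral_norm_bound])
       (rule integral_mono, use assms in auto)
  then have "(norm (integral\<^sup>L M f))\<^sup>2 \<le> (LINT x|M. a x * b x)\<^sup>2" by (rule power_mono) simp
  also have "\<dots> \<le> (LINT x|M. (a x)\<^sup>2) * (LINT x|M. (b x)\<^sup>2)"
    by (rule Cauchy_Schwarz_integral[OF assms(1-3)])
  finally show ?thesis .
qed

lemma integrable_compact_support_on:
  fixes f :: "complex \<Rightarrow> 'b::{banach,second_countable_topology}"
  assumes "open S" "compact K" "K \<subseteq> S" "continuous_on S f" "\<And>z. z \<notin> K \<Longrightarrow> f z = 0"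
  shows "integrable lborel f"
  by (rule integrable_compact_support[OF continuous_zero_extension[OF assms(1-4)] assms(2)]) (simp_all add: assms(5))

text \<open>Test functions of class C^2 with compact support in S. Two derivatives are what the a
  priori estimate consumes, and this regularity still admits the bumps of exponent 3.\<close>

definition C2_test_data where
  "C2_test_data S K (b :: complex \<Rightarrow> complex) bX bY bxx bxy byy \<longleftrightarrow> compact K \<and> K \<subseteq> S \<and>
     (\<forall>z. pderivs b (bX z) (bY z) z \<and> pderivs bX (bxx z) (bxy z) z \<and> pderivs bY (bxy z) (byy z) z) \<and>
     continuous_on UNIV bxx \<and> continuous_on UNIV bxy \<and> continuous_on UNIV byy \<and>
     (\<forall>z. z \<notin> K \<longrightarrow> b z = 0 \<and> bX z = 0 \<and> bY z = 0 \<and> bxx z = 0 \<and> bxy z = 0 \<and> byy z = 0)"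

definition C2_test where
  "C2_test S b bX bY \<longleftrightarrow> (\<exists>K bxx bxy byy. C2_test_data S K b bX bY bxx bxy byy)"

lemma C2_test_dataD:
  assumes "C2_test_data S K b bX bY bxx bxy byy"
  shows "compact K" "K \<subseteq> S"
     "\<And>z. pderivs b (bX z) (bY z) z" "\<And>z. pderivs bX (bxx z) (bxy z) z" "\<And>z. pderivs bY (bxy z) (byy z) z"
     "continuous_on UNIV bxx" "continuous_on UNIV bxy" "continuous_on UNIV byy"
     "\<And>z. z \<notin> K \<Longrightarrow> b z = 0" "\<And>z. z \<notin> K \<Longrightarrow> bX z = 0" "\<And>z. z \<notin> K \<Longrightarrow> bY z = 0"
     "\<And>z. z \<notin> K \<Longrightarrow> bxx z = 0" "\<And>z. z \<notin> K \<Longrightarrow> bxy z = 0" "\<And>z. z \<notin> K \<Longrightarrow> byy z = 0"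
  using assms by (simp_all add: C2_test_data_def)

lemma C2_test_combine:
  assumes "C2_test S b bX bY" "C2_test S c cX cY"
  shows "C2_test S (\<lambda>z. b z + s * c z) (\<lambda>z. bX z + s * cX z) (\<lambda>z. bY z + s * cY z)"
proof -
  obtain K bxx bxy byy where "C2_test_data S K b bX bY bxx bxy byy"
    using assms(1) unfolding C2_test_def by auto
  note b = C2_test_dataD[OF this]
  obtain K' cxx cxy cyy where "C2_test_data S K' c cX cY cxx cxy cyy"
    using assms(2) unfolding C2_test_def by auto
  note c = C2_test_dataD[OF this]
  have d: "pderivs (\<lambda>z. p z + s * q z) (px + s * qx) (py + s * qy) z" 
    if "pderivs p px py z" "pderivs q qx qy z" for p q :: "complex \<Rightarrow> complex" and px py qx qy z
    by (rule has_derivative_eq_rhs[OF has_derivative_add[OF that(1) has_derivative_mult_right[OF that(2), of s]]])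
       (rule ext, simp add: scaleR_conv_of_real algebra_simps)
  have z: "b z + s * c z = 0" "bX z + s * cX z = 0" "bY z + s * cY z = 0" "bxx z + s * cxx z = 0"
    "bxy z + s * cxy z = 0" "byy z + s * cyy z = 0" if "z \<notin> K \<union> K'" for z
    using b(9-14)[of z] c(9-14)[of z] that by simp_all
  have "compact (K \<union> K')" "K \<union> K' \<subseteq> S" using b(1,2) c(1,2) by auto
  moreover have "continuous_on UNIV (\<lambda>z. bxx z + s * cxx z)" "continuous_on UNIV (\<lambda>z. bxy z + s * cxy z)"
    "continuous_on UNIV (\<lambda>z. byy z + s * cyy z)"
    by (intro continuous_intros b(6-8) c(6-8))+
  ultimately have "C2_test_data S (K \<union> K') (\<lambda>z. b z + s * c z) (\<lambda>z. bX z + s * cX z) (\<lambda>z. bY z + s * cY z)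
     (\<lambda>z. bxx z + s * cxx z) (\<lambda>z. bxy z + s * cxy z) (\<lambda>z. byy z + s * cyy z)"
    unfolding C2_test_data_def
    by (intro conjI allI impI d[OF b(3) c(3)] d[OF b(4) c(4)] d[OF b(5) c(5)] z)
  then show ?thesis unfolding C2_test_def by blast
qed

lemma C2_test_continuous:
  assumes "C2_test S b bX bY"
  shows "continuous_on UNIV b" "continuous_on UNIV bX" "continuous_on UNIV bY"
proof -
  obtain K bxx bxy byy where "C2_test_data S K b bX bY bxx bxy byy"
    using assms unfolding C2_test_def by auto
  note b = C2_test_dataD[OF this]
  show "continuous_on UNIV b" "continuous_on UNIV bX" "continuous_on UNIV bY"
    by (intro continuous_at_imp_continuous_on ballI has_derivative_continuous, rule b(3-5))+
qed

lemma C2_test_support: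
  assumes "C2_test S b bX bY"
  obtains K where "compact K" "K \<subseteq> S" "\<And>z. z \<notin> K \<Longrightarrow> b z = 0" "\<And>z. z \<notin> K \<Longrightarrow> bX z = 0" "\<And>z. z \<notin> K \<Longrightarrow> bY z = 0"
proof -
  obtain K bxx bxy byy where "C2_test_data S K b bX bY bxx bxy byy"
    using assms unfolding C2_test_def by auto
  note b = C2_test_dataD[OF this]
  show ?thesis using that[OF b(1,2) b(9-11)] .
qed

lemma bump_translate_pderivs:
  assumes "k \<ge> 2"
  shows "pderivs (\<lambda>\<zeta>. bump r k (\<zeta> - z)) (- real k * 2 / r\<^sup>2 * Re (\<zeta> - z) * bump r (k - 1) (\<zeta> - z))
      (- real k * 2 / r\<^sup>2 * Im (\<zeta> - z) * bump r (k - 1) (\<zeta> - z)) \<zeta>"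
proof -
  obtain n where n: "k = Suc (Suc n)" using assms by (intro that[of "k - 2"]) simp
  have "((\<lambda>\<zeta>. \<zeta> - z) has_derivative (\<lambda>t. t)) (at \<zeta>)" by (auto intro!: derivative_eq_intros)
  from has_derivative_compose[OF this bump_pderivs[of r n "\<zeta> - z"]] show ?thesis unfolding n by simp
qed

text \<open>Translated mollification kernels are admissible test functions, so the weak equation can
  be tested on them directly.\<close>

lemma C2_test_bump:
  assumes r: "r > 0" and S: "cball z r \<subseteq> S"
  shows "C2_test S (\<lambda>\<zeta>. of_real (bump r 3 (\<zeta> - z))) (\<lambda>\<zeta>. of_real (- 6 / r\<^sup>2 * Re (\<zeta> - z) * bump r 2 (\<zeta> - z)))
     (\<lambda>\<zeta>. of_real (- 6 / r\<^sup>2 * Im (\<zeta> - z) * bump r 2 (\<zeta> - z)))"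
proof -
  define u v where "u \<zeta> = Re (\<zeta> - z)" and "v \<zeta> = Im (\<zeta> - z)" for \<zeta>
  define b1 b2 b3 where "b1 \<zeta> = bump r 1 (\<zeta> - z)" and "b2 \<zeta> = bump r 2 (\<zeta> - z)" and "b3 \<zeta> = bump r 3 (\<zeta> - z)" for \<zeta>
  have b3: "(b3 has_derivative (\<lambda>t. Re t * (- 6 / r\<^sup>2 * u \<zeta> * b2 \<zeta>) + Im t * (- 6 / r\<^sup>2 * v \<zeta> * b2 \<zeta>))) (at \<zeta>)" for \<zeta>
    using bump_translate_pderivs[of 3 r z \<zeta>] unfolding b3_def[abs_def] b2_def u_def v_def by simp
  have b2: "(b2 has_derivative (\<lambda>t. Re t * (- 4 / r\<^sup>2 * u \<zeta> * b1 \<zeta>) + Im t * (- 4 / r\<^sup>2 * v \<zeta> * b1 \<zeta>))) (at \<zeta>)" for \<zeta>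
    using bump_translate_pderivs[of 2 r z \<zeta>] unfolding b2_def[abs_def] b1_def u_def v_def by simp
  have u: "(u has_derivative Re) (at \<zeta>)" "(v has_derivative Im) (at \<zeta>)" for \<zeta>
    unfolding u_def[abs_def] v_def[abs_def] by (auto intro!: derivative_eq_intros)
  have ofr: "pderivs (\<lambda>\<zeta>. complex_of_real (f \<zeta>)) (of_real fx) (of_real fy) \<zeta>"
    if "(f has_derivative (\<lambda>t. Re t * fx + Im t * fy)) (at \<zeta>)" for f fx fy \<zeta>
    by (rule has_derivative_eq_rhs[OF has_derivative_of_real[OF that]]) (auto simp: fun_eq_iff scaleR_conv_of_real)
  define a where "a = - 6 / r\<^sup>2"
  define d where "d = - 4 / r\<^sup>2"
  have c: "continuous_on UNIV u" "continuous_on UNIV v" "continuous_on UNIV b1" "continuous_on UNIV b2"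
    unfolding u_def[abs_def] v_def[abs_def] b1_def[abs_def] b2_def[abs_def] by (intro continuous_intros)+
  have z: "b1 \<zeta> = 0" "b2 \<zeta> = 0" "b3 \<zeta> = 0" if "\<zeta> \<notin> cball z r" for \<zeta>
    using that r by (auto simp: b1_def b2_def b3_def dist_norm norm_minus_commute intro!: bump_eq_0)
  have "C2_test_data S (cball z r) (\<lambda>\<zeta>. of_real (b3 \<zeta>)) (\<lambda>\<zeta>. of_real (a * u \<zeta> * b2 \<zeta>)) (\<lambda>\<zeta>. of_real (a * v \<zeta> * b2 \<zeta>))
    (\<lambda>\<zeta>. of_real (a * b2 \<zeta> + a * d * u \<zeta> * u \<zeta> * b1 \<zeta>)) (\<lambda>\<zeta>. of_real (a * d * u \<zeta> * v \<zeta> * b1 \<zeta>))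
    (\<lambda>\<zeta>. of_real (a * b2 \<zeta> + a * d * v \<zeta> * v \<zeta> * b1 \<zeta>))"
    unfolding C2_test_data_def
  proof (intro conjI allI impI)
    fix \<zeta>
    show "pderivs (\<lambda>\<zeta>. complex_of_real (b3 \<zeta>)) (of_real (a * u \<zeta> * b2 \<zeta>)) (of_real (a * v \<zeta> * b2 \<zeta>)) \<zeta>"
      using b3[of \<zeta>] unfolding a_def[symmetric] by (rule ofr)
    note b2' = b2[of \<zeta>, folded d_def]
    show "pderivs (\<lambda>\<zeta>. complex_of_real (a * u \<zeta> * b2 \<zeta>)) (of_real (a * b2 \<zeta> + a * d * u \<zeta> * u \<zeta> * b1 \<zeta>)) (of_real (a * d * u \<zeta> * v \<zeta> * b1 \<zeta>)) \<zeta>"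
      by (rule ofr, rule has_derivative_eq_rhs[OF has_derivative_mult[OF has_derivative_mult_right[OF u(1)] b2']])
         (auto simp: fun_eq_iff algebra_simps)
    show "pderivs (\<lambda>\<zeta>. complex_of_real (a * v \<zeta> * b2 \<zeta>)) (of_real (a * d * u \<zeta> * v \<zeta> * b1 \<zeta>)) (of_real (a * b2 \<zeta> + a * d * v \<zeta> * v \<zeta> * b1 \<zeta>)) \<zeta>"
      by (rule ofr, rule has_derivative_eq_rhs[OF has_derivative_mult[OF has_derivative_mult_right[OF u(2)] b2']])
         (auto simp: fun_eq_iff algebra_simps)
    show "continuous_on UNIV (\<lambda>\<zeta>. complex_of_real (a * b2 \<zeta> + a * d * u \<zeta> * u \<zeta> * b1 \<zeta>))"
      "continuous_on UNIV (\<lambda>\<zeta>. complex_of_real (a * d * u \<zeta> * v \<zeta> * b1 \<zeta>))"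
      "continuous_on UNIV (\<lambda>\<zeta>. complex_of_real (a * b2 \<zeta> + a * d * v \<zeta> * v \<zeta> * b1 \<zeta>))"
      by (intro continuous_intros c)+
    show "compact (cball z r)" "cball z r \<subseteq> S" using S by auto
  qed (simp_all add: z)
  then have "C2_test S (\<lambda>\<zeta>. of_real (b3 \<zeta>)) (\<lambda>\<zeta>. of_real (a * u \<zeta> * b2 \<zeta>)) (\<lambda>\<zeta>. of_real (a * v \<zeta> * b2 \<zeta>))"
    unfolding C2_test_def by blast
  then show ?thesis unfolding a_def u_def v_def b2_def b3_def .
qed

section \<open>The weighted dbar equation\<close>

text \<open>Duality. On the expressions b_x - i b_y with the weight e^\<phi>, the functional
  -\<integral> \<omega> cnj b is bounded by A: Cauchy-Schwarz with the auxiliary weight \<kappa>,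
  followed by the a priori estimate. For the representing sequence E, the functions u = e^\<phi> E
  solve u_x + i u_y = \<omega> weakly in the limit, and \<integral> |u|^2 e^(-\<phi>) is \<integral>
  |E|^2 e^\<phi>.\<close>

lemma approximate_dbar_solution:
  fixes \<phi> \<kappa> :: "complex \<Rightarrow> real" and \<omega> :: "complex \<Rightarrow> complex"
  assumes S: "open S" and p: "C2_data S \<phi> px py pxx pxy pyx pyy"
    and k: "continuous_on S \<kappa>" "\<And>z. z \<in> S \<Longrightarrow> 0 < \<kappa> z" "\<And>z. z \<in> S \<Longrightarrow> \<kappa> z \<le> pxx z + pyy z"
    and \<omega>: "continuous_on UNIV \<omega>" "compact K0" "K0 \<subseteq> S" "\<And>z. z \<notin> K0 \<Longrightarrow> \<omega> z = 0"
    and A: "A \<ge> 0" "(LINT z|lborel. (cmod (\<omega> z))\<^sup>2 * exp (- \<phi> z) / \<kappa> z) \<le> A\<^sup>2"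
  obtains E :: "nat \<Rightarrow> complex \<Rightarrow> complex" where
    "\<And>n. continuous_on UNIV (E n)" "\<And>n. \<exists>K. compact K \<and> K \<subseteq> S \<and> (\<forall>z. z \<notin> K \<longrightarrow> E n z = 0)"
    "\<And>n. (LINT z|lborel. (cmod (E n z))\<^sup>2 * exp (\<phi> z)) \<le> (A + 1)\<^sup>2"
    "\<And>e. e > 0 \<Longrightarrow> \<exists>N. \<forall>m\<ge>N. \<forall>n\<ge>N. (LINT z|lborel. (cmod (E m z - E n z))\<^sup>2 * exp (\<phi> z)) < e"
    "\<And>b bX bY. C2_test S b bX bY \<Longrightarrow>
       (\<lambda>n. LINT z|lborel. exp (\<phi> z) *\<^sub>R (E n z * cnj (bX z - \<i> * bY z))) \<longlonglongrightarrow> - (LINT z|lborel. \<omega> z * cnj (b z))"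
proof -
  \<comment> \<open>Pairs are kept because the functional l depends on b and the form B on b_x - i
    b_y.\<close>
  define W where "W = {(b, E). \<exists>bX bY. C2_test S b bX bY \<and> E = (\<lambda>z. bX z - \<i> * bY z)}"
  define B where "B x y = (LINT z|lborel. Re (snd x z * cnj (snd y z)) * exp (\<phi> z))"
    for x y :: "(complex \<Rightarrow> complex) \<times> (complex \<Rightarrow> complex)"
  define l where "l x = - (LINT z|lborel. Re (\<omega> z * cnj (fst x z)))" for x :: "(complex \<Rightarrow> complex) \<times> (complex \<Rightarrow> complex)"
  define comb where "comb s x y = ((\<lambda>z. fst x z + of_real s * fst y z), (\<lambda>z. snd x z + of_real s * snd y z))"
    for s :: real and x y :: "(complex \<Rightarrow> complex) \<times> (complex \<Rightarrow> complex)"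
  have c\<phi>: "continuous_on S \<phi>" using C2_data_continuous[OF p] by simp
  have cp: "continuous_on S pxx" "continuous_on S pyy" using p by (auto simp: C2_data_def)
  have Wc: "continuous_on UNIV (fst x)" "continuous_on UNIV (snd x)" if "x \<in> W" for x
    using that C2_test_continuous unfolding W_def by (fastforce intro!: continuous_intros)+
  have Ws: "\<exists>K. compact K \<and> K \<subseteq> S \<and> (\<forall>z. z \<notin> K \<longrightarrow> fst x z = 0 \<and> snd x z = 0)" if "x \<in> W" for x
  proof -
    obtain b bX bY where x: "x = (b, \<lambda>z. bX z - \<i> * bY z)" "C2_test S b bX bY" using \<open>x \<in> W\<close> unfolding W_def by auto
    obtain K where "compact K" "K \<subseteq> S" "\<And>z. z \<notin> K \<Longrightarrow> b z = 0" "\<And>z. z \<notin> K \<Longrightarrow> bX z = 0" "\<And>z. z \<notin> K \<Longrightarrow> bY z = 0"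
      using C2_test_support[OF x(2)] by metis
    then show ?thesis using x(1) by (intro exI[of _ K]) auto
  qed
  have cS: "continuous_on S f" if "continuous_on UNIV f" for f :: "complex \<Rightarrow> complex"
    using that continuous_on_subset by blast
  have intB: "integrable lborel (\<lambda>z. Re (snd x z * cnj (snd y z)) * exp (\<phi> z))" if xy: "x \<in> W" "y \<in> W" for x y
  proof -
    obtain K where K: "compact K" "K \<subseteq> S" "\<And>z. z \<notin> K \<Longrightarrow> snd x z = 0" using Ws[OF xy(1)] by metis
    show ?thesis
      by (rule integrable_compact_support_on[OF S K(1,2)])
         (auto intro!: continuous_intros c\<phi> cS Wc xy simp: K(3))
  qed
  have intl: "integrable lborel (\<lambda>z. Re (\<omega> z * cnj (fst x z)))" if x: "x \<in> W" for x
    by (rule integrable_compact_support_on[OF S \<omega>(2,3)]) (auto intro!: continuous_intros cS \<omega>(1) Wc x simp: \<omega>(4))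
  have c\<omega>: "continuous_on S \<omega>" using \<omega>(1) cS by blast
  have cnjself: "Re (c * cnj c) = (cmod c)\<^sup>2" for c using cmod_power2[of c] by (simp add: power2_eq_square)
  have bd: "(l x)\<^sup>2 \<le> A\<^sup>2 * B x x" if x: "x \<in> W" for x
  proof -
    obtain b bX bY where xb: "x = (b, \<lambda>z. bX z - \<i> * bY z)" "C2_test S b bX bY" using x unfolding W_def by auto
    obtain K bxx bxy byy where "C2_test_data S K b bX bY bxx bxy byy"
      using xb(2) unfolding C2_test_def by auto
    note b = C2_test_dataD[OF this]
    have cb: "continuous_on S b" using C2_test_continuous(1)[OF xb(2)] cS by blast
    \<comment> \<open>The product f g equals |\<omega> b| on S. The square of f integrates to the
      quantity bounded by the square of A, that of g to at most the left side of the a priori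
      estimate.\<close>
    define f where "f z = cmod (\<omega> z) * exp (- \<phi> z / 2) / sqrt (\<kappa> z)" for z
    define g where "g z = sqrt (\<kappa> z) * cmod (b z) * exp (\<phi> z / 2)" for z
    have e2: "exp (x / 2 :: real)^2 = exp x" for x by (simp add: exp_double[symmetric] power2_eq_square exp_add[symmetric])
    have f2: "(f z)\<^sup>2 = (cmod (\<omega> z))\<^sup>2 * exp (- \<phi> z) / \<kappa> z" for z
    proof (cases "z \<in> S")
      case True then show ?thesis using k(2)[OF True] e2[of "- \<phi> z"] by (simp add: f_def power_divide power_mult_distrib)
    next
      case False then have "\<omega> z = 0" using \<omega>(3,4) by blast then show ?thesis by (simp add: f_def)
    qed
    have g2: "(g z)\<^sup>2 = \<kappa> z * (cmod (b z))\<^sup>2 * exp (\<phi> z)" for z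
    proof (cases "z \<in> S")
      case True then show ?thesis using k(2)[OF True] e2[of "\<phi> z"] by (simp add: g_def power_mult_distrib)
    next
      case False then have "b z = 0" using b(2,9) by blast then show ?thesis by (simp add: g_def)
    qed
    have cf: "continuous_on S f" "continuous_on S g" unfolding f_def g_def
      by (intro continuous_intros c\<omega> c\<phi> k cb; use k(2) in force)+
    have fz: "f z = 0" if "z \<notin> K0" for z using \<omega>(4)[OF that] by (simp add: f_def)
    have gz: "g z = 0" if "z \<notin> K" for z using b(9)[OF that] by (simp add: g_def)
    have "(norm (LINT z|lborel. Re (\<omega> z * cnj (b z))))\<^sup>2 \<le> (LINT z|lborel. (f z)\<^sup>2) * (LINT z|lborel. (g z)\<^sup>2)"
    proof (rule norm_integral_Cauchy_Schwarz)
      show "integrable lborel (\<lambda>z. (f z)\<^sup>2)" "integrable lborel (\<lambda>z. f z * g z)"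
        by (rule integrable_compact_support_on[OF S \<omega>(2,3)]; auto intro!: continuous_intros cf simp: fz)+
      show "integrable lborel (\<lambda>z. (g z)\<^sup>2)"
        by (rule integrable_compact_support_on[OF S b(1,2)]; auto intro!: continuous_intros cf simp: gz)
      show "integrable lborel (\<lambda>z. Re (\<omega> z * cnj (b z)))" using intl[OF x] xb by simp
      fix z
      show "norm (Re (\<omega> z * cnj (b z))) \<le> f z * g z"
      proof (cases "z \<in> S")
        case True
        have "f z * g z = cmod (\<omega> z) * cmod (b z) * (exp (- \<phi> z / 2) * exp (\<phi> z / 2))"
          using k(2)[OF True] by (simp add: f_def g_def)
        also have "\<dots> = cmod (\<omega> z * cnj (b z))" by (simp add: exp_add[symmetric] norm_mult)
        finally show ?thesis using abs_Re_le_cmod[of "\<omega> z * cnj (b z)"] by simp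
      next
        case False then have "\<omega> z = 0" using \<omega>(3,4) by blast then show ?thesis by (simp add: f_def)
      qed
    qed
    also have "\<dots> \<le> A\<^sup>2 * (LINT z|lborel. (g z)\<^sup>2)"
      using A(2) by (intro mult_right_mono integral_nonneg_AE) (auto simp: f2)
    also have "\<dots> \<le> A\<^sup>2 * B x x"
    proof (rule mult_left_mono)
      have "(LINT z|lborel. (g z)\<^sup>2) \<le> (LINT z|lborel. (pxx z + pyy z) * (cmod (b z))\<^sup>2 * exp (\<phi> z))"
      proof (rule integral_mono)
        show "integrable lborel (\<lambda>z. (g z)\<^sup>2)"
          by (rule integrable_compact_support_on[OF S b(1,2)]; auto intro!: continuous_intros cf simp: gz)
        show "integrable lborel (\<lambda>z. (pxx z + pyy z) * (cmod (b z))\<^sup>2 * exp (\<phi> z))"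
          by (rule integrable_compact_support_on[OF S b(1,2)]; auto intro!: continuous_intros c\<phi> cp cb simp: b(9))
        fix z show "(g z)\<^sup>2 \<le> (pxx z + pyy z) * (cmod (b z))\<^sup>2 * exp (\<phi> z)"
          unfolding g2 using k(3)[of z] b(2) b(9)[of z] by (cases "z \<in> K") (auto intro!: mult_right_mono)
      qed
      also have "\<dots> \<le> (LINT z|lborel. (cmod (bX z - \<i> * bY z))\<^sup>2 * exp (\<phi> z))"
        by (rule a_priori_estimate[OF S b(1,2) _ _ _ _ _ _ _ b(3-14)]) (use p in \<open>auto simp: C2_data_def\<close>)
      also have "\<dots> = B x x" unfolding B_def xb(1) snd_conv cnjself ..
      finally show "(LINT z|lborel. (g z)\<^sup>2) \<le> B x x" .
    qed simp
    finally show ?thesis by (simp add: l_def xb)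
  qed
  have W0: "((\<lambda>_. 0), (\<lambda>_. 0)) \<in> W"
  proof -
    have "C2_test_data S {} (\<lambda>_. 0) (\<lambda>_. 0) (\<lambda>_. 0) (\<lambda>_. 0) (\<lambda>_. 0) (\<lambda>_. 0)"
      by (simp add: C2_test_data_def)
    then have "C2_test S (\<lambda>_. 0) (\<lambda>_. 0) (\<lambda>_. 0)" unfolding C2_test_def by blast
    then show ?thesis unfolding W_def
      by (auto intro!: exI[of _ "\<lambda>_. 0"])
  qed
  have Wcomb: "((\<lambda>z. fst x z + s * fst y z), (\<lambda>z. snd x z + s * snd y z)) \<in> W" if xy: "x \<in> W" "y \<in> W" for x y and s :: complex
  proof -
    obtain b bX bY where x: "x = (b, \<lambda>z. bX z - \<i> * bY z)" "C2_test S b bX bY" using xy unfolding W_def by auto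
    obtain c cX cY where y: "y = (c, \<lambda>z. cX z - \<i> * cY z)" "C2_test S c cX cY" using xy unfolding W_def by auto
    have "(\<lambda>z. (bX z - \<i> * bY z) + s * (cX z - \<i> * cY z)) = (\<lambda>z. (bX z + s * cX z) - \<i> * (bY z + s * cY z))"
      by (rule ext) (simp add: algebra_simps)
    then show ?thesis using C2_test_combine[OF x(2) y(2), of s] unfolding x(1) y(1) W_def fst_conv snd_conv by blast
  qed
  have Bnonneg: "B x x \<ge> 0" for x
    unfolding B_def by (intro integral_nonneg_AE) (auto simp: mult_nonneg_nonneg)
  obtain X where X: "\<And>n. X n \<in> W" "\<And>n::nat. B (X n) (X n) \<le> (A + 1)\<^sup>2"
    "\<And>e. e > 0 \<Longrightarrow> \<exists>N. \<forall>m\<ge>N. \<forall>n\<ge>N. B (comb (-1) (X m) (X n)) (comb (-1) (X m) (X n)) < e"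
    "\<And>y. y \<in> W \<Longrightarrow> (\<lambda>n. B (X n) y) \<longlonglongrightarrow> l y"
  proof (rule Riesz_approximants[where B=B and l=l and comb=comb and W=W and A=A])
    show "comb s x y \<in> W" if "x \<in> W" "y \<in> W" for s x y
      using Wcomb[OF that, of "of_real s"] by (simp add: comb_def)
    show "B x y = B y x" for x y unfolding B_def by (intro Bochner_Integration.integral_cong) (auto simp: algebra_simps)
    show "B (comb s x y) z = B x z + s * B y z" if xyz: "x \<in> W" "y \<in> W" "z \<in> W" for s x y z
    proof -
      have "B (comb s x y) z = (LINT t|lborel. Re (snd x t * cnj (snd z t)) * exp (\<phi> t) + s * (Re (snd y t * cnj (snd z t)) * exp (\<phi> t)))"
        unfolding B_def comb_def by (intro Bochner_Integration.integral_cong) (auto simp: algebra_simps)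
      also have "\<dots> = B x z + s * B y z" unfolding B_def using intB xyz by (subst Bochner_Integration.integral_add) auto
      finally show ?thesis .
    qed
    show "l (comb s x y) = l x + s * l y" if xyz: "x \<in> W" "y \<in> W" for s x y
    proof -
      have "l (comb s x y) = - (LINT t|lborel. Re (\<omega> t * cnj (fst x t)) + s * Re (\<omega> t * cnj (fst y t)))"
        unfolding l_def comb_def by (intro arg_cong[of _ _ uminus] Bochner_Integration.integral_cong) (auto simp: algebra_simps)
      also have "\<dots> = l x + s * l y" unfolding l_def using intl xyz by (subst Bochner_Integration.integral_add) auto
      finally show ?thesis .
    qed
  qed (use W0 Bnonneg bd A in auto)
  show ?thesis
  proof (rule that[of "\<lambda>n. snd (X n)"])
    show "continuous_on UNIV (snd (X n))" for n using Wc X by blast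
    show "\<exists>K. compact K \<and> K \<subseteq> S \<and> (\<forall>z. z \<notin> K \<longrightarrow> snd (X n) z = 0)" for n using Ws[OF X(1)] by metis
    show "(LINT z|lborel. (cmod (snd (X n) z))\<^sup>2 * exp (\<phi> z)) \<le> (A + 1)\<^sup>2" for n
      using X(2)[of n] unfolding B_def cnjself .
    show "\<exists>N. \<forall>m\<ge>N. \<forall>n\<ge>N. (LINT z|lborel. (cmod (snd (X m) z - snd (X n) z))\<^sup>2 * exp (\<phi> z)) < e" if "e > 0" for e
      using X(3)[OF that] unfolding B_def cnjself comb_def by simp
    fix b bX bY assume t: "C2_test S b bX bY"
    define y where "y = (b, \<lambda>z. bX z - \<i> * bY z)"
    have y: "y \<in> W" using t unfolding W_def y_def by auto
    \<comment> \<open>B and l are real parts; testing with \<i> b recovers the imaginary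
      parts.\<close>
    define y' where "y' = ((\<lambda>z. 0 + \<i> * fst y z), (\<lambda>z. 0 + \<i> * snd y z))"
    have y': "y' \<in> W" using Wcomb[OF W0 y, of \<i>] by (simp add: y'_def)
    have int: "integrable lborel (\<lambda>z. exp (\<phi> z) *\<^sub>R (snd (X n) z * cnj (snd y z)))" for n
    proof -
      obtain K where K: "compact K" "K \<subseteq> S" "\<And>z. z \<notin> K \<Longrightarrow> snd (X n) z = 0" using Ws[OF X(1)] by metis
      show ?thesis
        by (rule integrable_compact_support_on[OF S K(1,2)])
           (auto intro!: continuous_intros c\<phi> cS[OF Wc(2)[OF X(1)]] cS[OF Wc(2)[OF y]] simp: K(3))
    qed
    have int2: "integrable lborel (\<lambda>z. \<omega> z * cnj (fst y z))"
      by (rule integrable_compact_support_on[OF S \<omega>(2,3)]) (auto intro!: continuous_intros cS \<omega>(1) Wc y simp: \<omega>(4))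
    let ?I = "\<lambda>n. LINT z|lborel. exp (\<phi> z) *\<^sub>R (snd (X n) z * cnj (snd y z))"
    have "Re (?I n) = B (X n) y" for n
      unfolding B_def using integral_Re[OF int[of n]] by (simp add: algebra_simps)
    moreover have "Im (?I n) = B (X n) y'" for n
      unfolding B_def y'_def using integral_Im[OF int[of n]] by (simp add: algebra_simps)
    moreover have "l y = Re (- (LINT z|lborel. \<omega> z * cnj (fst y z)))"
      unfolding l_def using integral_Re[OF int2] by simp
    moreover have "l y' = Im (- (LINT z|lborel. \<omega> z * cnj (fst y z)))"
      unfolding l_def y'_def using integral_Im[OF int2] by (simp add: algebra_simps)
    ultimately have "?I \<longlonglongrightarrow> - (LINT z|lborel. \<omega> z * cnj (fst y z))"
      using X(4)[OF y] X(4)[OF y'] by (simp add: tendsto_complex_iff)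
    then show "(\<lambda>n. LINT z|lborel. exp (\<phi> z) *\<^sub>R (snd (X n) z * cnj (bX z - \<i> * bY z))) \<longlonglongrightarrow> - (LINT z|lborel. \<omega> z * cnj (b z))"
      by (simp add: y_def)
  qed
qed

text \<open>Weyl's lemma at a fixed scale r. Difference quotients of the translated kernel converge
  uniformly and \<Lambda> is bounded in the sup norm, so z can be differentiated through \<Lambda>.
  The hypothesis that \<Lambda> kills (d_x + i d_y) of the kernel becomes the Cauchy-Riemann
  equation.\<close>

lemma weakly_holomorphic:
  fixes \<Lambda> :: "(complex \<Rightarrow> complex) \<Rightarrow> complex"
  assumes T: "open T" "r > 0" "\<And>z. z \<in> T \<Longrightarrow> cball z r \<subseteq> K"
    and \<T>: "\<T> = {\<eta>. continuous_on UNIV \<eta> \<and> (\<forall>z. z \<notin> K \<longrightarrow> \<eta> z = 0)}"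
    and lin: "\<And>\<eta> \<theta> s. \<eta> \<in> \<T> \<Longrightarrow> \<theta> \<in> \<T> \<Longrightarrow> \<Lambda> (\<lambda>\<zeta>. \<eta> \<zeta> + s * \<theta> \<zeta>) = \<Lambda> \<eta> + s * \<Lambda> \<theta>"
    and bd: "\<And>\<eta> M. \<eta> \<in> \<T> \<Longrightarrow> (\<And>\<zeta>. cmod (\<eta> \<zeta>) \<le> M) \<Longrightarrow> cmod (\<Lambda> \<eta>) \<le> C * M" and C: "C \<ge> 0"
    and hol: "\<And>z. z \<in> T \<Longrightarrow> \<Lambda> (\<lambda>\<zeta>. of_real (- 6 / r\<^sup>2 * Re (\<zeta> - z) * bump r 2 (\<zeta> - z))
       + \<i> * of_real (- 6 / r\<^sup>2 * Im (\<zeta> - z) * bump r 2 (\<zeta> - z))) = 0"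
  shows "(\<lambda>z. \<Lambda> (\<lambda>\<zeta>. of_real (bump r 3 (\<zeta> - z)))) holomorphic_on T"
proof -
  define \<beta> where "\<beta> = bump r 3"
  define \<beta>x \<beta>y where "\<beta>x y = - 6 / r\<^sup>2 * Re y * bump r 2 y" and "\<beta>y y = - 6 / r\<^sup>2 * Im y * bump r 2 y" for y
  have \<beta>: "pderivs \<beta> (\<beta>x y) (\<beta>y y) y" for y
    using bump_translate_pderivs[of 3 r 0 y] unfolding \<beta>_def \<beta>x_def \<beta>y_def by simp
  have z0: "\<beta> y = 0" "\<beta>x y = 0" "\<beta>y y = 0" if "y \<notin> cball 0 r" for y
    using that bump_eq_0[OF T(2), of 3 y] bump_eq_0[OF T(2), of 2 y] by (simp_all add: \<beta>_def \<beta>x_def \<beta>y_def)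
  have c: "continuous_on A \<beta>" "continuous_on A \<beta>x" "continuous_on A \<beta>y" for A
    unfolding \<beta>_def \<beta>x_def[abs_def] \<beta>y_def[abs_def] by (intro continuous_intros)+
  have inT: "(\<lambda>\<zeta>. of_real (f (\<zeta> - z))) \<in> \<T>"
    if "z \<in> T" "\<And>A. continuous_on A f" "\<And>y. y \<notin> cball 0 r \<Longrightarrow> f y = 0" for f :: "complex \<Rightarrow> real" and z
  proof -
    have "continuous_on UNIV (\<lambda>\<zeta>. f (\<zeta> - z))"
      by (rule continuous_on_compose2[OF that(2)[of UNIV]]) (auto intro!: continuous_intros)
    moreover have "f (\<zeta> - z) = 0" if "\<zeta> \<notin> K" for \<zeta>
    proof -
      have "\<zeta> \<notin> cball z r" using T(3)[OF \<open>z \<in> T\<close>] that by auto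
      then show ?thesis using \<open>\<And>y. y \<notin> cball 0 r \<Longrightarrow> f y = 0\<close>[of "\<zeta> - z"] by (simp add: dist_norm norm_minus_commute)
    qed
    ultimately show ?thesis unfolding \<T> by (auto intro!: continuous_intros)
  qed
  have comb: "(\<lambda>\<zeta>. \<eta> \<zeta> + s * \<theta> \<zeta>) \<in> \<T>" if "\<eta> \<in> \<T>" "\<theta> \<in> \<T>" for \<eta> \<theta> s
    using that unfolding \<T> by (auto intro!: continuous_intros)
  define h where "h z = \<Lambda> (\<lambda>\<zeta>. of_real (\<beta> (\<zeta> - z)))" for z
  define hx where "hx z = \<Lambda> (\<lambda>\<zeta>. of_real (\<beta>x (\<zeta> - z)))" for z
  have "(h has_field_derivative - hx z) (at z)" if z: "z \<in> T" for z
  proof -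
    define hy where "hy = \<Lambda> (\<lambda>\<zeta>. of_real (\<beta>y (\<zeta> - z)))"
    note iz = inT[OF z c(1) z0(1)] inT[OF z c(2) z0(2)] inT[OF z c(3) z0(3)]
    have "hx z + \<i> * hy = 0"
      using hol[OF z] lin[OF iz(2,3), of \<i>] by (simp add: hx_def hy_def \<beta>x_def \<beta>y_def)
    \<comment> \<open>The partials of h are -hx and -hy, so this is the Cauchy-Riemann equation for
      h.\<close>
    then have hy: "hy = \<i> * hx z" by (simp add: complex_eq_iff)
    show ?thesis unfolding has_field_derivative_def has_derivative_at_alt
    proof (intro conjI allI impI)
      show "bounded_linear ((*) (- hx z))" by (rule bounded_linear_mult_right)
      fix e :: real assume e: "e > 0"
      define e' where "e' = e / (C + 1)"
      have e': "e' > 0" "C * e' \<le> e" using e C by (auto simp: e'_def field_simps)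
      obtain d where d: "d > 0" "\<And>y t. norm t < d \<Longrightarrow>
        norm (\<beta> (y + t) - \<beta> y - (Re t *\<^sub>R \<beta>x y + Im t *\<^sub>R \<beta>y y)) \<le> e' * norm t"
        using uniform_linearization[OF \<beta> c(2,3) compact_cball z0(2,3) e'(1)] by blast
      obtain d' where d': "d' > 0" "ball z d' \<subseteq> T" using T(1) z open_contains_ball by blast
      show "\<exists>d>0. \<forall>y. norm (y - z) < d \<longrightarrow> norm (h y - h z - - hx z * (y - z)) \<le> e * norm (y - z)"
      proof (intro exI[of _ "min d d'"] conjI allI impI)
        show "min d d' > 0" using d d' by simp
        fix y assume y: "norm (y - z) < min d d'"
        have "y \<in> ball z d'" using y by (simp add: dist_norm norm_minus_commute)
        then have yT: "y \<in> T" using d' by blast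
        note iy = inT[OF yT c(1) z0(1)]
        define t where "t = y - z"
        define \<theta>1 where "\<theta>1 = (\<lambda>\<zeta>. complex_of_real (\<beta> (\<zeta> - y)) + (-1) * of_real (\<beta> (\<zeta> - z)))"
        define \<theta>2 where "\<theta>2 = (\<lambda>\<zeta>. \<theta>1 \<zeta> + of_real (Re t) * of_real (\<beta>x (\<zeta> - z)))"
        define \<theta> where "\<theta> = (\<lambda>\<zeta>. \<theta>2 \<zeta> + of_real (Im t) * of_real (\<beta>y (\<zeta> - z)))"
        have m: "\<theta>1 \<in> \<T>" "\<theta>2 \<in> \<T>" "\<theta> \<in> \<T>"
        proof -
          show m1: "\<theta>1 \<in> \<T>" unfolding \<theta>1_def by (rule comb[OF iy iz(1)])
          show m2: "\<theta>2 \<in> \<T>" unfolding \<theta>2_def by (rule comb[OF m1 iz(2)])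
          show "\<theta> \<in> \<T>" unfolding \<theta>_def by (rule comb[OF m2 iz(3)])
        qed
        have "\<Lambda> \<theta> = ((h y + (-1) * h z) + of_real (Re t) * hx z) + of_real (Im t) * hy"
          using lin[OF m(2) iz(3), of "of_real (Im t)"] lin[OF m(1) iz(2), of "of_real (Re t)"] lin[OF iy iz(1), of "-1"]
          unfolding \<theta>_def[symmetric] \<theta>2_def[symmetric] \<theta>1_def[symmetric] h_def hx_def hy_def by simp
        also have "\<dots> = h y - h z - - hx z * (y - z)"
          unfolding hy t_def[symmetric] by (simp add: complex_eq_iff algebra_simps)
        finally have L: "\<Lambda> \<theta> = h y - h z - - hx z * (y - z)" .
        have "cmod (\<theta> \<zeta>) \<le> e' * norm t" for \<zeta>
        proof -
          have "\<theta> \<zeta> = of_real (\<beta> ((\<zeta> - z) + (- t)) - \<beta> (\<zeta> - z) - (Re (- t) *\<^sub>R \<beta>x (\<zeta> - z) + Im (- t) *\<^sub>R \<beta>y (\<zeta> - z)))"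
            by (simp add: \<theta>_def \<theta>2_def \<theta>1_def t_def algebra_simps)
          then show ?thesis using d(2)[of "- t" "\<zeta> - z"] y by (simp only: norm_of_real) (simp add: t_def norm_minus_commute)
        qed
        then have "cmod (\<Lambda> \<theta>) \<le> C * (e' * norm t)" by (intro bd m(3))
        also have "\<dots> \<le> e * norm t" using e'(2) mult_right_mono[OF e'(2), of "norm t"] by (simp add: mult.assoc)
        finally show "norm (h y - h z - - hx z * (y - z)) \<le> e * norm (y - z)" unfolding L t_def .
      qed
    qed
  qed
  then have "h holomorphic_on T" using T(1) holomorphic_on_open by blast
  then show ?thesis unfolding h_def[abs_def] \<beta>_def .
qed

text \<open>G and the weak solution u satisfy the same equation, so mollifying G - u at radius r
  gives a holomorphic h. The mollified u is k, and h differs from G - k only by the oscillation of G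
  at scale r. Averaging costs a factor 2 in the weighted norm of k, through the oscillation of
  \<phi>. The bound contains neither r, T nor K.\<close>

lemma dbar_correction:
  fixes \<phi> \<kappa> :: "complex \<Rightarrow> real" and \<omega> G :: "complex \<Rightarrow> complex"
  assumes S: "open S" and p: "C2_data S \<phi> px py pxx pxy pyx pyy"
    and k: "continuous_on S \<kappa>" "\<And>z. z \<in> S \<Longrightarrow> 0 < \<kappa> z" "\<And>z. z \<in> S \<Longrightarrow> \<kappa> z \<le> pxx z + pyy z"
    and G: "\<And>z. z \<in> S \<Longrightarrow> pderivs G (gx z) (gy z) z" "continuous_on S gx" "continuous_on S gy"
    and \<omega>G: "\<And>z. z \<in> S \<Longrightarrow> gx z + \<i> * gy z = \<omega> z"
    and \<omega>: "continuous_on UNIV \<omega>" "compact K0" "K0 \<subseteq> S" "\<And>z. z \<notin> K0 \<Longrightarrow> \<omega> z = 0"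
    and A: "A \<ge> 0" "(LINT z|lborel. (cmod (\<omega> z))\<^sup>2 * exp (- \<phi> z) / \<kappa> z) \<le> A\<^sup>2"
    and T: "open T" "r > 0" "compact K" "K \<subseteq> S" "\<And>z. z \<in> T \<Longrightarrow> cball z r \<subseteq> K"
    and osc: "\<And>z \<zeta>. z \<in> T \<Longrightarrow> \<zeta> \<in> cball z r \<Longrightarrow> exp (- \<phi> z) \<le> 2 * exp (- \<phi> \<zeta>)"
      "\<And>z \<zeta>. z \<in> T \<Longrightarrow> \<zeta> \<in> cball z r \<Longrightarrow> cmod (G \<zeta> - G z) \<le> \<delta>"
  obtains h k where "h holomorphic_on T" "\<And>z. z \<in> T \<Longrightarrow> cmod (h z - (G z - k z)) \<le> \<delta>"
    "(\<integral>\<^sup>+z. indicator T z * ennreal (exp (- \<phi> z) * (cmod (k z))\<^sup>2) \<partial>lborel) \<le> ennreal (2 * (A + 1)\<^sup>2)"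
    "k \<in> borel_measurable borel"
proof -
  obtain E :: "nat \<Rightarrow> complex \<Rightarrow> complex" where E:
    "\<And>n. continuous_on UNIV (E n)" "\<And>n. \<exists>K. compact K \<and> K \<subseteq> S \<and> (\<forall>z. z \<notin> K \<longrightarrow> E n z = 0)"
    "\<And>n. (LINT z|lborel. (cmod (E n z))\<^sup>2 * exp (\<phi> z)) \<le> (A + 1)\<^sup>2"
    "\<And>e. e > 0 \<Longrightarrow> \<exists>N. \<forall>m\<ge>N. \<forall>n\<ge>N. (LINT z|lborel. (cmod (E m z - E n z))\<^sup>2 * exp (\<phi> z)) < e"
    "\<And>b bX bY. C2_test S b bX bY \<Longrightarrow>
       (\<lambda>n. LINT z|lborel. exp (\<phi> z) *\<^sub>R (E n z * cnj (bX z - \<i> * bY z))) \<longlonglongrightarrow> - (LINT z|lborel. \<omega> z * cnj (b z))"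
    by (rule approximate_dbar_solution[OF S p k \<omega> A]) (assumption | rule that)+
  have c\<phi>: "continuous_on S \<phi>" using C2_data_continuous(1)[OF p] .
  have cG: "continuous_on S G"
    by (intro continuous_at_imp_continuous_on ballI has_derivative_continuous, rule G(1))
  have TS: "T \<subseteq> S"
  proof
    fix z assume "z \<in> T"
    from T(5)[OF this] T(2,4) centre_in_cball[of z r] show "z \<in> S" by (auto simp: subset_iff)
  qed
  have cE: "continuous_on A (E n)" for A n using E(1) continuous_on_subset by blast
  define u where "u n z = exp (\<phi> z) *\<^sub>R E n z" for n z
  have supp: "\<exists>K. compact K \<and> K \<subseteq> S \<and> (\<forall>z. z \<notin> K \<longrightarrow> E n z = 0 \<and> u n z = 0)" for n
    using E(2)[of n] unfolding u_def by auto
  have cuS: "continuous_on S (u n)" for n unfolding u_def[abs_def] by (intro continuous_intros c\<phi> cE)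
  have cu: "continuous_on UNIV (u n)" for n
  proof -
    obtain K where K: "compact K" "K \<subseteq> S" "\<And>z. z \<notin> K \<Longrightarrow> u n z = 0" using supp[of n] by auto
    show ?thesis by (rule continuous_zero_extension[OF S K(1,2) cuS K(3)])
  qed
  define \<T> where "\<T> = {\<eta>::complex \<Rightarrow> complex. continuous_on UNIV \<eta> \<and> (\<forall>z. z \<notin> K \<longrightarrow> \<eta> z = 0)}"
  have c\<eta>: "continuous_on A \<eta>" if "\<eta> \<in> \<T>" for \<eta> A using that continuous_on_subset unfolding \<T>_def by blast
  have z\<eta>: "\<eta> z = 0" if "\<eta> \<in> \<T>" "z \<notin> K" for \<eta> z using that unfolding \<T>_def by blast
  have iK: "integrable lborel f" if "continuous_on S f" "\<And>z. z \<notin> K \<Longrightarrow> f z = 0" for f :: "complex \<Rightarrow> 'x::{banach,second_countable_topology}"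
    by (rule integrable_compact_support_on[OF S T(3,4) that(1)]) (rule that(2))
  have iu: "integrable lborel (\<lambda>z. u n z * \<eta> z)" if "\<eta> \<in> \<T>" for n \<eta>
    by (rule iK) (auto intro!: continuous_intros cuS c\<eta>[OF that] simp: z\<eta>[OF that])
  have iG: "integrable lborel (\<lambda>z. G z * \<eta> z)" if "\<eta> \<in> \<T>" for \<eta>
    by (rule iK) (auto intro!: continuous_intros cG c\<eta>[OF that] simp: z\<eta>[OF that])
  define Q where "Q \<eta> = (LINT z|lborel. (cmod (\<eta> z))\<^sup>2 * exp (\<phi> z))" for \<eta> :: "complex \<Rightarrow> complex"
  have Q0: "Q \<eta> \<ge> 0" for \<eta> unfolding Q_def by (intro integral_nonneg_AE) auto
  have CS: "(cmod (LINT z|lborel. exp (\<phi> z) *\<^sub>R F z * \<eta> z))\<^sup>2 \<le> (LINT z|lborel. (cmod (F z))\<^sup>2 * exp (\<phi> z)) * Q \<eta>"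
    if F: "continuous_on UNIV F" "compact K'" "K' \<subseteq> S" "\<And>z. z \<notin> K' \<Longrightarrow> F z = 0" and \<eta>: "\<eta> \<in> \<T>" for F K' \<eta>
  proof -
    have cF: "continuous_on S F" using F(1) continuous_on_subset by blast
    define a b where "a z = cmod (F z) * exp (\<phi> z / 2)" and "b z = cmod (\<eta> z) * exp (\<phi> z / 2)" for z
    have e2: "exp (\<phi> z / 2) ^ 2 = exp (\<phi> z)" for z by (simp add: power2_eq_square exp_add[symmetric])
    have cab: "continuous_on S a" "continuous_on S b"
      unfolding a_def[abs_def] b_def[abs_def] by (intro continuous_intros cF c\<phi> c\<eta>[OF \<eta>]; simp)+
    have za: "a z = 0" if "z \<notin> K'" for z using F(4)[OF that] by (simp add: a_def)
    have zb: "b z = 0" if "z \<notin> K" for z using z\<eta>[OF \<eta> that] by (simp add: b_def)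
    have "(cmod (LINT z|lborel. exp (\<phi> z) *\<^sub>R F z * \<eta> z))\<^sup>2 \<le> (LINT z|lborel. (a z)\<^sup>2) * (LINT z|lborel. (b z)\<^sup>2)"
    proof (rule norm_integral_Cauchy_Schwarz)
      show "integrable lborel (\<lambda>z. (a z)\<^sup>2)"
        by (rule integrable_compact_support_on[OF S F(2,3)]) (auto intro!: continuous_intros cab simp: za)
      show "integrable lborel (\<lambda>z. (b z)\<^sup>2)" "integrable lborel (\<lambda>z. a z * b z)"
        by (rule iK; auto intro!: continuous_intros cab simp: zb)+
      show "integrable lborel (\<lambda>z. exp (\<phi> z) *\<^sub>R F z * \<eta> z)"
        by (rule iK) (auto intro!: continuous_intros c\<phi> cF c\<eta>[OF \<eta>] simp: z\<eta>[OF \<eta>])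
      show "cmod (exp (\<phi> z) *\<^sub>R F z * \<eta> z) \<le> a z * b z" for z
        using e2[of z] by (simp add: a_def b_def norm_mult power2_eq_square mult_ac)
    qed
    then show ?thesis unfolding a_def b_def Q_def power_mult_distrib e2 .
  qed
  \<comment> \<open>The functional \<eta> -> \<integral> u \<eta> for the absent limit u. The value
    of \<open>lim\<close> is meaningful for \<eta> in \<T>, where convergence is shown next.\<close>
  define U where "U \<eta> = lim (\<lambda>n. LINT z|lborel. u n z * \<eta> z)" for \<eta>
  have U: "(\<lambda>n. LINT z|lborel. u n z * \<eta> z) \<longlonglongrightarrow> U \<eta>" if \<eta>: "\<eta> \<in> \<T>" for \<eta>
  proof -
    have "Cauchy (\<lambda>n. LINT z|lborel. u n z * \<eta> z)"
    proof (rule CauchyI)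
      fix e :: real assume e: "e > 0"
      \<comment> \<open>The added 1 covers the case Q \<eta> = 0.\<close>
      define e1 where "e1 = e\<^sup>2 / (Q \<eta> + 1)"
      have e1: "e1 > 0" "e1 * Q \<eta> < e\<^sup>2"
        using e Q0[of \<eta>] by (auto simp: e1_def field_simps)
      obtain N where N: "\<And>m n. m \<ge> N \<Longrightarrow> n \<ge> N \<Longrightarrow> (LINT z|lborel. (cmod (E m z - E n z))\<^sup>2 * exp (\<phi> z)) < e1"
        using E(4)[OF e1(1)] by blast
      have "cmod ((LINT z|lborel. u m z * \<eta> z) - (LINT z|lborel. u n z * \<eta> z)) < e" if mn: "m \<ge> N" "n \<ge> N" for m n
      proof -
        obtain K1 where K1: "compact K1" "K1 \<subseteq> S" "\<And>z. z \<notin> K1 \<Longrightarrow> E m z = 0" using E(2)[of m] by auto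
        obtain K2 where K2: "compact K2" "K2 \<subseteq> S" "\<And>z. z \<notin> K2 \<Longrightarrow> E n z = 0" using E(2)[of n] by auto
        have "(LINT z|lborel. u m z * \<eta> z) - (LINT z|lborel. u n z * \<eta> z) = (LINT z|lborel. exp (\<phi> z) *\<^sub>R (E m z - E n z) * \<eta> z)"
          using iu[OF \<eta>] by (subst Bochner_Integration.integral_diff[symmetric]) (auto simp: u_def algebra_simps)
        then have "(cmod ((LINT z|lborel. u m z * \<eta> z) - (LINT z|lborel. u n z * \<eta> z)))\<^sup>2
           \<le> (LINT z|lborel. (cmod (E m z - E n z))\<^sup>2 * exp (\<phi> z)) * Q \<eta>"
          using CS[of "\<lambda>z. E m z - E n z" "K1 \<union> K2" \<eta>] K1 K2 \<eta> continuous_on_diff[OF E(1)[of m] E(1)[of n]]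
          by (simp add: compact_Un)
        also have "\<dots> \<le> e1 * Q \<eta>" using N[OF mn] Q0 by (intro mult_right_mono) auto
        also have "\<dots> < e\<^sup>2" by (rule e1)
        finally show ?thesis using e by (simp add: power2_less_imp_less)
      qed
      then show "\<exists>M. \<forall>m\<ge>M. \<forall>n\<ge>M. cmod ((LINT z|lborel. u m z * \<eta> z) - (LINT z|lborel. u n z * \<eta> z)) < e"
        by (intro exI[of _ N] allI impI)
    qed
    then have "convergent (\<lambda>n. LINT z|lborel. u n z * \<eta> z)" by (rule Cauchy_convergent)
    then show ?thesis unfolding U_def convergent_LIMSEQ_iff .
  qed
  define IK where "IK = (LINT z|lborel. indicator K z *\<^sub>R exp (\<phi> z))"
  have iIK: "integrable lborel (\<lambda>z. indicator K z *\<^sub>R exp (\<phi> z))"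
    by (intro borel_integrable_compact T(3) continuous_intros continuous_on_subset[OF c\<phi> T(4)])
  define IG where "IG = (LINT z|lborel. indicator K z *\<^sub>R cmod (G z))"
  have iIG: "integrable lborel (\<lambda>z. indicator K z *\<^sub>R cmod (G z))"
    by (intro borel_integrable_compact T(3) continuous_intros continuous_on_subset[OF cG T(4)])
  have IK0: "IK \<ge> 0" "IG \<ge> 0" unfolding IK_def IG_def by (simp_all add: integral_nonneg_AE)
  have M0: "0 \<le> M" if "\<And>\<zeta>. cmod (\<eta> \<zeta>) \<le> M" for M and \<eta> :: "complex \<Rightarrow> complex" by (rule order_trans[OF norm_ge_zero that[of 0]])
  have Qle: "Q \<eta> \<le> M\<^sup>2 * IK" if \<eta>: "\<eta> \<in> \<T>" and M: "\<And>\<zeta>. cmod (\<eta> \<zeta>) \<le> M" for \<eta> M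
  proof -
    have "Q \<eta> \<le> (LINT z|lborel. M\<^sup>2 * (indicator K z *\<^sub>R exp (\<phi> z)))"
      unfolding Q_def
    proof (rule integral_mono)
      show "integrable lborel (\<lambda>z. (cmod (\<eta> z))\<^sup>2 * exp (\<phi> z))"
        by (rule iK) (auto intro!: continuous_intros c\<phi> c\<eta>[OF \<eta>] simp: z\<eta>[OF \<eta>])
      show "integrable lborel (\<lambda>z. M\<^sup>2 * (indicator K z *\<^sub>R exp (\<phi> z)))" using iIK by simp
      show "(cmod (\<eta> z))\<^sup>2 * exp (\<phi> z) \<le> M\<^sup>2 * (indicator K z *\<^sub>R exp (\<phi> z))" for z
        using M[of z] z\<eta>[OF \<eta>, of z] by (cases "z \<in> K") (auto intro!: mult_right_mono power_mono)
    qed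
    then show ?thesis by (simp add: IK_def)
  qed
  have Ubd: "cmod (U \<eta>) \<le> ((A + 1) * sqrt IK) * M" if \<eta>: "\<eta> \<in> \<T>" and M: "\<And>\<zeta>. cmod (\<eta> \<zeta>) \<le> M" for \<eta> M
  proof (rule LIMSEQ_le_const2[OF tendsto_norm[OF U[OF \<eta>]]], intro exI[of _ 0] allI impI)
    fix n
    obtain K1 where K1: "compact K1" "K1 \<subseteq> S" "\<And>z. z \<notin> K1 \<Longrightarrow> E n z = 0" using E(2)[of n] by auto
    have "(cmod (LINT z|lborel. u n z * \<eta> z))\<^sup>2 \<le> (LINT z|lborel. (cmod (E n z))\<^sup>2 * exp (\<phi> z)) * Q \<eta>"
      using CS[OF E(1)[of n] K1 \<eta>] by (simp add: u_def)
    also have "\<dots> \<le> (A + 1)\<^sup>2 * (M\<^sup>2 * IK)"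
      using E(3)[of n] Qle[OF \<eta> M] Q0 by (intro mult_mono) auto
    also have "\<dots> = (((A + 1) * sqrt IK) * M)\<^sup>2" using IK0 by (simp add: power_mult_distrib)
    finally show "cmod (LINT z|lborel. u n z * \<eta> z) \<le> ((A + 1) * sqrt IK) * M"
      by (rule power2_le_imp_le) (intro mult_nonneg_nonneg real_sqrt_ge_zero M0[OF M] IK0 add_nonneg_nonneg A(1), simp)
  qed
  have Ulin: "U (\<lambda>\<zeta>. \<eta> \<zeta> + s * \<theta> \<zeta>) = U \<eta> + s * U \<theta>" if t: "\<eta> \<in> \<T>" "\<theta> \<in> \<T>" for \<eta> \<theta> s
  proof -
    have "(\<lambda>\<zeta>. \<eta> \<zeta> + s * \<theta> \<zeta>) \<in> \<T>" using t unfolding \<T>_def by (auto intro!: continuous_intros)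
    from U[OF this] have "(\<lambda>n. (LINT z|lborel. u n z * \<eta> z) + s * (LINT z|lborel. u n z * \<theta> z)) \<longlonglongrightarrow> U (\<lambda>\<zeta>. \<eta> \<zeta> + s * \<theta> \<zeta>)"
    proof (rule Lim_transform_eventually, intro always_eventually allI)
      fix n
      have "(LINT z|lborel. u n z * (\<eta> z + s * \<theta> z)) = (LINT z|lborel. u n z * \<eta> z + s * (u n z * \<theta> z))"
        by (intro Bochner_Integration.integral_cong) (auto simp: algebra_simps)
      then show "(LINT z|lborel. u n z * (\<eta> z + s * \<theta> z)) = (LINT z|lborel. u n z * \<eta> z) + s * (LINT z|lborel. u n z * \<theta> z)"
        using iu[OF t(1)] iu[OF t(2)] by simp
    qed
    moreover have "(\<lambda>n. (LINT z|lborel. u n z * \<eta> z) + s * (LINT z|lborel. u n z * \<theta> z)) \<longlonglongrightarrow> U \<eta> + s * U \<theta>"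
      by (intro tendsto_intros U t)
    ultimately show ?thesis by (rule LIMSEQ_unique)
  qed
  \<comment> \<open>G - u as a functional on \<T>.\<close>
  define \<Lambda> where "\<Lambda> \<eta> = (LINT z|lborel. G z * \<eta> z) - U \<eta>" for \<eta>
  have bump_in: "(\<lambda>\<zeta>. of_real (bump r 3 (\<zeta> - z))) \<in> \<T>" if z: "z \<in> T" for z
  proof -
    have "bump r 3 (\<zeta> - z) = 0" if "\<zeta> \<notin> K" for \<zeta>
    proof -
      have "\<zeta> \<notin> cball z r" using T(5)[OF z] that by auto
      then show ?thesis by (intro bump_eq_0 T) (auto simp: dist_norm norm_minus_commute)
    qed
    then show ?thesis unfolding \<T>_def by (auto intro!: continuous_intros)
  qed
  have hol: "(\<lambda>z. \<Lambda> (\<lambda>\<zeta>. of_real (bump r 3 (\<zeta> - z)))) holomorphic_on T"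
  proof (rule weakly_holomorphic[OF T(1,2,5) \<T>_def])
    show "\<Lambda> (\<lambda>\<zeta>. \<eta> \<zeta> + s * \<theta> \<zeta>) = \<Lambda> \<eta> + s * \<Lambda> \<theta>" if t: "\<eta> \<in> \<T>" "\<theta> \<in> \<T>" for \<eta> \<theta> s
    proof -
      have "(LINT z|lborel. G z * (\<eta> z + s * \<theta> z)) = (LINT z|lborel. G z * \<eta> z + s * (G z * \<theta> z))"
        by (intro Bochner_Integration.integral_cong) (auto simp: algebra_simps)
      then show ?thesis using iG[OF t(1)] iG[OF t(2)] Ulin[OF t, of s] by (simp add: \<Lambda>_def algebra_simps)
    qed
    show "cmod (\<Lambda> \<eta>) \<le> (IG + (A + 1) * sqrt IK) * M" if \<eta>: "\<eta> \<in> \<T>" and M: "\<And>\<zeta>. cmod (\<eta> \<zeta>) \<le> M" for \<eta> M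
    proof -
      have "cmod (LINT z|lborel. G z * \<eta> z) \<le> (LINT z|lborel. (indicator K z *\<^sub>R cmod (G z)) * M)"
      proof (rule Bochner_Integration.integral_norm_bound_integral[OF iG[OF \<eta>]])
        show "integrable lborel (\<lambda>z. (indicator K z *\<^sub>R cmod (G z)) * M)" using iIG by simp
        show "cmod (G z * \<eta> z) \<le> (indicator K z *\<^sub>R cmod (G z)) * M" for z
          using M[of z] z\<eta>[OF \<eta>, of z] by (cases "z \<in> K") (auto simp: norm_mult intro!: mult_left_mono)
      qed
      also have "\<dots> = IG * M" by (simp add: IG_def)
      finally show ?thesis using Ubd[OF \<eta> M] norm_triangle_ineq4[of "LINT z|lborel. G z * \<eta> z" "U \<eta>"]
        by (simp add: \<Lambda>_def algebra_simps)
    qed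
    show "0 \<le> IG + (A + 1) * sqrt IK" using IK0 A(1) by simp
    fix z assume z: "z \<in> T"
    define b bX bY where "b \<zeta> = complex_of_real (bump r 3 (\<zeta> - z))"
      and "bX \<zeta> = complex_of_real (- 6 / r\<^sup>2 * Re (\<zeta> - z) * bump r 2 (\<zeta> - z))"
      and "bY \<zeta> = complex_of_real (- 6 / r\<^sup>2 * Im (\<zeta> - z) * bump r 2 (\<zeta> - z))" for \<zeta>
    have zK: "cball z r \<subseteq> S" using T(4) T(5)[OF z] by blast
    have t: "C2_test S b bX bY"
      using C2_test_bump[OF T(2) zK] unfolding b_def[abs_def] bX_def[abs_def] bY_def[abs_def] .
    have zb: "b \<zeta> = 0" "bX \<zeta> = 0" "bY \<zeta> = 0" if "\<zeta> \<notin> K" for \<zeta>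
    proof -
      have "\<zeta> \<notin> cball z r" using T(5)[OF z] that by auto
      then have "r \<le> cmod (\<zeta> - z)" by (simp add: dist_norm norm_minus_commute)
      then show "b \<zeta> = 0" "bX \<zeta> = 0" "bY \<zeta> = 0"
        using bump_eq_0[OF T(2), of 3 "\<zeta> - z"] bump_eq_0[OF T(2), of 2 "\<zeta> - z"] by (simp_all add: b_def bX_def bY_def)
    qed
    have cb: "continuous_on A b" "continuous_on A bX" "continuous_on A bY" for A
      using C2_test_continuous[OF t] continuous_on_subset by blast+
    have bin: "(\<lambda>\<zeta>. bX \<zeta> + \<i> * bY \<zeta>) \<in> \<T>"
      unfolding \<T>_def using zb by (auto intro!: continuous_intros cb)
    \<comment> \<open>The kernel is real, so conjugation only turns d_x - i d_y into d_x + i d_y,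
      the operator that \<open>weakly_holomorphic\<close> tests.\<close>
    have cnjb: "cnj (b \<zeta>) = b \<zeta>" "cnj (bX \<zeta> - \<i> * bY \<zeta>) = bX \<zeta> + \<i> * bY \<zeta>" for \<zeta>
      by (simp_all add: b_def bX_def bY_def)
    have "(\<lambda>n. LINT z|lborel. u n z * (bX z + \<i> * bY z)) \<longlonglongrightarrow> - (LINT z|lborel. \<omega> z * b z)"
      using E(5)[OF t] unfolding cnjb u_def by simp
    then have UU: "U (\<lambda>\<zeta>. bX \<zeta> + \<i> * bY \<zeta>) = - (LINT z|lborel. \<omega> z * b z)"
      using U[OF bin] LIMSEQ_unique by blast
    obtain bxx bxy byy K' where "C2_test_data S K' b bX bY bxx bxy byy" using t unfolding C2_test_def by auto
    note b = C2_test_dataD(3)[OF this]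
    \<comment> \<open>The partials of G b. Integrating them to 0 gives \<integral> G (b_x + i b_y) =
      -\<integral> \<omega> b, the same value that U takes, so the two parts of \<Lambda>
      cancel.\<close>
    define fx fy where "fx \<zeta> = G \<zeta> * bX \<zeta> + gx \<zeta> * b \<zeta>" and "fy \<zeta> = G \<zeta> * bY \<zeta> + gy \<zeta> * b \<zeta>" for \<zeta>
    have cf: "continuous_on S fx" "continuous_on S fy"
      unfolding fx_def[abs_def] fy_def[abs_def] by (intro continuous_intros cG G cb)+
    have zf: "fx \<zeta> = 0" "fy \<zeta> = 0" if "\<zeta> \<notin> K" for \<zeta> using zb[OF that] by (simp_all add: fx_def fy_def)
    have d: "pderivs (\<lambda>\<zeta>. G \<zeta> * b \<zeta>) (fx \<zeta>) (fy \<zeta>) \<zeta>" if "\<zeta> \<in> S" for \<zeta>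
      unfolding fx_def fy_def
      by (rule has_derivative_eq_rhs[OF has_derivative_mult[OF G(1)[OF that] b]])
         (rule ext, simp add: scaleR_conv_of_real algebra_simps)
    have I: "integral\<^sup>L lborel fx = 0" "integral\<^sup>L lborel fy = 0"
      by (rule integral_pderiv_eq_0[OF S T(3,4) d cf]; simp add: zf zb)+
    have "0 = integral\<^sup>L lborel fx + \<i> * integral\<^sup>L lborel fy" by (simp add: I)
    also have "\<dots> = (LINT \<zeta>|lborel. fx \<zeta> + \<i> * fy \<zeta>)" using iK[OF cf(1) zf(1)] iK[OF cf(2) zf(2)] by simp
    also have "\<dots> = (LINT \<zeta>|lborel. G \<zeta> * (bX \<zeta> + \<i> * bY \<zeta>) + \<omega> \<zeta> * b \<zeta>)"
    proof (rule Bochner_Integration.integral_cong)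
      fix \<zeta>
      show "fx \<zeta> + \<i> * fy \<zeta> = G \<zeta> * (bX \<zeta> + \<i> * bY \<zeta>) + \<omega> \<zeta> * b \<zeta>"
      proof (cases "\<zeta> \<in> K")
        case True
        then have "\<omega> \<zeta> = gx \<zeta> + \<i> * gy \<zeta>" using \<omega>G[of \<zeta>] T(4) by auto
        then show ?thesis by (simp add: fx_def fy_def algebra_simps)
      next
        case False then show ?thesis using zf zb by simp
      qed
    qed simp
    also have "\<dots> = (LINT \<zeta>|lborel. G \<zeta> * (bX \<zeta> + \<i> * bY \<zeta>)) + (LINT \<zeta>|lborel. \<omega> \<zeta> * b \<zeta>)"
    proof (rule Bochner_Integration.integral_add[OF iG[OF bin]])
      have "continuous_on S \<omega>" using \<omega>(1) continuous_on_subset by blast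
      then show "integrable lborel (\<lambda>\<zeta>. \<omega> \<zeta> * b \<zeta>)" by (intro iK) (auto intro!: continuous_intros cb simp: zb)
    qed
    finally have "\<Lambda> (\<lambda>\<zeta>. bX \<zeta> + \<i> * bY \<zeta>) = 0" unfolding \<Lambda>_def UU by (simp add: algebra_simps)
    then show "\<Lambda> (\<lambda>\<zeta>. complex_of_real (- 6 / r\<^sup>2 * Re (\<zeta> - z) * bump r 2 (\<zeta> - z)) +
       \<i> * complex_of_real (- 6 / r\<^sup>2 * Im (\<zeta> - z) * bump r 2 (\<zeta> - z))) = 0"
      unfolding bX_def bY_def .
  qed
  define c where "c = (LINT y|lborel. bump r 3 y)"
  have c0: "c > 0"
  proof -
    have "0 < (3/4) ^ 3 * (pi * (r/2)\<^sup>2)" using T(2) by simp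
    also have "\<dots> \<le> c" using integral_bump_ge(2)[OF T(2), of 3 0] by (simp add: c_def)
    finally show ?thesis .
  qed
  have ib: "integrable lborel (\<lambda>\<zeta>. bump r 3 (\<zeta> - z))" for z using integral_bump_ge(1)[OF T(2)] by simp
  have bm: "bump r 3 \<in> borel_measurable borel" by (intro borel_measurable_continuous_onI continuous_intros)
  have cz: "(LINT \<zeta>|lborel. bump r 3 (\<zeta> - z)) = c" for z
    using lborel_integral_translation[OF bm, of "-z"] by (simp add: c_def)
  define kn where "kn n z = (LINT \<zeta>|lborel. u n \<zeta> * of_real (bump r 3 (\<zeta> - z))) / of_real c" for n z
  \<comment> \<open>The pointwise limit is known only on T; defining k by \<open>lim\<close>
    everywhere makes it measurable on the whole plane.\<close>
  define k where "k z = lim (\<lambda>n. kn n z)" for z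
  have um [measurable]: "u n \<in> borel_measurable borel" for n using cu by (rule borel_measurable_continuous_onI)
  note bm [measurable]
  have knm [measurable]: "kn n \<in> borel_measurable borel" for n
    unfolding kn_def[abs_def] by measurable
  have km: "k \<in> borel_measurable borel" unfolding k_def[abs_def] by measurable
  have kU: "k z = U (\<lambda>\<zeta>. of_real (bump r 3 (\<zeta> - z))) / of_real c" "(\<lambda>n. kn n z) \<longlonglongrightarrow> k z" if "z \<in> T" for z
  proof -
    have *: "(\<lambda>n. kn n z) \<longlonglongrightarrow> U (\<lambda>\<zeta>. of_real (bump r 3 (\<zeta> - z))) / of_real c"
      unfolding kn_def using c0 by (intro tendsto_intros U bump_in that) simp
    then show "k z = U (\<lambda>\<zeta>. of_real (bump r 3 (\<zeta> - z))) / of_real c" unfolding k_def by (rule limI)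
    then show "(\<lambda>n. kn n z) \<longlonglongrightarrow> k z" using * by simp
  qed
  define h where "h z = \<Lambda> (\<lambda>\<zeta>. of_real (bump r 3 (\<zeta> - z))) / of_real c" for z
  \<comment> \<open>Cauchy-Schwarz for the probability density bump / c: the square of a mean is at
    most the mean of the squares.\<close>
  have kn2: "(cmod (kn n z))\<^sup>2 \<le> (LINT \<zeta>|lborel. (cmod (u n \<zeta>))\<^sup>2 * bump r 3 (\<zeta> - z)) / c" 
     and kni: "integrable lborel (\<lambda>\<zeta>. (cmod (u n \<zeta>))\<^sup>2 * bump r 3 (\<zeta> - z))" for n z
  proof -
    define a b where "a \<zeta> = cmod (u n \<zeta>) * sqrt (bump r 3 (\<zeta> - z))" and "b \<zeta> = sqrt (bump r 3 (\<zeta> - z))" for \<zeta>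
    have a2: "(a \<zeta>)\<^sup>2 = (cmod (u n \<zeta>))\<^sup>2 * bump r 3 (\<zeta> - z)" and b2: "(b \<zeta>)\<^sup>2 = bump r 3 (\<zeta> - z)" for \<zeta>
      using bump_nonneg[of r 3 "\<zeta> - z"] by (simp_all add: a_def b_def power_mult_distrib)
    have cab: "continuous_on UNIV a" "continuous_on UNIV b"
      unfolding a_def[abs_def] b_def[abs_def] by (intro continuous_intros cu)+
    obtain K1 where K1: "compact K1" "\<And>z. z \<notin> K1 \<Longrightarrow> u n z = 0" using supp[of n] by auto
    have za: "a \<zeta> = 0" if "\<zeta> \<notin> K1" for \<zeta> using K1(2)[OF that] by (simp add: a_def)
    show kni: "integrable lborel (\<lambda>\<zeta>. (cmod (u n \<zeta>))\<^sup>2 * bump r 3 (\<zeta> - z))"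
      by (rule integrable_compact_support[OF _ K1(1)]) (auto intro!: continuous_intros cu simp: K1(2))
    have "(cmod (LINT \<zeta>|lborel. u n \<zeta> * of_real (bump r 3 (\<zeta> - z))))\<^sup>2 \<le> (LINT \<zeta>|lborel. (a \<zeta>)\<^sup>2) * (LINT \<zeta>|lborel. (b \<zeta>)\<^sup>2)"
    proof (rule norm_integral_Cauchy_Schwarz)
      show "integrable lborel (\<lambda>\<zeta>. (a \<zeta>)\<^sup>2)" "integrable lborel (\<lambda>\<zeta>. (b \<zeta>)\<^sup>2)" unfolding a2 b2 using kni ib by simp_all
      show "integrable lborel (\<lambda>\<zeta>. a \<zeta> * b \<zeta>)"
        by (rule integrable_compact_support[OF _ K1(1)]) (auto intro!: continuous_intros cab simp: za)
      show "integrable lborel (\<lambda>\<zeta>. u n \<zeta> * of_real (bump r 3 (\<zeta> - z)))"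
        by (rule integrable_compact_support[OF _ K1(1)]) (auto intro!: continuous_intros cu simp: K1(2))
      show "cmod (u n \<zeta> * of_real (bump r 3 (\<zeta> - z))) \<le> a \<zeta> * b \<zeta>" for \<zeta>
        using b2[of \<zeta>] bump_nonneg[of r 3 "\<zeta> - z"] by (simp add: a_def b_def norm_mult mult.assoc)
    qed
    then have "(cmod (LINT \<zeta>|lborel. u n \<zeta> * of_real (bump r 3 (\<zeta> - z))))\<^sup>2 \<le> (LINT \<zeta>|lborel. (cmod (u n \<zeta>))\<^sup>2 * bump r 3 (\<zeta> - z)) * c"
      unfolding a2 b2 cz .
    then show "(cmod (kn n z))\<^sup>2 \<le> (LINT \<zeta>|lborel. (cmod (u n \<zeta>))\<^sup>2 * bump r 3 (\<zeta> - z)) / c"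
      using c0 by (simp add: kn_def norm_divide power_divide field_simps power2_eq_square)
  qed
  define \<phi>T where "\<phi>T z = indicator T z *\<^sub>R exp (- \<phi> z)" for z
  have \<phi>Tm [measurable]: "\<phi>T \<in> borel_measurable borel"
    unfolding \<phi>T_def[abs_def] using T(1)
    by (intro borel_measurable_continuous_on_indicator continuous_intros continuous_on_subset[OF c\<phi> TS]) auto
  have \<phi>T0: "\<phi>T z \<ge> 0" for z by (simp add: \<phi>T_def)
  have bound: "(\<integral>\<^sup>+z. ennreal (\<phi>T z * (cmod (kn n z))\<^sup>2) \<partial>lborel) \<le> ennreal (2 * (A + 1)\<^sup>2)" for n
  proof -
    \<comment> \<open>After Fubini the inner integration is over z. There \<open>osc\<close>
      replaces e^(-\<phi>(z)) by 2 e^(-\<phi>(\<zeta>)), and e^(-\<phi>) |u|^2 = e^\<phi> |E|^2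
      restores the norm of E.\<close>
    define w where "w z \<zeta> = \<phi>T z * (cmod (u n \<zeta>))\<^sup>2 * bump r 3 (\<zeta> - z) / c" for z \<zeta>
    have "(\<integral>\<^sup>+z. ennreal (\<phi>T z * (cmod (kn n z))\<^sup>2) \<partial>lborel) \<le> (\<integral>\<^sup>+z. (\<integral>\<^sup>+\<zeta>. ennreal (w z \<zeta>) \<partial>lborel) \<partial>lborel)"
    proof (rule nn_integral_mono)
      fix z
      have "ennreal (\<phi>T z * (cmod (kn n z))\<^sup>2) \<le> ennreal (\<phi>T z * ((LINT \<zeta>|lborel. (cmod (u n \<zeta>))\<^sup>2 * bump r 3 (\<zeta> - z)) / c))"
        using kn2 \<phi>T0 by (intro ennreal_leI mult_left_mono)
      also have "\<phi>T z * ((LINT \<zeta>|lborel. (cmod (u n \<zeta>))\<^sup>2 * bump r 3 (\<zeta> - z)) / c) = (LINT \<zeta>|lborel. w z \<zeta>)"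
        unfolding w_def by (simp add: mult.assoc)
      also have "ennreal (LINT \<zeta>|lborel. w z \<zeta>) = (\<integral>\<^sup>+\<zeta>. ennreal (w z \<zeta>) \<partial>lborel)"
      proof (rule nn_integral_eq_integral[symmetric])
        show "integrable lborel (w z)" unfolding w_def[abs_def] using kni by (simp add: mult.assoc)
        show "AE \<zeta> in lborel. 0 \<le> w z \<zeta>" using \<phi>T0 bump_nonneg c0 by (simp add: w_def)
      qed
      finally show "ennreal (\<phi>T z * (cmod (kn n z))\<^sup>2) \<le> (\<integral>\<^sup>+\<zeta>. ennreal (w z \<zeta>) \<partial>lborel)" .
    qed
    also have "\<dots> = (\<integral>\<^sup>+\<zeta>. (\<integral>\<^sup>+z. ennreal (w z \<zeta>) \<partial>lborel) \<partial>lborel)"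
      by (rule lborel_pair.Fubini'[symmetric]) (simp add: w_def[abs_def])
    also have "\<dots> \<le> (\<integral>\<^sup>+\<zeta>. ennreal (2 * ((cmod (E n \<zeta>))\<^sup>2 * exp (\<phi> \<zeta>))) \<partial>lborel)"
    proof (rule nn_integral_mono)
      fix \<zeta>
      define q where "q = 2 * ((cmod (E n \<zeta>))\<^sup>2 * exp (\<phi> \<zeta>)) / c"
      have q0: "q \<ge> 0" using c0 by (simp add: q_def)
      have bsym: "bump r 3 (\<zeta> - z) = bump r 3 (z - \<zeta>)" for z using bump_minus[of r 3 "z - \<zeta>"] by simp
      have "(\<integral>\<^sup>+z. ennreal (w z \<zeta>) \<partial>lborel) \<le> (\<integral>\<^sup>+z. ennreal (q * bump r 3 (z - \<zeta>)) \<partial>lborel)"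
      proof (intro nn_integral_mono ennreal_leI)
        fix z
        show "w z \<zeta> \<le> q * bump r 3 (z - \<zeta>)"
        proof (cases "z \<in> T \<and> \<zeta> \<in> cball z r")
          case True
          have "\<phi>T z * (cmod (u n \<zeta>))\<^sup>2 \<le> (2 * exp (- \<phi> \<zeta>)) * (cmod (u n \<zeta>))\<^sup>2"
            using True osc(1)[of z \<zeta>] by (intro mult_right_mono) (auto simp: \<phi>T_def)
          also have "\<dots> = 2 * ((cmod (E n \<zeta>))\<^sup>2 * exp (\<phi> \<zeta>))"
            by (simp add: u_def power_mult_distrib power2_eq_square exp_minus field_simps)
          finally have "\<phi>T z * (cmod (u n \<zeta>))\<^sup>2 \<le> 2 * ((cmod (E n \<zeta>))\<^sup>2 * exp (\<phi> \<zeta>))" .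
          then have "\<phi>T z * (cmod (u n \<zeta>))\<^sup>2 * (bump r 3 (\<zeta> - z) / c) \<le> 2 * ((cmod (E n \<zeta>))\<^sup>2 * exp (\<phi> \<zeta>)) * (bump r 3 (\<zeta> - z) / c)"
            using bump_nonneg c0 by (intro mult_right_mono) auto
          then show ?thesis by (simp add: w_def q_def bsym)
        next
          case False
          then have "\<phi>T z * bump r 3 (\<zeta> - z) = 0"
            using bump_eq_0[OF T(2), of 3 "\<zeta> - z"] by (cases "z \<in> T") (auto simp: \<phi>T_def dist_norm norm_minus_commute)
          then have "w z \<zeta> = 0" by (auto simp: w_def)
          then show ?thesis using q0 bump_nonneg by simp
        qed
      qed
      also have "\<dots> = ennreal (LINT z|lborel. q * bump r 3 (z - \<zeta>))"
        using ib[of \<zeta>] q0 bump_nonneg by (intro nn_integral_eq_integral) auto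
      also have "(LINT z|lborel. q * bump r 3 (z - \<zeta>)) = 2 * ((cmod (E n \<zeta>))\<^sup>2 * exp (\<phi> \<zeta>))"
        using cz[of \<zeta>] c0 by (simp add: q_def)
      finally show "(\<integral>\<^sup>+z. ennreal (w z \<zeta>) \<partial>lborel) \<le> ennreal (2 * ((cmod (E n \<zeta>))\<^sup>2 * exp (\<phi> \<zeta>)))" .
    qed
    also have "\<dots> = ennreal (LINT \<zeta>|lborel. 2 * ((cmod (E n \<zeta>))\<^sup>2 * exp (\<phi> \<zeta>)))"
    proof (rule nn_integral_eq_integral)
      obtain K1 where K1: "compact K1" "K1 \<subseteq> S" "\<And>z. z \<notin> K1 \<Longrightarrow> E n z = 0" using E(2)[of n] by auto
      show "integrable lborel (\<lambda>\<zeta>. 2 * ((cmod (E n \<zeta>))\<^sup>2 * exp (\<phi> \<zeta>)))"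
        by (rule integrable_compact_support_on[OF S K1(1,2)]) (auto intro!: continuous_intros c\<phi> cE simp: K1(3))
    qed simp
    also have "\<dots> \<le> ennreal (2 * (A + 1)\<^sup>2)" using E(3)[of n] by (intro ennreal_leI) simp
    finally show ?thesis .
  qed
  show ?thesis
  proof (rule that[of h k])
    show "h holomorphic_on T" unfolding h_def[abs_def] using hol c0 by (intro holomorphic_intros) auto
    show "k \<in> borel_measurable borel" by (rule km)
    fix z assume z: "z \<in> T"
    have i: "integrable lborel (\<lambda>\<zeta>. G \<zeta> * of_real (bump r 3 (\<zeta> - z)))" by (rule iG[OF bump_in[OF z]])
    have i2: "integrable lborel (\<lambda>\<zeta>. G z * of_real (bump r 3 (\<zeta> - z)))" using ib[of z] by simp
    have "h z - (G z - k z) = ((LINT \<zeta>|lborel. G \<zeta> * of_real (bump r 3 (\<zeta> - z))) - G z * of_real c) / of_real c"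
      using c0 by (simp add: h_def \<Lambda>_def kU[OF z] field_simps)
    also have "G z * of_real c = (LINT \<zeta>|lborel. G z * of_real (bump r 3 (\<zeta> - z)))"
      using cz[of z] ib[of z] by simp
    also have "(LINT \<zeta>|lborel. G \<zeta> * of_real (bump r 3 (\<zeta> - z))) - \<dots> = (LINT \<zeta>|lborel. (G \<zeta> - G z) * of_real (bump r 3 (\<zeta> - z)))"
      using Bochner_Integration.integral_diff[OF i i2] by (simp add: algebra_simps)
    also have "cmod (\<dots> / of_real c) = cmod (LINT \<zeta>|lborel. (G \<zeta> - G z) * of_real (bump r 3 (\<zeta> - z))) / c"
      using c0 by (simp add: norm_divide)
    also have "cmod (LINT \<zeta>|lborel. (G \<zeta> - G z) * of_real (bump r 3 (\<zeta> - z))) \<le> (LINT \<zeta>|lborel. \<delta> * bump r 3 (\<zeta> - z))"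
    proof (rule Bochner_Integration.integral_norm_bound_integral)
      show "integrable lborel (\<lambda>\<zeta>. (G \<zeta> - G z) * of_real (bump r 3 (\<zeta> - z)))"
        using Bochner_Integration.integrable_diff[OF i i2] by (simp add: algebra_simps)
      show "integrable lborel (\<lambda>\<zeta>. \<delta> * bump r 3 (\<zeta> - z))" using ib[of z] by simp
      fix \<zeta>
      show "cmod ((G \<zeta> - G z) * of_real (bump r 3 (\<zeta> - z))) \<le> \<delta> * bump r 3 (\<zeta> - z)"
      proof (cases "\<zeta> \<in> cball z r")
        case True then show ?thesis using osc(2)[OF z True] bump_nonneg[of r 3 "\<zeta> - z"] by (auto simp: norm_mult intro!: mult_right_mono)
      next
        case False then have "bump r 3 (\<zeta> - z) = 0" by (intro bump_eq_0 T) (auto simp: dist_norm norm_minus_commute)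
        then show ?thesis by simp
      qed
    qed
    also have "\<dots> = \<delta> * c" using cz[of z] by simp
    finally show "cmod (h z - (G z - k z)) \<le> \<delta>" using c0 by (simp add: divide_right_mono field_simps)
  next
    have "(\<integral>\<^sup>+z. indicator T z * ennreal (exp (- \<phi> z) * (cmod (k z))\<^sup>2) \<partial>lborel)
       = (\<integral>\<^sup>+z. liminf (\<lambda>n. ennreal (\<phi>T z * (cmod (kn n z))\<^sup>2)) \<partial>lborel)"
    proof (rule nn_integral_cong)
      fix z
      show "indicator T z * ennreal (exp (- \<phi> z) * (cmod (k z))\<^sup>2) = liminf (\<lambda>n. ennreal (\<phi>T z * (cmod (kn n z))\<^sup>2))"
      proof (cases "z \<in> T")
        case True
        have "(\<lambda>n. ennreal (\<phi>T z * (cmod (kn n z))\<^sup>2)) \<longlonglongrightarrow> ennreal (\<phi>T z * (cmod (k z))\<^sup>2)"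
          by (intro tendsto_ennrealI tendsto_intros kU True)
        then have "liminf (\<lambda>n. ennreal (\<phi>T z * (cmod (kn n z))\<^sup>2)) = ennreal (\<phi>T z * (cmod (k z))\<^sup>2)"
          by (intro lim_imp_Liminf) simp_all
        then show ?thesis using True unfolding \<phi>T_def by simp
      next
        case False then show ?thesis by (simp add: \<phi>T_def Liminf_const)
      qed
    qed
    also have "\<dots> \<le> liminf (\<lambda>n. \<integral>\<^sup>+z. ennreal (\<phi>T z * (cmod (kn n z))\<^sup>2) \<partial>lborel)"
      by (rule nn_integral_liminf) measurable
    also have "\<dots> \<le> ennreal (2 * (A + 1)\<^sup>2)"
      using bound by (intro Liminf_le always_eventually allI) simp_all
    finally show "(\<integral>\<^sup>+z. indicator T z * ennreal (exp (- \<phi> z) * (cmod (k z))\<^sup>2) \<partial>lborel) \<le> ennreal (2 * (A + 1)\<^sup>2)" .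
  qed
qed

section \<open>Peak functions\<close>

lemma C2_data_radial:
  fixes f f1 f2 :: "real \<Rightarrow> real" and w :: complex
  assumes T: "T > 0"
    and f: "\<And>t. t \<ge> 0 \<Longrightarrow> (f has_real_derivative f1 t) (at t)" "\<And>t. t \<ge> 0 \<Longrightarrow> (f1 has_real_derivative f2 t) (at t)"
    and c: "continuous_on {0..} f2"
  defines "X \<equiv> \<lambda>z::complex. ((Re (z - w))\<^sup>2 + (Im (z - w))\<^sup>2) / T"
  shows "C2_data UNIV (\<lambda>z. f (X z)) (\<lambda>z. f1 (X z) * (2 / T * Re (z - w))) (\<lambda>z. f1 (X z) * (2 / T * Im (z - w)))
    (\<lambda>z. f2 (X z) * (2 / T * Re (z - w))\<^sup>2 + f1 (X z) * (2 / T)) (\<lambda>z. f2 (X z) * (2 / T * Im (z - w)) * (2 / T * Re (z - w)))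
    (\<lambda>z. f2 (X z) * (2 / T * Re (z - w)) * (2 / T * Im (z - w))) (\<lambda>z. f2 (X z) * (2 / T * Im (z - w))\<^sup>2 + f1 (X z) * (2 / T))"
proof -
  have X0: "X z \<ge> 0" for z using T by (simp add: X_def)
  define x y where "x z = 2 / T * Re (z - w)" and "y z = 2 / T * Im (z - w)" for z
  have dX: "(X has_derivative (\<lambda>t. Re t * x z + Im t * y z)) (at z)" for z
    using T unfolding X_def x_def y_def divide_inverse by (auto intro!: derivative_eq_intros simp: fun_eq_iff algebra_simps)
  have dx: "(x has_derivative (\<lambda>t. Re t * (2/T))) (at z)" "(y has_derivative (\<lambda>t. Im t * (2/T))) (at z)" for z
    using T unfolding x_def y_def by (auto intro!: derivative_eq_intros simp: fun_eq_iff algebra_simps)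
  have comp: "((\<lambda>z. g (X z)) has_derivative (\<lambda>t. Re t * (g' (X z) * x z) + Im t * (g' (X z) * y z))) (at z)"
    if "\<And>t. t \<ge> 0 \<Longrightarrow> (g has_real_derivative g' t) (at t)" for g g' z
    by (rule has_derivative_eq_rhs[OF has_derivative_compose[OF dX has_field_derivative_imp_has_derivative[OF that[OF X0[of z]]]]])
       (auto simp: fun_eq_iff algebra_simps)
  have cX: "continuous_on UNIV X" by (intro continuous_at_imp_continuous_on ballI has_derivative_continuous, rule dX)
  have cxy: "continuous_on UNIV x" "continuous_on UNIV y" unfolding x_def[abs_def] y_def[abs_def] by (intro continuous_intros)+
  have cf2: "continuous_on UNIV (\<lambda>z. f2 (X z))" by (rule continuous_on_compose2[OF c cX]) (use X0 in auto)
  have cf1: "continuous_on UNIV (\<lambda>z. f1 (X z))"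
    by (intro continuous_at_imp_continuous_on ballI has_derivative_continuous, rule comp[OF f(2)])
  have d1: "pderivs (\<lambda>z. f (X z)) (f1 (X z) * x z) (f1 (X z) * y z) z" for z
    using comp[OF f(1), of z] by simp
  have d2: "pderivs (\<lambda>z. f1 (X z) * x z) (f2 (X z) * (x z)\<^sup>2 + f1 (X z) * (2/T)) (f2 (X z) * y z * x z) z" for z
    by (rule has_derivative_eq_rhs[OF has_derivative_mult[OF comp[OF f(2), of z] dx(1)]])
       (auto simp: fun_eq_iff power2_eq_square algebra_simps)
  have d3: "pderivs (\<lambda>z. f1 (X z) * y z) (f2 (X z) * x z * y z) (f2 (X z) * (y z)\<^sup>2 + f1 (X z) * (2/T)) z" for z
    by (rule has_derivative_eq_rhs[OF has_derivative_mult[OF comp[OF f(2), of z] dx(2)]])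
       (auto simp: fun_eq_iff power2_eq_square algebra_simps)
  show ?thesis
    unfolding C2_data_def x_def[symmetric] y_def[symmetric]
    by (intro conjI ballI d1 d2 d3 continuous_intros cf1 cf2 cxy)
qed

lemma C2_data_combine:
  assumes "C2_data S f fx fy fxx fxy fyx fyy" "C2_data S g gx gy gxx gxy gyx gyy"
  shows "C2_data S (\<lambda>z. a * f z + b * g z) (\<lambda>z. a * fx z + b * gx z) (\<lambda>z. a * fy z + b * gy z) (\<lambda>z. a * fxx z + b * gxx z)
    (\<lambda>z. a * fxy z + b * gxy z) (\<lambda>z. a * fyx z + b * gyx z) (\<lambda>z. a * fyy z + b * gyy z)"
proof -
  have d: "pderivs (\<lambda>z. a * p z + b * q z) (a * px + b * qx) (a * py + b * qy) z"
    if "pderivs p px py z" "pderivs q qx qy z" for p q :: "complex \<Rightarrow> real" and px py qx qy z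
    by (rule has_derivative_eq_rhs[OF has_derivative_add[OF has_derivative_mult_right[OF that(1), of a] has_derivative_mult_right[OF that(2), of b]]])
       (auto simp: fun_eq_iff algebra_simps)
  have f: "pderivs f (fx z) (fy z) z" "pderivs fx (fxx z) (fxy z) z" "pderivs fy (fyx z) (fyy z) z" if "z \<in> S" for z
    using assms(1) that unfolding C2_data_def by blast+
  have g: "pderivs g (gx z) (gy z) z" "pderivs gx (gxx z) (gxy z) z" "pderivs gy (gyx z) (gyy z) z" if "z \<in> S" for z
    using assms(2) that unfolding C2_data_def by blast+
  have c: "continuous_on S fxx" "continuous_on S fxy" "continuous_on S fyx" "continuous_on S fyy"
     "continuous_on S gxx" "continuous_on S gxy" "continuous_on S gyx" "continuous_on S gyy"
    using assms unfolding C2_data_def by blast+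
  show ?thesis unfolding C2_data_def
    by (intro conjI ballI d f g continuous_intros c)
qed

lemma C2_data_subset: "C2_data S f fx fy fxx fxy fyx fyy \<Longrightarrow> S' \<subseteq> S \<Longrightarrow> C2_data S' f fx fy fxx fxy fyx fyy"
  unfolding C2_data_def by (auto intro: continuous_on_subset)

lemma tanh_le_self:
  assumes "(y::real) \<ge> 0"
  shows "tanh y \<le> y"
proof -
  have "(0::real) - tanh 0 \<le> y - tanh y"
  proof (rule DERIV_nonneg_imp_nondecreasing[OF assms])
    fix x :: real
    show "\<exists>d. ((\<lambda>x. x - tanh x) has_real_derivative d) (at x) \<and> 0 \<le> d"
      by (rule exI[of _ "(tanh x)\<^sup>2"]) (auto intro!: derivative_eq_intros)
  qed
  then show ?thesis by simp
qed

text \<open>As \<open>\<epsilon>\<close> gets small this function of \<open>t = |z - w|\<^sup>2 / T\<close> passes from slope \<open>0\<close> to logarithmic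
  growth so slowly that its Laplacian costs only a small multiple of \<open>1 / (T (1 + t))\<close>.\<close>

definition slow_log :: "real \<Rightarrow> real \<Rightarrow> real" where
  "slow_log \<epsilon> t = ln (cosh (\<epsilon> * ln (1 + t))) / \<epsilon>"

lemma slow_log_DERIV:
  assumes "\<epsilon> > 0" "t \<ge> 0"
  shows "(slow_log \<epsilon> has_real_derivative tanh (\<epsilon> * ln (1 + t)) / (1 + t)) (at t)"
    "((\<lambda>t. tanh (\<epsilon> * ln (1 + t)) / (1 + t)) has_real_derivative
       (\<epsilon> * (1 - (tanh (\<epsilon> * ln (1 + t)))\<^sup>2) - tanh (\<epsilon> * ln (1 + t))) / (1 + t)\<^sup>2) (at t)"
proof -
  define y where "y t = \<epsilon> * ln (1 + t)" for t
  have y: "(y has_real_derivative \<epsilon> / (1 + t)) (at t)"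
    unfolding y_def[abs_def] using assms by (auto intro!: derivative_eq_intros)
  have d1: "((\<lambda>t. cosh (y t)) has_real_derivative sinh (y t) * (\<epsilon> / (1 + t))) (at t)"
    by (auto intro!: derivative_eq_intros y)
  have "((\<lambda>t. ln (cosh (y t))) has_real_derivative 1 / cosh (y t) * (sinh (y t) * (\<epsilon> / (1 + t)))) (at t)"
    by (rule DERIV_chain2[where f=ln and g="\<lambda>t. cosh (y t)" and x=t and s=UNIV, OF DERIV_ln_divide[OF cosh_real_pos[of "y t"]] d1])
  from DERIV_cdivide[OF this, of \<epsilon>]
  show "(slow_log \<epsilon> has_real_derivative tanh (\<epsilon> * ln (1 + t)) / (1 + t)) (at t)"
    unfolding slow_log_def[abs_def] y_def by (rule DERIV_cong) (use assms in \<open>simp add: tanh_def\<close>)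
  show "((\<lambda>t. tanh (\<epsilon> * ln (1 + t)) / (1 + t)) has_real_derivative
       (\<epsilon> * (1 - (tanh (\<epsilon> * ln (1 + t)))\<^sup>2) - tanh (\<epsilon> * ln (1 + t))) / (1 + t)\<^sup>2) (at t)"
  proof -
    have d2: "((\<lambda>t. tanh (y t)) has_real_derivative (1 - (tanh (y t))\<^sup>2) * (\<epsilon> / (1 + t))) (at t)"
      by (rule DERIV_cong[OF has_field_derivative_tanh[OF _ y]]) auto
    have d3: "((\<lambda>t. 1 + t) has_real_derivative 1) (at t)" by (auto intro!: derivative_eq_intros)
    have "1 + t \<noteq> 0" using assms by simp
    from DERIV_divide[OF d2 d3 this] show ?thesis
      unfolding y_def by (rule DERIV_cong) (use assms in \<open>simp add: power2_eq_square\<close>)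
  qed
qed

text \<open>With y = \<epsilon> ln (1 + t), the inequalities e^y / 2 <= cosh y <= e^y place
  \<open>slow_log\<close> between ln (1 + t) - ln 2 / \<epsilon> and ln (1 + t). The loss is a
  constant once \<epsilon> is fixed.\<close>

lemma slow_log_bounds:
  assumes "\<epsilon> > 0" "t \<ge> 0"
  shows "1 + t \<le> exp (ln 2 / \<epsilon>) * exp (slow_log \<epsilon> t)" "exp (slow_log \<epsilon> t) \<le> 1 + t"
proof -
  define y where "y = \<epsilon> * ln (1 + t)"
  have y: "y \<ge> 0" using assms by (simp add: y_def)
  have c: "exp y / 2 \<le> cosh y" "cosh y \<le> exp y" using y by (simp_all add: cosh_def)
  have "ln (exp y / 2) \<le> ln (cosh y)" using c by (subst ln_le_cancel_iff) auto
  then have "y - ln 2 \<le> ln (cosh y)" by (simp add: ln_div)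
  then have "(y - ln 2) / \<epsilon> \<le> slow_log \<epsilon> t" using assms by (simp add: slow_log_def y_def divide_right_mono)
  then have "ln (1 + t) \<le> ln 2 / \<epsilon> + slow_log \<epsilon> t" using assms by (simp add: y_def diff_divide_distrib)
  then have "exp (ln (1 + t)) \<le> exp (ln 2 / \<epsilon> + slow_log \<epsilon> t)" by (simp only: exp_le_cancel_iff)
  then show "1 + t \<le> exp (ln 2 / \<epsilon>) * exp (slow_log \<epsilon> t)" using assms by (simp add: exp_add)
  have "ln (cosh y) \<le> ln (exp y)" using c by (subst ln_le_cancel_iff) auto
  then have "slow_log \<epsilon> t \<le> ln (1 + t)" using assms by (simp add: slow_log_def y_def divide_le_eq mult.commute)
  then have "exp (slow_log \<epsilon> t) \<le> exp (ln (1 + t))" by simp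
  then show "exp (slow_log \<epsilon> t) \<le> 1 + t" using assms by simp
qed

text \<open>The left side is f' + t f'' for f = \<open>slow_log \<epsilon>\<close>, which is T/4
  times the Laplacian of f(|z - w|^2 / T). After cancellation the numerator over (1 + t)^2 is L + t
  \<epsilon> (1 - L^2) with L = tanh (\<epsilon> ln (1 + t)) <= \<epsilon> t.\<close>

lemma slow_log_laplacian:
  assumes "(\<epsilon>::real) > 0" "(t::real) \<ge> 0"
  shows "tanh (\<epsilon> * ln (1 + t)) / (1 + t) + t * ((\<epsilon> * (1 - (tanh (\<epsilon> * ln (1 + t)))\<^sup>2) - tanh (\<epsilon> * ln (1 + t))) / (1 + t)\<^sup>2)
    \<le> 2 * \<epsilon> / (1 + t)"
proof -
  define L where "L = tanh (\<epsilon> * ln (1 + t))"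
  have "ln (1 + t) \<le> t" using assms ln_add_one_self_le_self[of t] by simp
  then have "\<epsilon> * ln (1 + t) \<le> \<epsilon> * t" using assms by (intro mult_left_mono) auto
  moreover have "L \<le> \<epsilon> * ln (1 + t)" unfolding L_def using assms by (intro tanh_le_self) simp
  ultimately have L: "L \<le> \<epsilon> * t" by simp
  have "L / (1 + t) = L * (1 + t) / (1 + t)\<^sup>2" using assms by (simp add: power2_eq_square)
  then have "L / (1 + t) + t * ((\<epsilon> * (1 - L\<^sup>2) - L) / (1 + t)\<^sup>2) = (L * (1 + t) + t * (\<epsilon> * (1 - L\<^sup>2) - L)) / (1 + t)\<^sup>2"
    by (simp only: add_divide_distrib times_divide_eq_right)
  also have "L * (1 + t) + t * (\<epsilon> * (1 - L\<^sup>2) - L) = L + t * \<epsilon> * (1 - L\<^sup>2)" by (simp add: algebra_simps)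
  also have "(L + t * \<epsilon> * (1 - L\<^sup>2)) / (1 + t)\<^sup>2 \<le> (2 * \<epsilon> * (1 + t)) / (1 + t)\<^sup>2"
  proof (rule divide_right_mono)
    have "t * \<epsilon> * (1 - L\<^sup>2) \<le> t * \<epsilon> * 1" using assms by (intro mult_left_mono) auto
    then have "L + t * \<epsilon> * (1 - L\<^sup>2) \<le> \<epsilon> * t + t * \<epsilon> * 1" by (rule add_mono[OF L])
    also have "\<dots> \<le> 2 * \<epsilon> * (1 + t)" using assms by (simp add: algebra_simps)
    finally show "L + t * \<epsilon> * (1 - L\<^sup>2) \<le> 2 * \<epsilon> * (1 + t)" .
  qed simp
  also have "\<dots> = 2 * \<epsilon> / (1 + t)" using assms by (simp add: power2_eq_square)
  finally show ?thesis by (simp add: L_def)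
qed

lemma peak_weight:
  fixes w :: complex
  assumes T: "T > 0" and \<epsilon>: "\<epsilon> > 0"
  defines "X \<equiv> \<lambda>z::complex. ((Re (z - w))\<^sup>2 + (Im (z - w))\<^sup>2) / T"
  obtains qx qy qxx qxy qyx qyy where "C2_data UNIV (\<lambda>z. slow_log \<epsilon> (X z)) qx qy qxx qxy qyx qyy"
    "\<And>z. qxx z + qyy z \<le> 8 * \<epsilon> / (T * (1 + X z))"
proof -
  define f1 f2 where "f1 t = tanh (\<epsilon> * ln (1 + t)) / (1 + t)"
    and "f2 t = (\<epsilon> * (1 - (tanh (\<epsilon> * ln (1 + t)))\<^sup>2) - tanh (\<epsilon> * ln (1 + t))) / (1 + t)\<^sup>2" for t
  have c: "continuous_on {0..} f2" unfolding f2_def[abs_def] by (intro continuous_intros) auto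
  have d: "(slow_log \<epsilon> has_real_derivative f1 t) (at t)" "(f1 has_real_derivative f2 t) (at t)" if "t \<ge> 0" for t
    using slow_log_DERIV[OF \<epsilon> that] unfolding f1_def[abs_def] f2_def by auto
  have Xz: "X z = ((Re (z - w))\<^sup>2 + (Im (z - w))\<^sup>2) / T" for z by (simp add: X_def)
  note C = C2_data_radial[OF T d c, of w, folded Xz]
  show ?thesis
  proof (rule that[OF C], assumption, assumption)
    fix z
    have X0: "X z \<ge> 0" using T by (simp add: X_def)
    have e: "(2 / T * Re (z - w))\<^sup>2 + (2 / T * Im (z - w))\<^sup>2 = 4 / T * X z"
      using T by (simp add: X_def power_mult_distrib power_divide field_simps power2_eq_square)
    have "f2 (X z) * (2 / T * Re (z - w))\<^sup>2 + f1 (X z) * (2 / T) + (f2 (X z) * (2 / T * Im (z - w))\<^sup>2 + f1 (X z) * (2 / T))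
      = f2 (X z) * ((2 / T * Re (z - w))\<^sup>2 + (2 / T * Im (z - w))\<^sup>2) + f1 (X z) * (4 / T)"
      by (simp add: algebra_simps)
    also have "\<dots> = 4 / T * (f1 (X z) + X z * f2 (X z))" unfolding e by (simp add: algebra_simps)
    also have "\<dots> \<le> 4 / T * (2 * \<epsilon> / (1 + X z))"
      using slow_log_laplacian[OF \<epsilon> X0] T by (intro mult_left_mono) (auto simp: f1_def f2_def)
    finally show "f2 (X z) * (2 / T * Re (z - w))\<^sup>2 + f1 (X z) * (2 / T) + (f2 (X z) * (2 / T * Im (z - w))\<^sup>2 + f1 (X z) * (2 / T))
      \<le> 8 * \<epsilon> / (T * (1 + X z))" by simp
  qed
qed

text \<open>\<open>cutoff_quotient R (z - w)\<close> is \<open>(1 - \<chi>(z)) / (z - w)\<close> for the cutoff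
  \<open>\<chi>(z) = bump R 2 (z - w)\<close>; it is \<open>C\<^sup>1\<close> also at \<open>z = w\<close>.\<close>

definition cut_profile :: "real \<Rightarrow> real" where "cut_profile t = 2 - t + (max 0 (t - 1))\<^sup>2 / t"
definition cut_profile' :: "real \<Rightarrow> real" where
  "cut_profile' t = - 1 + (2 * max 0 (t - 1) * t - (max 0 (t - 1))\<^sup>2) / t\<^sup>2"
definition cutoff_quotient :: "real \<Rightarrow> complex \<Rightarrow> complex" where
  "cutoff_quotient R y = cnj y * of_real (cut_profile (((Re y)\<^sup>2 + (Im y)\<^sup>2) / R\<^sup>2) / R\<^sup>2)"

lemma cut_profile_DERIV: "(cut_profile has_real_derivative cut_profile' t) (at t)"
proof (cases "t < 1")
  case True
  \<comment> \<open>The formula 2 - t also holds at t = 0, where the quotient in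
    \<open>cut_profile\<close> is 0 / 0 = 0.\<close>
  have "((\<lambda>t::real. 2 - t) has_real_derivative cut_profile' t) (at t)"
    using True by (auto intro!: derivative_eq_intros simp: cut_profile'_def)
  then show ?thesis
    by (rule has_field_derivative_transform_within_open[where S="{..<1}"]) (use True in \<open>auto simp: cut_profile_def\<close>)
next
  case False
  have m: "((\<lambda>s::real. (max 0 (s - 1))\<^sup>2) has_real_derivative 2 * max 0 (t - 1)) (at t)"
  proof -
    have "((\<lambda>s::real. s - 1) has_real_derivative 1) (at t)" by (auto intro!: derivative_eq_intros)
    from DERIV_chain2[OF DERIV_max_power[of 0, of "t - 1"] this] show ?thesis by (simp add: numeral_2_eq_2)
  qed
  show ?thesis unfolding cut_profile_def[abs_def] cut_profile'_def
    by (rule DERIV_cong[OF DERIV_add[OF DERIV_diff[OF DERIV_const DERIV_ident] DERIV_divide[OF m DERIV_ident]]])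
       (use False in \<open>auto simp: power2_eq_square\<close>)
qed

lemma continuous_on_cut_profile': "continuous_on A cut_profile'"
proof (rule continuous_at_imp_continuous_on, rule ballI)
  fix t :: real
  show "isCont cut_profile' t"
  proof (cases "t < 1")
    case True
    have ev: "eventually (\<lambda>s. cut_profile' s = -1) (nhds t)"
      using eventually_nhds_in_open[of "{..<1}" t] True
      by (auto elim!: eventually_mono simp: cut_profile'_def)
    show ?thesis using isCont_cong[OF ev] by simp
  next
    case False
    then show ?thesis unfolding cut_profile'_def[abs_def] by (intro continuous_intros) auto
  qed
qed

text \<open>By the second identity the profile is (1 - (1 - t)_+^2) / t in a form that is regular at
  0. The first is the derivative of t times the profile; it is the combination that dbar of
  \<open>cutoff_quotient\<close> produces.\<close>

lemma cut_profile_identities: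
  assumes "t \<ge> 0"
  shows "cut_profile t + t * cut_profile' t = 2 * max 0 (1 - t)" "t * cut_profile t = 1 - (max 0 (1 - t))\<^sup>2"
proof -
  show "cut_profile t + t * cut_profile' t = 2 * max 0 (1 - t)"
  proof (cases "t = 0")
    case False
    define M where "M = max 0 (t - 1)"
    have "cut_profile t + t * cut_profile' t = 2 - 2 * t + 2 * M"
      using False by (simp add: cut_profile_def cut_profile'_def M_def[symmetric] field_simps power2_eq_square)
    also have "\<dots> = 2 * max 0 (1 - t)" by (simp add: M_def max_def)
    finally show ?thesis .
  qed (simp add: cut_profile_def)
  show "t * cut_profile t = 1 - (max 0 (1 - t))\<^sup>2"
  proof (cases "t = 0")
    case False
    define M where "M = max 0 (t - 1)"
    have "t * cut_profile t = 2 * t - t\<^sup>2 + M\<^sup>2"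
      using False by (simp add: cut_profile_def M_def[symmetric] field_simps power2_eq_square)
    also have "\<dots> = 1 - (max 0 (1 - t))\<^sup>2" by (simp add: M_def max_def power2_eq_square algebra_simps)
    finally show ?thesis .
  qed simp
qed

lemma mult_cutoff_quotient:
  assumes "R > 0"
  shows "y * cutoff_quotient R y = 1 - of_real (bump R 2 y)"
proof -
  define X where "X = ((Re y)\<^sup>2 + (Im y)\<^sup>2) / R\<^sup>2"
  have X0: "X \<ge> 0" by (simp add: X_def)
  have "y * cnj y = of_real (X * R\<^sup>2)" using assms by (simp add: complex_mult_cnj X_def)
  then have "y * cutoff_quotient R y = of_real (X * R\<^sup>2) * of_real (cut_profile X / R\<^sup>2)"
    unfolding cutoff_quotient_def X_def[symmetric] by (simp add: mult.assoc[symmetric])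
  also have "\<dots> = of_real (X * R\<^sup>2 * (cut_profile X / R\<^sup>2))" by (rule of_real_mult[symmetric])
  also have "X * R\<^sup>2 * (cut_profile X / R\<^sup>2) = X * cut_profile X" using assms by simp
  also have "complex_of_real \<dots> = 1 - of_real (bump R 2 y)" unfolding cut_profile_identities(2)[OF X0] by (simp add: bump_def X_def)
  finally show ?thesis .
qed

text \<open>For the quadratic bump \<chi>, (d_x + i d_y) \<chi> is -4/R^2 (z - w) times the bump of
  exponent 1. Its factor z - w cancels the denominator of (1 - \<chi>) / (z - w), so the right-hand
  side of the dbar equation is bounded and supported near w.\<close>

lemma cutoff_quotient_pderivs:
  assumes R: "R > 0"
  obtains mx my where "\<And>z. pderivs (\<lambda>z. cutoff_quotient R (z - w)) (mx z) (my z) z"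
    "continuous_on UNIV mx" "continuous_on UNIV my"
    "\<And>z. mx z + \<i> * my z = of_real (4 / R\<^sup>2 * bump R 1 (z - w))"
proof -
  define X where "X z = ((Re (z - w))\<^sup>2 + (Im (z - w))\<^sup>2) / R\<^sup>2" for z
  have X0: "X z \<ge> 0" for z by (simp add: X_def)
  have dX: "(X has_derivative (\<lambda>t. Re t * (2 / R\<^sup>2 * Re (z - w)) + Im t * (2 / R\<^sup>2 * Im (z - w)))) (at z)" for z
    unfolding X_def[abs_def] divide_inverse by (auto intro!: derivative_eq_intros simp: fun_eq_iff algebra_simps)
  define n n' where "n z = cut_profile (X z) / R\<^sup>2" and "n' z = cut_profile' (X z) / R\<^sup>2" for z
  have dn: "(n has_derivative (\<lambda>t. n' z * (Re t * (2 / R\<^sup>2 * Re (z - w)) + Im t * (2 / R\<^sup>2 * Im (z - w))))) (at z)" for z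
    unfolding n_def[abs_def] n'_def divide_inverse
    by (rule has_derivative_eq_rhs[OF has_derivative_mult_left[OF has_derivative_compose[OF dX has_field_derivative_imp_has_derivative[OF cut_profile_DERIV]]]])
       (auto simp: fun_eq_iff divide_inverse algebra_simps)
  define mx my where "mx z = of_real (n z) + cnj (z - w) * of_real (n' z * (2 / R\<^sup>2 * Re (z - w)))"
    and "my z = - \<i> * of_real (n z) + cnj (z - w) * of_real (n' z * (2 / R\<^sup>2 * Im (z - w)))" for z
  have cX: "continuous_on UNIV X" by (intro continuous_at_imp_continuous_on ballI has_derivative_continuous, rule dX)
  have cn: "continuous_on UNIV n" by (intro continuous_at_imp_continuous_on ballI has_derivative_continuous, rule dn)
  have cn': "continuous_on UNIV n'" unfolding n'_def[abs_def] divide_inverse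
    by (intro continuous_intros continuous_on_compose2[OF continuous_on_cut_profile' cX]) auto
  show ?thesis
  proof (rule that[of mx my])
    show "continuous_on UNIV mx" "continuous_on UNIV my"
      unfolding mx_def[abs_def] my_def[abs_def] by (intro continuous_intros cn cn')+
    fix z
    have dc: "((\<lambda>z. cnj (z - w)) has_derivative cnj) (at z)"
      by (auto intro!: derivative_eq_intros simp: fun_eq_iff)
    show "pderivs (\<lambda>z. cutoff_quotient R (z - w)) (mx z) (my z) z"
      unfolding cutoff_quotient_def X_def[symmetric] n_def[symmetric]
      by (rule has_derivative_eq_rhs[OF has_derivative_mult[OF dc has_derivative_of_real[OF dn]]])
         (auto simp: fun_eq_iff mx_def my_def complex_eq_iff algebra_simps)
    define a where "a = 2 / R\<^sup>2"
    have "mx z + \<i> * my z = of_real (2 * n z) + of_real a * of_real (n' z) * (cnj (z - w) * (z - w))"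
      unfolding mx_def my_def a_def[symmetric] by (simp add: complex_eq_iff algebra_simps)
    also have "cnj (z - w) * (z - w) = of_real (X z * R\<^sup>2)"
      using R complex_mult_cnj[of "z - w"] by (simp add: X_def mult.commute del: complex_cnj_diff)
    also have "of_real (2 * n z) + of_real a * of_real (n' z) * of_real (X z * R\<^sup>2) = complex_of_real (2 / R\<^sup>2 * (cut_profile (X z) + X z * cut_profile' (X z)))"
    proof -
      have "2 * n z + a * n' z * (X z * R\<^sup>2) = 2 / R\<^sup>2 * (cut_profile (X z) + X z * cut_profile' (X z))"
        using R by (simp add: a_def n_def n'_def field_simps)
      from this[symmetric] show ?thesis by (simp only: of_real_add of_real_mult)
    qed
    also have "\<dots> = of_real (4 / R\<^sup>2 * bump R 1 (z - w))"
      unfolding cut_profile_identities(1)[OF X0] by (simp add: bump_def X_def)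
    finally show "mx z + \<i> * my z = of_real (4 / R\<^sup>2 * bump R 1 (z - w))" .
  qed
qed

lemma sum_sq3: "(a + b + c)\<^sup>2 \<le> 3 * (a\<^sup>2 + b\<^sup>2 + c\<^sup>2)" for a b c :: real
proof -
  have "0 \<le> (a - b)\<^sup>2 + (b - c)\<^sup>2 + (a - c)\<^sup>2" by simp
  then show ?thesis by (simp add: power2_eq_square algebra_simps)
qed

section \<open>Weights with Lipschitz tau: local comparison, point evaluation, peak functions on
  smaller discs\<close>

locale lipschitz_weight =
  fixes \<psi> px py pxx pxy pyx pyy \<tau> :: "complex \<Rightarrow> real" and C1 C2 :: real
  assumes psi: "C2_data disc \<psi> px py pxx pxy pyx pyy"
    and lap_pos: "\<And>z. z \<in> disc \<Longrightarrow> 0 < pxx z + pyy z"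
    and tau: "\<And>z. z \<in> disc \<Longrightarrow> \<tau> z = 1 / sqrt (pxx z + pyy z)"
    and lip: "\<And>z \<xi>. z \<in> disc \<Longrightarrow> \<xi> \<in> disc \<Longrightarrow> \<bar>\<tau> z - \<tau> \<xi>\<bar> \<le> C1 * cmod (z - \<xi>)"
    and small: "\<And>z. z \<in> disc \<Longrightarrow> \<tau> z \<le> C2 * (1 - cmod z)"
    and C1: "C1 > 0" and C2: "C2 > 0"
begin

text \<open>Chosen so that C2 * rad < 1 keeps the disc of radius rad * \<tau>(w) inside the unit
  disc, C1 * rad <= 1/2 keeps \<tau> between half and three halves of \<tau>(w) on it, and rad <=
  1/2 makes the quadratic error in \<open>local_exponent\<close> at most 1.\<close>

definition rad :: real where "rad = 1 / (2 * (1 + C1 + C2))"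

lemma rad: "rad > 0" "rad \<le> 1 / 2" "C1 * rad \<le> 1 / 2" "C2 * rad < 1"
  using C1 C2 by (auto simp: rad_def field_simps)

lemma tau_pos: "z \<in> disc \<Longrightarrow> \<tau> z > 0"
  using tau lap_pos by simp

lemma lap_eq: "z \<in> disc \<Longrightarrow> pxx z + pyy z = 1 / (\<tau> z)\<^sup>2"
  using tau[of z] lap_pos[of z] by (simp add: power_divide)

lemma psi_cont: "continuous_on disc \<psi>"
  using C2_data_continuous(1)[OF psi] .

lemma local_disc:
  assumes w: "w \<in> disc"
  shows "cball w (rad * \<tau> w) \<subseteq> disc" "rad * \<tau> w > 0"
    "\<And>z. z \<in> cball w (rad * \<tau> w) \<Longrightarrow> \<tau> w / 2 \<le> \<tau> z" "\<And>z. z \<in> cball w (rad * \<tau> w) \<Longrightarrow> \<tau> z \<le> 3 / 2 * \<tau> w"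
proof -
  show "rad * \<tau> w > 0" using rad tau_pos[OF w] by simp
  have w1: "1 - cmod w > 0" using w by simp
  have "rad * \<tau> w \<le> rad * (C2 * (1 - cmod w))" using small[OF w] rad by (intro mult_left_mono) auto
  also have "\<dots> = (C2 * rad) * (1 - cmod w)" by simp
  also have "\<dots> < 1 * (1 - cmod w)" using rad(4) w1 by (intro mult_strict_right_mono)
  finally have lt: "rad * \<tau> w < 1 - cmod w" by simp
  show sub: "cball w (rad * \<tau> w) \<subseteq> disc"
  proof
    fix z assume "z \<in> cball w (rad * \<tau> w)"
    then have "cmod (z - w) < 1 - cmod w" using lt by (simp add: dist_norm norm_minus_commute)
    then show "z \<in> disc" using norm_triangle_ineq[of w "z - w"] by simp
  qed
  fix z assume z: "z \<in> cball w (rad * \<tau> w)"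
  have "\<bar>\<tau> z - \<tau> w\<bar> \<le> C1 * cmod (z - w)" using lip[of z w] z sub w by blast
  also have "\<dots> \<le> C1 * (rad * \<tau> w)" using z C1 by (intro mult_left_mono) (auto simp: dist_norm norm_minus_commute)
  also have "\<dots> = (C1 * rad) * \<tau> w" by simp
  also have "\<dots> \<le> 1 / 2 * \<tau> w" using rad(3) tau_pos[OF w] by (intro mult_right_mono) auto
  finally show "\<tau> w / 2 \<le> \<tau> z" "\<tau> z \<le> 3 / 2 * \<tau> w" by linarith+
qed

lemma local_exponent:
  assumes w: "w \<in> disc"
  obtains h where "h holomorphic_on UNIV"
    "\<And>z. z \<in> cball w (rad * \<tau> w) \<Longrightarrow> - 1 \<le> Re (h z) - \<psi> z" "\<And>z. z \<in> cball w (rad * \<tau> w) \<Longrightarrow> Re (h z) - \<psi> z \<le> 2"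
proof -
  note L = local_disc[OF w]
  \<comment> \<open>On the disc \<tau> is at least \<tau>(w) / 2, so the Laplacian is at most 4 /
    \<tau>(w)^2; the 5 makes the bound strict.\<close>
  define A where "A = 5 / (\<tau> w)\<^sup>2"
  have "pxx z + pyy z < A" if z: "z \<in> cball w (rad * \<tau> w)" for z
  proof -
    have zd: "z \<in> disc" using L(1) z by blast
    have "(\<tau> w / 2)\<^sup>2 \<le> (\<tau> z)\<^sup>2" using L(3)[OF z] tau_pos[OF w] by (intro power_mono) auto
    then have "pxx z + pyy z \<le> 1 / (\<tau> w / 2)\<^sup>2"
      unfolding lap_eq[OF zd] using tau_pos[OF w] tau_pos[OF zd] by (intro divide_left_mono mult_pos_pos zero_less_power) auto
    also have "\<dots> = 4 / (\<tau> w)\<^sup>2" by (simp add: power_divide)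
    also have "\<dots> < A" unfolding A_def using tau_pos[OF w] by (intro divide_strict_right_mono) auto
    finally show ?thesis .
  qed
  moreover have "0 < pxx z + pyy z" if "z \<in> cball w (rad * \<tau> w)" for z using lap_pos L(1) that by blast
  ultimately obtain h where h: "h holomorphic_on UNIV"
    "\<And>z. z \<in> cball w (rad * \<tau> w) \<Longrightarrow> - 1 \<le> Re (h z) - \<psi> z"
    "\<And>z. z \<in> cball w (rad * \<tau> w) \<Longrightarrow> Re (h z) - \<psi> z \<le> 1 + A * (rad * \<tau> w)\<^sup>2 / 4"
    using local_harmonic_majorant[OF psi L(1,2), of A] by blast
  have "A * (rad * \<tau> w)\<^sup>2 / 4 = 5 / 4 * rad\<^sup>2" using tau_pos[OF w] by (simp add: A_def power_mult_distrib)
  also have "\<dots> \<le> 5 / 4 * (1/2)\<^sup>2" using rad by (intro mult_left_mono power_mono) auto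
  also have "\<dots> \<le> 1" by (simp add: power2_eq_square)
  finally have "1 + A * (rad * \<tau> w)\<^sup>2 / 4 \<le> 2" by simp
  then have "Re (h z) - \<psi> z \<le> 2" if "z \<in> cball w (rad * \<tau> w)" for z using h(3)[OF that] by linarith
  then show ?thesis using h(2) by (intro that[OF h(1)])
qed

text \<open>The mean value inequality for f e^(-h). Replacing -2 Re h by -2 \<psi> costs a factor
  exp 4 at w, since Re h <= \<psi> + 2, and exp 2 under the integral, since Re h >= \<psi> - 1;
  together exp 6.\<close>

lemma point_evaluation:
  assumes w: "w \<in> disc" and S: "open S" "cball w (rad * \<tau> w) \<subseteq> S" and f: "f holomorphic_on S"
  shows "(rad * \<tau> w)\<^sup>2 / 4 * ((cmod (f w))\<^sup>2 * exp (- 2 * \<psi> w)) \<le>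
    exp 6 * (LINT z|lborel. indicator (cball w (rad * \<tau> w)) z * ((cmod (f z))\<^sup>2 * exp (- 2 * \<psi> z)))"
proof -
  note L = local_disc[OF w]
  obtain h where h: "h holomorphic_on UNIV"
    "\<And>z. z \<in> cball w (rad * \<tau> w) \<Longrightarrow> - 1 \<le> Re (h z) - \<psi> z" "\<And>z. z \<in> cball w (rad * \<tau> w) \<Longrightarrow> Re (h z) - \<psi> z \<le> 2"
    using local_exponent[OF w] by blast
  define B where "B = cball w (rad * \<tau> w)"
  have wB: "w \<in> B" using L(2) by (simp add: B_def)
  define g where "g z = f z * exp (- h z)" for z
  have g: "g holomorphic_on S" unfolding g_def using f h(1) by (intro holomorphic_intros) (auto intro: holomorphic_on_subset)
  have g2: "(cmod (g z))\<^sup>2 = (cmod (f z))\<^sup>2 * exp (- 2 * Re (h z))" for z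
    by (simp add: g_def norm_mult power_mult_distrib power2_eq_square exp_add[symmetric])
  have cf: "continuous_on B f" and cg: "continuous_on B g" and c\<psi>: "continuous_on B \<psi>"
    using holomorphic_on_imp_continuous_on[OF f] holomorphic_on_imp_continuous_on[OF g] psi_cont S(2) L(1)
      continuous_on_subset unfolding B_def by blast+
  have i1: "integrable lborel (\<lambda>z. indicator B z *\<^sub>R (cmod (g z))\<^sup>2)"
    by (rule borel_integrable_compact) (auto simp: B_def[symmetric] intro!: continuous_intros cg, simp add: B_def)
  have i2: "integrable lborel (\<lambda>z. indicator B z *\<^sub>R (exp 2 * ((cmod (f z))\<^sup>2 * exp (- 2 * \<psi> z))))"
    by (rule borel_integrable_compact) (auto simp: B_def[symmetric] intro!: continuous_intros cf c\<psi>, simp add: B_def)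
  have "exp (- 4) * ((cmod (f w))\<^sup>2 * exp (- 2 * \<psi> w)) = (cmod (f w))\<^sup>2 * exp (- 2 * \<psi> w - 4)"
    by (simp add: exp_diff exp_minus field_simps)
  also have "\<dots> \<le> (cmod (g w))\<^sup>2"
    unfolding g2 using h(3)[of w] wB by (intro mult_left_mono) (auto simp: B_def)
  finally have "(rad * \<tau> w)\<^sup>2 / 4 * (exp (- 4) * ((cmod (f w))\<^sup>2 * exp (- 2 * \<psi> w))) \<le> (rad * \<tau> w)\<^sup>2 / 4 * (cmod (g w))\<^sup>2"
    by (rule mult_left_mono) simp
  also have "\<dots> \<le> (LINT z|lborel. indicator B z * (cmod (g z))\<^sup>2)"
    using L2_mean_value_inequality[OF g S L(2)] by (simp add: B_def)
  also have "\<dots> \<le> (LINT z|lborel. indicator B z * (exp 2 * ((cmod (f z))\<^sup>2 * exp (- 2 * \<psi> z))))"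
  proof (rule integral_mono)
    show "integrable lborel (\<lambda>z. indicator B z * (cmod (g z))\<^sup>2)" using i1 by simp
    show "integrable lborel (\<lambda>z. indicator B z * (exp 2 * ((cmod (f z))\<^sup>2 * exp (- 2 * \<psi> z))))" using i2 by simp
    fix z
    show "indicator B z * (cmod (g z))\<^sup>2 \<le> indicator B z * (exp 2 * ((cmod (f z))\<^sup>2 * exp (- 2 * \<psi> z)))"
    proof (cases "z \<in> B")
      case True
      have "(cmod (g z))\<^sup>2 \<le> (cmod (f z))\<^sup>2 * exp (2 - 2 * \<psi> z)"
        unfolding g2 using h(2)[of z] True by (intro mult_left_mono) (auto simp: B_def)
      also have "\<dots> = exp 2 * ((cmod (f z))\<^sup>2 * exp (- 2 * \<psi> z))" by (simp add: exp_diff exp_minus field_simps)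
      finally show ?thesis using True by simp
    qed simp
  qed
  also have "\<dots> = exp 2 * (LINT z|lborel. indicator B z * ((cmod (f z))\<^sup>2 * exp (- 2 * \<psi> z)))"
    by (subst Bochner_Integration.integral_mult_right_zero[symmetric]) (simp add: mult_ac)
  finally have "exp 4 * ((rad * \<tau> w)\<^sup>2 / 4 * (exp (- 4) * ((cmod (f w))\<^sup>2 * exp (- 2 * \<psi> w)))) \<le>
     exp 4 * (exp 2 * (LINT z|lborel. indicator B z * ((cmod (f z))\<^sup>2 * exp (- 2 * \<psi> z))))"
    by (rule mult_left_mono) simp
  moreover have "exp 4 * (a * (exp (- 4) * b)) = a * b" for a b :: real
  proof -
    have "exp 4 * (a * (exp (- 4) * b)) = (exp 4 * exp (- 4)) * (a * b)" by (simp only: mult_ac)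
    also have "exp 4 * exp (- 4) = (1::real)" using exp_add[of 4 "-4::real"] by simp
    finally show ?thesis by simp
  qed
  moreover have "exp 4 * (exp 2 * y) = exp 6 * y" for y :: real
    using exp_add[of 4 "2::real"] by (simp add: mult.assoc[symmetric])
  ultimately show ?thesis unfolding B_def by metis
qed

text \<open>The choice turns 8 eps \<tau>(z)^2 <= 16 eps (1 + C1^2) T (1 + X) into a comparison with
  T (1 + X), so the logarithm costs at most one of the two copies of the Laplacian of
  \<psi>.\<close>

definition eps :: real where "eps = 1 / (16 * (1 + C1\<^sup>2))"
text \<open>72 = 16 * 2 * 9/4: the square of 4 from the derivative of the cut-off, the bound 2 for
  exp of \<open>slow_log\<close> near w, and (3/2)^2 from \<tau>(z) <= 3/2 \<tau>(w). The factor exp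
  4 comes from Re h <= \<psi> + 2, and pi from the area of the disc.\<close>

definition dbar_const :: real where "dbar_const = sqrt (72 * exp 4 * pi) / rad"
text \<open>One summand per term of the peak function: cut-off main part, mollification error, dbar
  correction. Each carries the 3 of \<open>sum_sq3\<close>; the last also carries the 2 of
  \<open>dbar_correction\<close>.\<close>

definition peak_const :: real where
  "peak_const = 3 * exp 4 * pi + 3 + 6 * exp (ln 2 / eps) * (dbar_const + 1)\<^sup>2"

lemma eps: "eps > 0" "16 * eps * (1 + C1\<^sup>2) = 1"
proof -
  have "1 + C1\<^sup>2 > 0" by (simp add: add_pos_nonneg)
  then show "eps > 0" "16 * eps * (1 + C1\<^sup>2) = 1" by (auto simp: eps_def field_simps)
qed

text \<open>Take f = F + (z - w) hh with F = e^h and hh from \<open>dbar_correction\<close>: f is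
  visibly holomorphic and f(w) = F(w). Since F + (z - w) G is the cut-off F, also f = \<chi> F + (z
  - w) (hh - G), where hh - G is -k up to \<delta>; this form is the one that is small in norm. The
  bound is independent of s, as the passage s -> 1 requires.\<close>

lemma peak_on_subdisc:
  assumes w: "w \<in> disc" and s: "cmod w < s" "s < 1"
  obtains f where "f holomorphic_on ball 0 s" "exp (\<psi> w - 1) \<le> cmod (f w)"
    "(\<integral>\<^sup>+z. indicator (ball 0 s) z * ennreal ((cmod (f z))\<^sup>2 * exp (- 2 * \<psi> z)) \<partial>lborel) \<le> ennreal (peak_const * (\<tau> w)\<^sup>2)"
proof -
  note L = local_disc[OF w]
  have tw: "\<tau> w > 0" by (rule tau_pos[OF w])
  define T where "T = (\<tau> w)\<^sup>2"
  have T: "T > 0" using tw by (simp add: T_def)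
  define R where "R = rad * \<tau> w"
  have R: "R > 0" "cball w R \<subseteq> disc" using L by (simp_all add: R_def)
  have R2: "R\<^sup>2 = rad\<^sup>2 * T" by (simp add: R_def T_def power_mult_distrib)
  have R2T: "R\<^sup>2 \<le> T"
  proof -
    have "rad\<^sup>2 \<le> 1" using rad by (simp add: power_le_one)
    then show ?thesis unfolding R2 using T by (intro mult_left_le_one_le) auto
  qed
  obtain h where h: "h holomorphic_on UNIV"
    "\<And>z. z \<in> cball w R \<Longrightarrow> - 1 \<le> Re (h z) - \<psi> z" "\<And>z. z \<in> cball w R \<Longrightarrow> Re (h z) - \<psi> z \<le> 2"
    using local_exponent[OF w, folded R_def] by blast
  define X where "X z = ((Re (z - w))\<^sup>2 + (Im (z - w))\<^sup>2) / T" for z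
  have X: "X z = (cmod (z - w))\<^sup>2 / T" for z by (simp add: X_def cmod_power2)
  have X0: "X z \<ge> 0" for z using T by (simp add: X_def)
  obtain qx qy qxx qxy qyx qyy where q: "C2_data UNIV (\<lambda>z. slow_log eps (X z)) qx qy qxx qxy qyx qyy"
    "\<And>z. qxx z + qyy z \<le> 8 * eps / (T * (1 + X z))"
    by (rule peak_weight[OF T eps(1), of w, folded X_def]) (assumption | rule that)+
  \<comment> \<open>One copy of \<psi> pays for the logarithm in the Laplacian, the other remains as
    \<kappa>.\<close>
  define \<phi> where "\<phi> z = 2 * \<psi> z + (-1) * slow_log eps (X z)" for z
  note C\<phi> = C2_data_combine[OF psi C2_data_subset[OF q(1) subset_UNIV], of 2 "-1", folded \<phi>_def]
  have c\<phi>: "continuous_on disc \<phi>" using C2_data_continuous(1)[OF C\<phi>] .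
  define \<kappa> where "\<kappa> z = pxx z + pyy z" for z
  have c\<kappa>: "continuous_on disc \<kappa>" unfolding \<kappa>_def[abs_def] using psi by (auto simp: C2_data_def intro!: continuous_intros)
  have \<kappa>pos: "0 < \<kappa> z" if "z \<in> disc" for z using lap_pos[OF that] by (simp add: \<kappa>_def)
  \<comment> \<open>The Lipschitz bound gives \<tau>(z)^2 <= 2 (1 + C1^2) T (1 + X z), so the
    Laplacian of \<psi> decays no faster than the bound for that of the logarithm.\<close>
  have \<kappa>le: "\<kappa> z \<le> (2 * pxx z + - 1 * qxx z) + (2 * pyy z + - 1 * qyy z)" if z: "z \<in> disc" for z
  proof -
    have X1: "1 + X z > 0" using X0[of z] by simp
    have "\<tau> z \<le> \<tau> w + C1 * cmod (z - w)" using lip[OF z w] by simp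
    then have "(\<tau> z)\<^sup>2 \<le> (\<tau> w + C1 * cmod (z - w))\<^sup>2" using tau_pos[OF z] by (intro power_mono) auto
    also have "\<dots> \<le> 2 * T + 2 * C1\<^sup>2 * (cmod (z - w))\<^sup>2"
      using zero_le_power2[of "\<tau> w - C1 * cmod (z - w)"] by (simp add: T_def power2_eq_square algebra_simps)
    also have "(cmod (z - w))\<^sup>2 = T * X z" using T by (simp add: X)
    also have "2 * T + 2 * C1\<^sup>2 * (T * X z) \<le> 2 * (1 + C1\<^sup>2) * (T * (1 + X z))"
      using T X0[of z] by (simp add: algebra_simps)
    finally have "(8 * eps) * (\<tau> z)\<^sup>2 \<le> (8 * eps) * (2 * (1 + C1\<^sup>2) * (T * (1 + X z)))"
      using eps(1) by (intro mult_left_mono) auto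
    also have "\<dots> = (16 * eps * (1 + C1\<^sup>2)) * (T * (1 + X z))" by simp
    also have "\<dots> = T * (1 + X z)" unfolding eps(2) by simp
    finally have "8 * eps / (T * (1 + X z)) \<le> 1 / (\<tau> z)\<^sup>2"
      using T X1 tau_pos[OF z] by (simp add: divide_simps mult.commute)
    then have "qxx z + qyy z \<le> \<kappa> z" using q(2)[of z] lap_eq[OF z] by (simp add: \<kappa>_def)
    then show ?thesis by (simp add: \<kappa>_def)
  qed
  define F where "F z = exp (h z)" for z
  have F: "F holomorphic_on UNIV" unfolding F_def using h(1) by (intro holomorphic_intros)
  have cF: "continuous_on A F" "continuous_on A (deriv F)" for A
    using F holomorphic_deriv[OF F open_UNIV] holomorphic_on_imp_continuous_on continuous_on_subset by blast+
  have F2: "(cmod (F z))\<^sup>2 * exp (- 2 * \<psi> z) \<le> exp 4" if "z \<in> cball w R" for z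
  proof -
    have "(cmod (F z))\<^sup>2 * exp (- 2 * \<psi> z) = exp (2 * (Re (h z) - \<psi> z))"
      by (simp add: F_def power2_eq_square exp_add[symmetric] algebra_simps)
    also have "\<dots> \<le> exp 4" using h(3)[OF that] by simp
    finally show ?thesis .
  qed
  obtain mx my where m: "\<And>z. pderivs (\<lambda>z. cutoff_quotient R (z - w)) (mx z) (my z) z"
    "continuous_on UNIV mx" "continuous_on UNIV my"
    "\<And>z. mx z + \<i> * my z = of_real (4 / R\<^sup>2 * bump R 1 (z - w))"
    by (rule cutoff_quotient_pderivs[OF R(1), of w]) (assumption | rule that)+
  define M where "M z = cutoff_quotient R (z - w)" for z
  have cM: "continuous_on A M" for A unfolding M_def[abs_def]
    by (intro continuous_at_imp_continuous_on ballI has_derivative_continuous, rule m(1))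
  have cm: "continuous_on A mx" "continuous_on A my" for A using m(2,3) continuous_on_subset by blast+
  \<comment> \<open>G = -(1 - \<chi>) F / (z - w). As F is holomorphic, dbar falls only on the
    cut-off quotient and gives \<omega>, supported in \<open>cball w R\<close>.\<close>
  define G where "G z = - (F z * M z)" for z
  define gx gy where "gx z = - (F z * mx z + deriv F z * M z)" and "gy z = - (F z * my z + \<i> * deriv F z * M z)" for z
  define \<omega> where "\<omega> z = - (F z * of_real (4 / R\<^sup>2 * bump R 1 (z - w)))" for z
  have G: "pderivs G (gx z) (gy z) z" for z
    unfolding G_def[abs_def] M_def[abs_def] gx_def gy_def
    by (rule has_derivative_eq_rhs[OF has_derivative_minus[OF has_derivative_mult[OF holomorphic_pderivs[OF F open_UNIV UNIV_I] m(1)]]])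
       (rule ext, simp add: M_def scaleR_conv_of_real algebra_simps)
  have cg: "continuous_on A gx" "continuous_on A gy" for A
    unfolding gx_def[abs_def] gy_def[abs_def] by (intro continuous_intros cF cm cM)+
  have \<omega>G: "gx z + \<i> * gy z = \<omega> z" for z
  proof -
    have "gx z + \<i> * gy z = - (F z * (mx z + \<i> * my z))" by (simp add: gx_def gy_def algebra_simps)
    then show ?thesis unfolding m(4) \<omega>_def .
  qed
  have c\<omega>: "continuous_on A \<omega>" for A unfolding \<omega>_def[abs_def] by (intro continuous_intros cF)
  have z\<omega>: "\<omega> z = 0" if "z \<notin> cball w R" for z
    using that bump_eq_0[OF R(1), of 1 "z - w"] by (simp add: \<omega>_def dist_norm norm_minus_commute)
  have A0: "dbar_const \<ge> 0" using rad by (simp add: dbar_const_def)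
  have A: "(LINT z|lborel. (cmod (\<omega> z))\<^sup>2 * exp (- \<phi> z) / \<kappa> z) \<le> dbar_const\<^sup>2"
  proof -
    define Kc where "Kc = 72 * exp 4 * T / (R\<^sup>2 * R\<^sup>2)"
    have "(LINT z|lborel. (cmod (\<omega> z))\<^sup>2 * exp (- \<phi> z) / \<kappa> z) \<le> (LINT z|lborel. Kc * indicator (cball w R) z)"
    proof (rule integral_mono)
      show "integrable lborel (\<lambda>z. (cmod (\<omega> z))\<^sup>2 * exp (- \<phi> z) / \<kappa> z)"
        by (rule integrable_compact_support_on[OF open_ball compact_cball R(2)])
           (use \<kappa>pos in \<open>force intro!: continuous_intros c\<omega> c\<phi> c\<kappa>\<close>, simp add: z\<omega>)
      show "integrable lborel (\<lambda>z. Kc * indicator (cball w R) z)"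
        using emeasure_bounded_finite[of "cball w R"] by simp
      fix z
      show "(cmod (\<omega> z))\<^sup>2 * exp (- \<phi> z) / \<kappa> z \<le> Kc * indicator (cball w R) z"
      proof (cases "z \<in> cball w R")
        case True
        have zd: "z \<in> disc" using R(2) True by blast
        have "X z \<le> R\<^sup>2 / T" unfolding X using True T by (intro divide_right_mono power_mono) (auto simp: dist_norm norm_minus_commute)
        also have "\<dots> \<le> 1" using R2T T by simp
        finally have X1: "X z \<le> 1" .
        have "exp (- \<phi> z) = exp (- 2 * \<psi> z) * exp (slow_log eps (X z))" by (simp add: \<phi>_def exp_add[symmetric])
        also have "\<dots> \<le> exp (- 2 * \<psi> z) * 2"
          using slow_log_bounds(2)[OF eps(1) X0[of z]] X1 by (intro mult_left_mono) auto
        finally have e: "exp (- \<phi> z) \<le> exp (- 2 * \<psi> z) * 2" .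
        have k: "1 / \<kappa> z \<le> 9 / 4 * T"
        proof -
          have "1 / \<kappa> z = (\<tau> z)\<^sup>2" unfolding \<kappa>_def lap_eq[OF zd] by simp
          also have "\<dots> \<le> (3 / 2 * \<tau> w)\<^sup>2"
            using L(4)[of z] True tau_pos[OF zd] by (intro power_mono) (auto simp: R_def)
          finally show ?thesis by (simp add: T_def power_mult_distrib power_divide)
        qed
        have b: "(bump R 1 (z - w))\<^sup>2 \<le> 1" using bump_nonneg bump_le_1 by (intro power_le_one)
        have "(cmod (\<omega> z))\<^sup>2 = (cmod (F z))\<^sup>2 * (16 / (R\<^sup>2 * R\<^sup>2)) * (bump R 1 (z - w))\<^sup>2"
          using bump_nonneg[of R 1 "z - w"]
          by (simp add: \<omega>_def norm_mult norm_divide norm_power power_mult_distrib power_divide power2_eq_square)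
        also have "\<dots> \<le> (cmod (F z))\<^sup>2 * (16 / (R\<^sup>2 * R\<^sup>2)) * 1" using b by (intro mult_left_mono) auto
        finally have o: "(cmod (\<omega> z))\<^sup>2 \<le> (cmod (F z))\<^sup>2 * (16 / (R\<^sup>2 * R\<^sup>2))" by simp
        have "(cmod (\<omega> z))\<^sup>2 * exp (- \<phi> z) / \<kappa> z = (cmod (\<omega> z))\<^sup>2 * exp (- \<phi> z) * (1 / \<kappa> z)" by simp
        also have "\<dots> \<le> ((cmod (F z))\<^sup>2 * (16 / (R\<^sup>2 * R\<^sup>2))) * (exp (- 2 * \<psi> z) * 2) * (9 / 4 * T)"
          using \<kappa>pos[OF zd] T by (intro mult_mono o e k mult_nonneg_nonneg) auto
        also have "\<dots> = 72 * T / (R\<^sup>2 * R\<^sup>2) * ((cmod (F z))\<^sup>2 * exp (- 2 * \<psi> z))" by simp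
        also have "\<dots> \<le> 72 * T / (R\<^sup>2 * R\<^sup>2) * exp 4" using F2[OF True] T by (intro mult_left_mono) auto
        also have "\<dots> = Kc" by (simp add: Kc_def)
        finally show ?thesis using True by simp
      qed (simp add: z\<omega>)
    qed
    also have "\<dots> = Kc * (pi * R\<^sup>2)" using R(1) by (simp add: content_cball unit_ball_vol_2)
    also have "\<dots> = dbar_const\<^sup>2"
    proof -
      have "Kc * (pi * R\<^sup>2) = 72 * exp 4 * pi * T / R\<^sup>2" 
      proof -
        have "x * T / (S * S) * (pi * S) = x * pi * T / S" if "S \<noteq> 0" for x S :: real using that by simp
        from this[of "R\<^sup>2" "72 * exp 4"] R(1) show ?thesis unfolding Kc_def by simp
      qed
      also have "\<dots> = 72 * exp 4 * pi / rad\<^sup>2" unfolding R2 using T by simp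
      finally show ?thesis by (simp add: dbar_const_def power_divide)
    qed
    finally show ?thesis .
  qed
  \<comment> \<open>An intermediate radius: mollifying over distances up to (1 - s) / 2 stays in the
    compact disc K, on which \<phi> and G are uniformly continuous.\<close>
  define s' where "s' = (1 + s) / 2"
  have s': "s < s'" "s' < 1" "s > 0" using s le_less_trans[OF norm_ge_zero s(1)] by (simp_all add: s'_def)
  define K where "K = cball (0::complex) s'"
  have K: "compact K" "K \<subseteq> disc" using s' by (auto simp: K_def)
  have "\<exists>N. \<forall>z\<in>K. exp (- 2 * \<psi> z) \<le> N"
  proof -
    have "continuous_on K (\<lambda>z. exp (- 2 * \<psi> z))" by (intro continuous_intros continuous_on_subset[OF psi_cont K(2)])
    from compact_continuous_image[OF this K(1)] show ?thesis using compact_imp_bounded bounded_real by fastforce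
  qed
  then obtain N where N: "\<And>z. z \<in> K \<Longrightarrow> exp (- 2 * \<psi> z) \<le> N" by blast
  have N0: "N > 0"
  proof -
    have "0 \<in> K" using s' by (simp add: K_def)
    from N[OF this] show ?thesis using exp_gt_zero less_le_trans by blast
  qed
  \<comment> \<open>The error term is at most 3 * 4 \<delta>^2 N pointwise, as |z - w| <= 2, and so
    contributes at most 3 T over the unit disc. N depends on s, hence so do \<delta> and r, but 3 T
    does not.\<close>
  define \<delta> where "\<delta> = sqrt (T / (4 * N * pi))"
  have \<delta>: "\<delta> > 0" "4 * \<delta>\<^sup>2 * N * pi = T" using T N0 by (simp_all add: \<delta>_def)
  have "uniformly_continuous_on K \<phi>" "uniformly_continuous_on K G"
    using K c\<phi> compact_uniformly_continuous continuous_on_subset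
    by (blast, intro compact_uniformly_continuous K(1)) (auto simp: G_def intro!: continuous_intros cF cM)
  then obtain d1 d2 where d1: "d1 > 0" "\<And>z \<zeta>. z \<in> K \<Longrightarrow> \<zeta> \<in> K \<Longrightarrow> dist \<zeta> z < d1 \<Longrightarrow> dist (\<phi> \<zeta>) (\<phi> z) < ln 2"
    and d2: "d2 > 0" "\<And>z \<zeta>. z \<in> K \<Longrightarrow> \<zeta> \<in> K \<Longrightarrow> dist \<zeta> z < d2 \<Longrightarrow> dist (G \<zeta>) (G z) < \<delta>"
    unfolding uniformly_continuous_on_def using \<delta>(1) ln_gt_zero[of 2] by (metis one_less_numeral_iff semiring_norm(76))
  define r where "r = min ((1 - s) / 2) (min (d1 / 2) (d2 / 2))"
  have "r \<le> (1 - s) / 2" "r \<le> d1 / 2" "r \<le> d2 / 2"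
    unfolding r_def by (rule min.cobounded1, rule order_trans[OF min.cobounded2 min.cobounded1],
      rule order_trans[OF min.cobounded2 min.cobounded2])
  moreover have "r > 0" unfolding r_def using d1(1) d2(1) s by simp
  ultimately have r: "r > 0" "r \<le> (1 - s) / 2" "r < d1" "r < d2" using d1(1) d2(1) by linarith+
  have inK: "cball z r \<subseteq> K" if "z \<in> ball 0 s" for z
  proof
    fix \<zeta> assume "\<zeta> \<in> cball z r"
    then have "cmod (\<zeta> - z) \<le> (1 - s) / 2" using r by (simp add: dist_norm norm_minus_commute)
    moreover have "cmod \<zeta> \<le> cmod z + cmod (\<zeta> - z)" using norm_triangle_ineq[of z "\<zeta> - z"] by simp
    moreover have "cmod z < s" using that by simp
    moreover have "s + (1 - s) / 2 = s'" by (simp add: s'_def field_simps)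
    ultimately have "cmod \<zeta> \<le> s'" by linarith
    then show "\<zeta> \<in> K" by (simp add: K_def)
  qed
  have osc: "exp (- \<phi> z) \<le> 2 * exp (- \<phi> \<zeta>)" "cmod (G \<zeta> - G z) \<le> \<delta>" if z: "z \<in> ball 0 s" and \<zeta>: "\<zeta> \<in> cball z r" for z \<zeta>
  proof -
    have zk: "z \<in> K" "\<zeta> \<in> K" using inK[OF z] \<zeta> r(1) by auto
    have dd: "dist \<zeta> z \<le> r" using \<zeta> by (simp add: dist_commute)
    show "cmod (G \<zeta> - G z) \<le> \<delta>" using d2(2)[OF zk] dd r(4) by (simp add: dist_norm)
    have "\<bar>\<phi> \<zeta> - \<phi> z\<bar> < ln 2" using d1(2)[OF zk] dd r(3) by (simp add: dist_real_def)
    then have "- \<phi> z \<le> ln 2 + - \<phi> \<zeta>" by linarith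
    then have "exp (- \<phi> z) \<le> exp (ln 2 + - \<phi> \<zeta>)" by (simp only: exp_le_cancel_iff)
    then show "exp (- \<phi> z) \<le> 2 * exp (- \<phi> \<zeta>)" by (simp only: exp_add exp_ln[OF zero_less_numeral])
  qed
  obtain hh k where hk: "hh holomorphic_on ball 0 s" "\<And>z. z \<in> ball 0 s \<Longrightarrow> cmod (hh z - (G z - k z)) \<le> \<delta>"
    "(\<integral>\<^sup>+z. indicator (ball 0 s) z * ennreal (exp (- \<phi> z) * (cmod (k z))\<^sup>2) \<partial>lborel) \<le> ennreal (2 * (dbar_const + 1)\<^sup>2)"
    "k \<in> borel_measurable borel"
  proof (rule dbar_correction[OF open_ball C\<phi> c\<kappa> \<kappa>pos \<kappa>le])
    show "pderivs G (gx z) (gy z) z" for z by (rule G)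
    show "continuous_on disc gx" "continuous_on disc gy" by (rule cg)+
    show "gx z + \<i> * gy z = \<omega> z" for z by (rule \<omega>G)
    show "continuous_on UNIV \<omega>" by (rule c\<omega>)
    show "compact (cball w R)" "cball w R \<subseteq> disc" by (simp, rule R)
    show "\<omega> z = 0" if "z \<notin> cball w R" for z by (rule z\<omega>[OF that])
    show "dbar_const \<ge> 0" by (rule A0)
    show "(LINT z|lborel. (cmod (\<omega> z))\<^sup>2 * exp (- \<phi> z) / \<kappa> z) \<le> dbar_const\<^sup>2" by (rule A)
    show "open (ball (0::complex) s)" "r > 0" "compact K" "K \<subseteq> disc" using r K by auto
    show "cball z r \<subseteq> K" if "z \<in> ball 0 s" for z by (rule inK[OF that])
    show "exp (- \<phi> z) \<le> 2 * exp (- \<phi> \<zeta>)" if "z \<in> ball 0 s" "\<zeta> \<in> cball z r" for z \<zeta> by (rule osc(1)[OF that])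
    show "cmod (G \<zeta> - G z) \<le> \<delta>" if "z \<in> ball 0 s" "\<zeta> \<in> cball z r" for z \<zeta> by (rule osc(2)[OF that])
  qed (assumption | rule that)+
  define f where "f z = F z + (z - w) * hh z" for z
  define B where "B = exp (ln 2 / eps)"
  define \<phi>s where "\<phi>s z = indicator (ball 0 s) z *\<^sub>R exp (- \<phi> z)" for z
  have sd: "ball 0 s \<subseteq> disc" using s by auto
  have \<phi>m: "\<phi>s \<in> borel_measurable borel"
    unfolding \<phi>s_def[abs_def]
    by (intro borel_measurable_continuous_on_indicator continuous_intros continuous_on_subset[OF c\<phi> sd]) simp
  have third: "indicator (ball 0 s) z * ennreal (exp (- \<phi> z) * (cmod (k z))\<^sup>2) = ennreal (\<phi>s z * (cmod (k z))\<^sup>2)" for z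
    by (cases "z \<in> ball 0 s") (simp_all add: \<phi>s_def)
  have m3: "(\<lambda>z. indicator (ball 0 s) z * ennreal (exp (- \<phi> z) * (cmod (k z))\<^sup>2)) \<in> borel_measurable lborel"
    unfolding third using \<phi>m hk(4) by simp
  \<comment> \<open>The three terms are the cut-off F, the mollification error \<delta>, and the
    correction k.\<close>
  have pt: "(cmod (f z))\<^sup>2 * exp (- 2 * \<psi> z) \<le> 3 * exp 4 * indicator (cball w R) z + 12 * \<delta>\<^sup>2 * N + 3 * T * B * (exp (- \<phi> z) * (cmod (k z))\<^sup>2)"
    if z: "z \<in> ball 0 s" for z
  proof -
    define b where "b = bump R 2 (z - w)"
    have b: "0 \<le> b" "b \<le> 1" using bump_nonneg bump_le_1 by (simp_all add: b_def)
    have "f z = F z * of_real b + (z - w) * (hh z - G z)"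
    proof -
      have "(z - w) * G z = - (F z * ((z - w) * M z))" by (simp add: G_def)
      also have "(z - w) * M z = 1 - of_real b" unfolding M_def b_def by (rule mult_cutoff_quotient[OF R(1)])
      finally show ?thesis by (simp add: f_def algebra_simps)
    qed
    then have "cmod (f z) \<le> cmod (F z) * b + cmod (z - w) * cmod (hh z - G z)"
      using norm_triangle_ineq[of "F z * of_real b" "(z - w) * (hh z - G z)"] b by (simp add: norm_mult)
    also have "\<dots> \<le> cmod (F z) * b + cmod (z - w) * (\<delta> + cmod (k z))"
    proof (intro add_left_mono mult_left_mono)
      have "hh z - G z = (hh z - (G z - k z)) - k z" by simp
      then show "cmod (hh z - G z) \<le> \<delta> + cmod (k z)"
        using hk(2)[OF z] norm_triangle_ineq4[of "hh z - (G z - k z)" "k z"] by simp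
    qed simp
    finally have "cmod (f z) \<le> cmod (F z) * b + cmod (z - w) * \<delta> + cmod (z - w) * cmod (k z)" by (simp add: algebra_simps)
    then have "(cmod (f z))\<^sup>2 \<le> (cmod (F z) * b + cmod (z - w) * \<delta> + cmod (z - w) * cmod (k z))\<^sup>2" by (rule power_mono) simp
    also have "\<dots> \<le> 3 * ((cmod (F z) * b)\<^sup>2 + (cmod (z - w) * \<delta>)\<^sup>2 + (cmod (z - w) * cmod (k z))\<^sup>2)"
      by (rule sum_sq3)
    finally have 1: "(cmod (f z))\<^sup>2 * exp (- 2 * \<psi> z) \<le> 3 * ((cmod (F z) * b)\<^sup>2 + (cmod (z - w) * \<delta>)\<^sup>2 + (cmod (z - w) * cmod (k z))\<^sup>2) * exp (- 2 * \<psi> z)"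
      by (rule mult_right_mono) simp
    have t1: "(cmod (F z) * b)\<^sup>2 * exp (- 2 * \<psi> z) \<le> exp 4 * indicator (cball w R) z"
    proof (cases "z \<in> cball w R")
      case True
      have "(cmod (F z) * b)\<^sup>2 * exp (- 2 * \<psi> z) = b\<^sup>2 * ((cmod (F z))\<^sup>2 * exp (- 2 * \<psi> z))" by (simp add: power_mult_distrib)
      also have "\<dots> \<le> 1 * exp 4" using b F2[OF True] by (intro mult_mono) (auto simp: power_le_one)
      finally show ?thesis using True by simp
    next
      case False
      then have "b = 0" using bump_eq_0[OF R(1), of 2 "z - w"] by (simp add: b_def dist_norm norm_minus_commute)
      then show ?thesis by simp
    qed
    have t2: "(cmod (z - w) * \<delta>)\<^sup>2 * exp (- 2 * \<psi> z) \<le> 4 * \<delta>\<^sup>2 * N"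
    proof -
      have "cmod z < 1" "cmod w < 1" using z w s by auto
      then have "cmod (z - w) \<le> 2" using norm_triangle_ineq4[of z w] by linarith
      then have "(cmod (z - w))\<^sup>2 \<le> 2\<^sup>2" by (rule power_mono) simp
      moreover have "exp (- 2 * \<psi> z) \<le> N" using N[of z] z s' by (auto simp: K_def)
      ultimately have "((cmod (z - w))\<^sup>2 * \<delta>\<^sup>2) * exp (- 2 * \<psi> z) \<le> (2\<^sup>2 * \<delta>\<^sup>2) * N"
        by (intro mult_mono) auto
      then show ?thesis by (simp add: power_mult_distrib)
    qed
    \<comment> \<open>Here the logarithm is spent: |z - w|^2 = T X is at most T B exp of
      \<open>slow_log\<close>, and this exponential is absorbed in passing from 2 \<psi> to
      \<phi>.\<close>
    have t3: "(cmod (z - w) * cmod (k z))\<^sup>2 * exp (- 2 * \<psi> z) \<le> T * B * (exp (- \<phi> z) * (cmod (k z))\<^sup>2)"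
    proof -
      have "(cmod (z - w))\<^sup>2 = T * X z" using T by (simp add: X)
      also have "\<dots> \<le> T * (B * exp (slow_log eps (X z)))"
        using slow_log_bounds(1)[OF eps(1) X0[of z]] T by (intro mult_left_mono) (auto simp: B_def)
      finally have "(cmod (z - w))\<^sup>2 * ((cmod (k z))\<^sup>2 * exp (- 2 * \<psi> z)) \<le> T * (B * exp (slow_log eps (X z))) * ((cmod (k z))\<^sup>2 * exp (- 2 * \<psi> z))"
        by (rule mult_right_mono) simp
      also have "\<dots> = T * B * ((exp (slow_log eps (X z)) * exp (- 2 * \<psi> z)) * (cmod (k z))\<^sup>2)" by simp
      also have "exp (slow_log eps (X z)) * exp (- 2 * \<psi> z) = exp (- \<phi> z)" by (simp add: \<phi>_def exp_add[symmetric])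
      finally show ?thesis by (simp add: power_mult_distrib mult.assoc)
    qed
    show ?thesis using 1 t1 t2 t3 by (simp add: distrib_left distrib_right mult.assoc)
  qed
  show ?thesis
  proof (rule that[of f])
    show "f holomorphic_on ball 0 s" unfolding f_def[abs_def]
      by (intro holomorphic_intros hk(1) holomorphic_on_subset[OF F]) simp
    have "\<psi> w - 1 \<le> Re (h w)" using h(2)[of w] R(1) by simp
    then show "exp (\<psi> w - 1) \<le> cmod (f w)" by (simp add: f_def F_def)
    have "(\<integral>\<^sup>+z. indicator (ball 0 s) z * ennreal ((cmod (f z))\<^sup>2 * exp (- 2 * \<psi> z)) \<partial>lborel)
      \<le> (\<integral>\<^sup>+z. ennreal (3 * exp 4) * indicator (cball w R) z + (ennreal (12 * \<delta>\<^sup>2 * N) * indicator (ball 0 1) z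
            + ennreal (3 * T * B) * (indicator (ball 0 s) z * ennreal (exp (- \<phi> z) * (cmod (k z))\<^sup>2))) \<partial>lborel)"
    proof (rule nn_integral_mono)
      fix z
      show "indicator (ball 0 s) z * ennreal ((cmod (f z))\<^sup>2 * exp (- 2 * \<psi> z)) \<le>
        ennreal (3 * exp 4) * indicator (cball w R) z + (ennreal (12 * \<delta>\<^sup>2 * N) * indicator (ball 0 1) z
            + ennreal (3 * T * B) * (indicator (ball 0 s) z * ennreal (exp (- \<phi> z) * (cmod (k z))\<^sup>2)))"
      proof (cases "z \<in> ball 0 s")
        case True
        have zd: "z \<in> disc" using True sd by blast
        have B0: "B \<ge> 0" by (simp add: B_def)
        have "ennreal ((cmod (f z))\<^sup>2 * exp (- 2 * \<psi> z)) \<le> ennreal (3 * exp 4 * indicator (cball w R) z + (12 * \<delta>\<^sup>2 * N + 3 * T * B * (exp (- \<phi> z) * (cmod (k z))\<^sup>2)))"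
          using pt[OF True] by (intro ennreal_leI) (simp add: add.assoc)
        also have "\<dots> = ennreal (3 * exp 4 * indicator (cball w R) z) + (ennreal (12 * \<delta>\<^sup>2 * N) + ennreal (3 * T * B * (exp (- \<phi> z) * (cmod (k z))\<^sup>2)))"
          using T N0 B0 by (simp add: ennreal_plus del: ennreal_plus[symmetric])
        also have "\<dots> = ennreal (3 * exp 4) * indicator (cball w R) z + (ennreal (12 * \<delta>\<^sup>2 * N) + ennreal (3 * T * B) * ennreal (exp (- \<phi> z) * (cmod (k z))\<^sup>2))"
          using T B0 by (simp add: ennreal_mult indicator_def)
        finally show ?thesis using True zd by simp
      qed simp
    qed
    also have "\<dots> = ennreal (3 * exp 4) * emeasure lborel (cball w R) + (ennreal (12 * \<delta>\<^sup>2 * N) * emeasure lborel (ball (0::complex) 1)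
        + ennreal (3 * T * B) * (\<integral>\<^sup>+z. indicator (ball 0 s) z * ennreal (exp (- \<phi> z) * (cmod (k z))\<^sup>2) \<partial>lborel))"
    proof -
      define g3 where "g3 z = indicator (ball 0 s) z * ennreal (exp (- \<phi> z) * (cmod (k z))\<^sup>2)" for z
      have g3m [measurable]: "g3 \<in> borel_measurable lborel" unfolding g3_def[abs_def] by (rule m3)
      have [measurable]: "cball w R \<in> sets lborel" "ball (0::complex) 1 \<in> sets lborel" by simp_all
      have "(\<integral>\<^sup>+z. a * indicator (cball w R) z + (b * indicator (ball 0 1) z + c * g3 z) \<partial>lborel)
        = a * emeasure lborel (cball w R) + (b * emeasure lborel (ball (0::complex) 1) + c * (\<integral>\<^sup>+z. g3 z \<partial>lborel))" for a b c
        by (subst nn_integral_add, measurable, subst nn_integral_add, measurable,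
            subst nn_integral_cmult_indicator, measurable, subst nn_integral_cmult_indicator, measurable,
            subst nn_integral_cmult, measurable)
      then show ?thesis unfolding g3_def .
    qed
    also have "\<dots> \<le> ennreal (3 * exp 4) * ennreal (pi * R\<^sup>2) + (ennreal (12 * \<delta>\<^sup>2 * N) * ennreal pi
        + ennreal (3 * T * B) * ennreal (2 * (dbar_const + 1)\<^sup>2))"
      using R(1) by (intro add_mono mult_left_mono hk(3)) (simp_all add: emeasure_cball emeasure_ball unit_ball_vol_2)
    also have "\<dots> = ennreal (3 * exp 4 * (pi * R\<^sup>2) + (12 * \<delta>\<^sup>2 * N * pi + 3 * T * B * (2 * (dbar_const + 1)\<^sup>2)))"
    proof -
      have "ennreal a * ennreal b + (ennreal c * ennreal d + ennreal p * ennreal q) = ennreal (a * b + (c * d + p * q))"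
        if "a \<ge> 0" "b \<ge> 0" "c \<ge> 0" "d \<ge> 0" "p \<ge> 0" "q \<ge> 0" for a b c d p q
        using that by (simp add: ennreal_mult)
      from this[of "3 * exp 4" "pi * R\<^sup>2" "12 * \<delta>\<^sup>2 * N" pi "3 * T * B" "2 * (dbar_const + 1)\<^sup>2"]
      show ?thesis using T N0 by (simp only: B_def exp_ge_zero mult_nonneg_nonneg pi_ge_zero zero_le_power2 zero_le_numeral less_imp_le simp_thms)
    qed
    also have "\<dots> \<le> ennreal (peak_const * (\<tau> w)\<^sup>2)"
    proof (rule ennreal_leI)
      have "12 * \<delta>\<^sup>2 * N * pi = 3 * (4 * \<delta>\<^sup>2 * N * pi)" by simp
      then have "12 * \<delta>\<^sup>2 * N * pi = 3 * T" unfolding \<delta>(2) .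
      moreover have "3 * exp 4 * (pi * R\<^sup>2) \<le> 3 * exp 4 * (pi * T)" using R2T by (intro mult_left_mono) auto
      moreover have "peak_const * (\<tau> w)\<^sup>2 = 3 * exp 4 * (pi * T) + (3 * T + 3 * T * B * (2 * (dbar_const + 1)\<^sup>2))"
        unfolding peak_const_def T_def[symmetric] B_def[symmetric] by (simp add: algebra_simps)
      ultimately show "3 * exp 4 * (pi * R\<^sup>2) + (12 * \<delta>\<^sup>2 * N * pi + 3 * T * B * (2 * (dbar_const + 1)\<^sup>2)) \<le> peak_const * (\<tau> w)\<^sup>2"
        by linarith
    qed
    finally show "(\<integral>\<^sup>+z. indicator (ball 0 s) z * ennreal ((cmod (f z))\<^sup>2 * exp (- 2 * \<psi> z)) \<partial>lborel) \<le> ennreal (peak_const * (\<tau> w)\<^sup>2)" .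
  qed
qed

end

section \<open>Compactness in the weighted Bergman space\<close>

lemma weighted_density_measurable:
  fixes f :: "complex \<Rightarrow> complex"
  assumes "continuous_on (ball 0 s) f" "continuous_on disc \<psi>" "s \<le> 1"
  shows "(\<lambda>z. indicator (ball 0 s) z * ((cmod (f z))\<^sup>2 * exp (- 2 * \<psi> z))) \<in> borel_measurable borel"
proof -
  have "ball (0::complex) s \<subseteq> disc" using assms(3) by auto
  then have "continuous_on (ball 0 s) \<psi>" using assms(2) continuous_on_subset by blast
  then have "(\<lambda>z. indicator (ball 0 s) z *\<^sub>R ((cmod (f z))\<^sup>2 * exp (- 2 * \<psi> z))) \<in> borel_measurable borel"
    by (intro borel_measurable_continuous_on_indicator continuous_intros assms(1)) auto
  then show ?thesis by simp
qed

text \<open>\<open>AL2\<close> and \<open>L2norm\<close> use the gauge integral. The density is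
  nonnegative, so it is absolutely integrable, and Borel measurability moves the integral to
  \<open>lborel\<close>. The factor pi undoes the normalisation of area measure.\<close>

lemma AL2_lebesgue:
  assumes c: "continuous_on disc \<psi>" and f: "f \<in> AL2 \<psi>"
  shows "integrable lborel (\<lambda>z. indicator disc z * ((cmod (f z))\<^sup>2 * exp (- 2 * \<psi> z)))"
    "(LINT z|lborel. indicator disc z * ((cmod (f z))\<^sup>2 * exp (- 2 * \<psi> z))) = pi * (L2norm \<psi> f)\<^sup>2"
proof -
  let ?F = "\<lambda>z. (cmod (f z))\<^sup>2 * exp (- 2 * \<psi> z)"
  have hol: "f holomorphic_on disc" and i: "?F integrable_on disc" using f by (auto simp: AL2_def)
  have m: "(\<lambda>z. indicator disc z * ?F z) \<in> borel_measurable borel"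
    by (rule weighted_density_measurable[OF holomorphic_on_imp_continuous_on[OF hol] c]) simp
  have si: "set_integrable lebesgue disc ?F"
    by (rule nonnegative_absolutely_integrable_1[OF i]) simp
  then have "integrable lebesgue (\<lambda>z. indicator disc z * ?F z)" by (simp add: set_integrable_def)
  then show "integrable lborel (\<lambda>z. indicator disc z * ?F z)" using m by (subst (asm) integrable_completion) auto
  have "integral disc ?F = (LINT z|lebesgue. indicator disc z * ?F z)"
    using set_lebesgue_integral_eq_integral(2)[OF si] by (simp add: set_lebesgue_integral_def)
  also have "\<dots> = (LINT z|lborel. indicator disc z * ?F z)" using m by (intro integral_completion) simp
  finally have e: "integral disc ?F = (LINT z|lborel. indicator disc z * ?F z)" .
  have "0 \<le> (LINT z|lborel. indicator disc z * ?F z)" by (intro integral_nonneg_AE) simp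
  then have "0 \<le> integral disc ?F" unfolding e .
  then have "pi * (L2norm \<psi> f)\<^sup>2 = integral disc ?F" unfolding L2norm_def by simp
  then show "(LINT z|lborel. indicator disc z * ?F z) = pi * (L2norm \<psi> f)\<^sup>2" using e by simp
qed

lemma AL2I:
  assumes c: "continuous_on disc \<psi>" and f: "f holomorphic_on disc" and C: "C \<ge> 0"
    and bd: "(\<integral>\<^sup>+z. indicator disc z * ennreal ((cmod (f z))\<^sup>2 * exp (- 2 * \<psi> z)) \<partial>lborel) \<le> ennreal C"
  shows "f \<in> AL2 \<psi>" "pi * (L2norm \<psi> f)\<^sup>2 \<le> C"
proof -
  let ?F = "\<lambda>z. (cmod (f z))\<^sup>2 * exp (- 2 * \<psi> z)"
  have m: "(\<lambda>z. indicator disc z * ?F z) \<in> borel_measurable borel"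
    by (rule weighted_density_measurable[OF holomorphic_on_imp_continuous_on[OF f] c]) simp
  have e: "indicator disc z * ennreal (?F z) = ennreal (indicator disc z * ?F z)" for z
    by (cases "z \<in> disc") auto
  have fin: "(\<integral>\<^sup>+z. ennreal (indicator disc z * ?F z) \<partial>lborel) < \<infinity>"
    using bd unfolding e by (rule le_less_trans) simp
  have i: "integrable lborel (\<lambda>z. indicator disc z * ?F z)"
    by (rule integrableI_nonneg[OF _ _ fin]) (use m in auto)
  then have "integrable lebesgue (\<lambda>z. indicator disc z * ?F z)" using m by (subst integrable_completion) auto
  then have "set_integrable lebesgue disc ?F" by (simp add: set_integrable_def)
  then show AL: "f \<in> AL2 \<psi>" using set_lebesgue_integral_eq_integral(1) f by (auto simp: AL2_def)
  have "ennreal (LINT z|lborel. indicator disc z * ?F z) = (\<integral>\<^sup>+z. ennreal (indicator disc z * ?F z) \<partial>lborel)"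
    by (rule nn_integral_eq_integral[symmetric, OF i]) simp
  also have "\<dots> \<le> ennreal C" using bd unfolding e .
  finally have "(LINT z|lborel. indicator disc z * ?F z) \<le> C" using C by (simp add: ennreal_le_iff)
  then show "pi * (L2norm \<psi> f)\<^sup>2 \<le> C" using AL2_lebesgue(2)[OF c AL] by simp
qed

text \<open>A crude bound with a constant depending on the position of z; it serves only to make
  families bounded on compact sets.\<close>

lemma weighted_local_bound:
  fixes \<psi> :: "complex \<Rightarrow> real"
  assumes f: "f holomorphic_on ball 0 s" and z: "cball z r \<subseteq> ball 0 s" and r: "r > 0" and c: "continuous_on disc \<psi>" "s \<le> 1"
    and M: "\<And>x. x \<in> cball z r \<Longrightarrow> exp (2 * \<psi> x) \<le> M" and C: "C \<ge> 0"
    and bd: "(\<integral>\<^sup>+z. indicator (ball 0 s) z * ennreal ((cmod (f z))\<^sup>2 * exp (- 2 * \<psi> z)) \<partial>lborel) \<le> ennreal C"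
  shows "r\<^sup>2 / 4 * (cmod (f z))\<^sup>2 \<le> M * C"
proof -
  let ?F = "\<lambda>z. (cmod (f z))\<^sup>2 * exp (- 2 * \<psi> z)"
  have M0: "M > 0" using M[of z] r less_le_trans[OF exp_gt_zero] by auto
  have e: "indicator (ball 0 s) z * ennreal (?F z) = ennreal (indicator (ball 0 s) z * ?F z)" for z
    by (cases "z \<in> ball 0 s") auto
  have m: "(\<lambda>z. indicator (ball 0 s) z * ?F z) \<in> borel_measurable borel"
    by (rule weighted_density_measurable[OF holomorphic_on_imp_continuous_on[OF f] c])
  have fin: "(\<integral>\<^sup>+z. ennreal (indicator (ball 0 s) z * ?F z) \<partial>lborel) < \<infinity>"
    using bd unfolding e by (rule le_less_trans) simp
  have i: "integrable lborel (\<lambda>z. indicator (ball 0 s) z * ?F z)"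
    by (rule integrableI_nonneg[OF _ _ fin]) (use m in auto)
  have cf: "continuous_on (cball z r) f" using holomorphic_on_imp_continuous_on[OF f] z continuous_on_subset by blast
  have i1: "integrable lborel (\<lambda>x. indicator (cball z r) x *\<^sub>R (cmod (f x))\<^sup>2)"
    by (intro borel_integrable_compact continuous_intros cf) simp
  have "r\<^sup>2 / 4 * (cmod (f z))\<^sup>2 \<le> (LINT x|lborel. indicator (cball z r) x * (cmod (f x))\<^sup>2)"
    by (rule L2_mean_value_inequality[OF f open_ball z r])
  also have "\<dots> \<le> (LINT x|lborel. M * (indicator (ball 0 s) x * ?F x))"
  proof (rule integral_mono)
    show "integrable lborel (\<lambda>x. indicator (cball z r) x * (cmod (f x))\<^sup>2)" using i1 by simp
    show "integrable lborel (\<lambda>x. M * (indicator (ball 0 s) x * ?F x))" using i by simp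
    fix x
    show "indicator (cball z r) x * (cmod (f x))\<^sup>2 \<le> M * (indicator (ball 0 s) x * ?F x)"
    proof (cases "x \<in> cball z r")
      case True
      then have xs: "x \<in> ball 0 s" using z by blast
      have "(cmod (f x))\<^sup>2 = exp (2 * \<psi> x) * ?F x" by (simp add: exp_add[symmetric])
      also have "\<dots> \<le> M * ?F x" using M[OF True] by (intro mult_right_mono) auto
      finally show ?thesis using True xs by simp
    next
      case False
      have "0 \<le> M * (indicator (ball 0 s) x * ?F x)" using M0 by (intro mult_nonneg_nonneg) auto
      then show ?thesis using False by simp
    qed
  qed
  also have "\<dots> = M * (LINT x|lborel. indicator (ball 0 s) x * ?F x)" by simp
  also have "\<dots> \<le> M * C"
  proof (rule mult_left_mono)
    have "ennreal (LINT z|lborel. indicator (ball 0 s) z * ?F z) = (\<integral>\<^sup>+z. ennreal (indicator (ball 0 s) z * ?F z) \<partial>lborel)"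
      by (rule nn_integral_eq_integral[symmetric, OF i]) simp
    also have "\<dots> \<le> ennreal C" using bd unfolding e .
    finally show "(LINT x|lborel. indicator (ball 0 s) x * ?F x) \<le> C" using C by (simp add: ennreal_le_iff)
  qed (use M0 in simp)
  finally show ?thesis .
qed

text \<open>Montel's theorem needs a common domain, so each \<open>f n\<close> is dilated to the unit disc.\<close>

lemma exhaustion_limit:
  fixes \<psi> :: "complex \<Rightarrow> real"
  assumes s: "\<And>n. 1 / 2 \<le> s n" "\<And>n. s n < 1" "s \<longlonglongrightarrow> (1::real)" and c: "continuous_on disc \<psi>" and C: "C \<ge> 0"
    and f: "\<And>n. f n holomorphic_on ball 0 (s n)"
    and bd: "\<And>n::nat. (\<integral>\<^sup>+z. indicator (ball 0 (s n)) z * ennreal ((cmod (f n z))\<^sup>2 * exp (- 2 * \<psi> z)) \<partial>lborel) \<le> ennreal C"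
  obtains g r where "strict_mono (r :: nat \<Rightarrow> nat)" "g \<in> AL2 \<psi>" "pi * (L2norm \<psi> g)\<^sup>2 \<le> C"
    "\<And>z. z \<in> disc \<Longrightarrow> (\<lambda>n. f (r n) z) \<longlonglongrightarrow> g z"
proof -
  define F where "F n z = f n (of_real (s n) * z)" for n z
  have s0: "s n > 0" for n using s(1)[of n] by simp
  have inb: "of_real (s n) * z \<in> ball 0 (s n)" if "z \<in> disc" for n z
    using that s0[of n] by (simp add: norm_mult)
  have Fhol: "F n holomorphic_on disc" for n
    unfolding F_def using inb
    by (intro holomorphic_on_compose_gen[OF _ f, unfolded o_def] holomorphic_intros) auto
  have bounded: "\<exists>B. \<forall>h\<in>range F. \<forall>z\<in>K. cmod (h z) \<le> B" if K: "compact K" "K \<subseteq> disc" for K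
  proof -
    obtain b where b: "b < 1" "b \<ge> 0" "K \<subseteq> cball 0 b"
    proof (cases "K = {}")
      case True then show ?thesis by (intro that[of 0]) auto
    next
      case False
      then obtain x where x: "x \<in> K" "\<And>y. y \<in> K \<Longrightarrow> cmod y \<le> cmod x"
        using continuous_attains_sup[OF K(1) False continuous_on_norm_id] by blast
      then show ?thesis using K(2) by (intro that[of "cmod x"]) auto
    qed
    define K' where "K' = cball (0::complex) ((1 + b) / 2)"
    have K': "compact K'" "K' \<subseteq> disc" using b by (auto simp: K'_def)
    have "continuous_on K' (\<lambda>z. exp (2 * \<psi> z))" by (intro continuous_intros continuous_on_subset[OF c K'(2)])
    then have "bounded ((\<lambda>z. exp (2 * \<psi> z)) ` K')" using compact_continuous_image K'(1) compact_imp_bounded by blast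
    then obtain M where M: "\<And>z. z \<in> K' \<Longrightarrow> exp (2 * \<psi> z) \<le> M" unfolding bounded_iff by fastforce
    have "(0::complex) \<in> K'" using b by (simp add: K'_def)
    from M[OF this] have M0: "M \<ge> 0" using order_trans[OF exp_ge_zero] by blast
    \<comment> \<open>Since s n is at least 1/2, r is at most s n (1 - b) / 2. So for z in K the
      disc of radius r about s n z stays in the ball of radius s n (1 + b) / 2, uniformly in
      n.\<close>
    define r where "r = (1 - b) / 4"
    have r: "r > 0" using b by (simp add: r_def)
    have "cmod (F n z) \<le> sqrt (4 * (M * C) / r\<^sup>2)" if z: "z \<in> K" for n z
    proof -
      have zb: "cmod z \<le> b" using b z by auto
      define y where "y = of_real (s n) * z"
      have yb: "cmod y \<le> s n * b" using zb s0[of n] by (simp add: y_def norm_mult)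
      have rs: "r \<le> s n * ((1 - b) / 2)"
      proof -
        have "1 / 2 * ((1 - b) / 2) \<le> s n * ((1 - b) / 2)" using s(1)[of n] b by (intro mult_right_mono) auto
        then show ?thesis by (simp add: r_def)
      qed
      have sb: "s n * b + s n * ((1 - b) / 2) = s n * ((1 + b) / 2)" by (simp add: algebra_simps) (simp add: field_simps)
      have nx: "cmod x \<le> s n * ((1 + b) / 2)" if "x \<in> cball y r" for x
        using that norm_triangle_ineq[of y "x - y"] yb rs sb by (simp add: dist_norm norm_minus_commute) 
      have b2: "s n * ((1 + b) / 2) < s n" "s n * ((1 + b) / 2) \<le> (1 + b) / 2"
        using s0[of n] s(2)[of n] b by (auto simp: mult_left_le_one_le)
      have "r\<^sup>2 / 4 * (cmod (f n y))\<^sup>2 \<le> M * C"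
      proof (rule weighted_local_bound[OF f _ r c _ _ C bd])
        show "cball y r \<subseteq> ball 0 (s n)" using nx b2(1) by fastforce
        show "s n \<le> 1" using s(2)[of n] by simp
        show "exp (2 * \<psi> x) \<le> M" if "x \<in> cball y r" for x
          using nx[OF that] b2(2) by (intro M) (simp add: K'_def)
      qed
      then have "(cmod (F n z))\<^sup>2 \<le> 4 * (M * C) / r\<^sup>2" using r by (simp add: F_def y_def field_simps)
      then show ?thesis by (rule real_le_rsqrt)
    qed
    then show ?thesis by blast
  qed
  obtain g r where gr: "g holomorphic_on disc" "strict_mono r"
     "\<And>x. x \<in> disc \<Longrightarrow> (\<lambda>n. F (r n) x) \<longlonglongrightarrow> g x"
     "\<And>K. compact K \<Longrightarrow> K \<subseteq> disc \<Longrightarrow> uniform_limit K (F \<circ> r) g sequentially"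
    using Montel[OF open_ball, of "range F" 0 1 F] Fhol bounded by blast
  have sr: "(\<lambda>n. s (r n)) \<longlonglongrightarrow> 1" using LIMSEQ_subseq_LIMSEQ[OF s(3) gr(2)] by (simp add: o_def)
  have lim: "(\<lambda>n. f (r n) z) \<longlonglongrightarrow> g z" and ev: "\<forall>\<^sub>F n in sequentially. z \<in> ball 0 (s (r n))" if z: "z \<in> disc" for z
  proof -
    define b where "b = (1 + cmod z) / 2"
    have b: "cmod z < b" "b < 1" "b > 0" using z norm_ge_zero[of z] by (auto simp: b_def simp del: norm_ge_zero)
    \<comment> \<open>Undoes the dilation: F (r n) at y n is f (r n) at z. The points y n move, so
      uniform convergence on a closed disc around 0 is used together with continuity of g.\<close>
    define y where "y n = z / of_real (s (r n))" for n
    have yl: "y \<longlonglongrightarrow> z"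
    proof -
      have "y \<longlonglongrightarrow> z / of_real 1" unfolding y_def by (intro tendsto_intros sr) simp
      then show ?thesis by simp
    qed
    have yK: "\<forall>\<^sub>F n in sequentially. y n \<in> cball 0 b"
    proof -
      have "(\<lambda>n. cmod (y n)) \<longlonglongrightarrow> cmod z" by (intro tendsto_norm yl)
      from order_tendstoD(2)[OF this b(1)] show ?thesis by (auto elim!: eventually_mono)
    qed
    show "\<forall>\<^sub>F n in sequentially. z \<in> ball 0 (s (r n))"
      using order_tendstoD(1)[OF sr, of "cmod z"] z by (auto elim!: eventually_mono)
    have K: "compact (cball (0::complex) b)" "cball 0 b \<subseteq> disc" using b by auto
    have ul: "uniform_limit (cball 0 b) (F \<circ> r) g sequentially" by (rule gr(4)[OF K])
    have "isCont g z" using gr(1) z holomorphic_on_imp_continuous_on continuous_on_eq_continuous_at by blast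
    then have gy: "(\<lambda>n. g (y n)) \<longlonglongrightarrow> g z" using yl isCont_tendsto_compose by blast
    have "(\<lambda>n. F (r n) (y n) - g (y n)) \<longlonglongrightarrow> 0"
    proof (rule tendstoI)
      fix e :: real assume "e > 0"
      then have "\<forall>\<^sub>F n in sequentially. \<forall>x\<in>cball 0 b. dist ((F \<circ> r) n x) (g x) < e" using ul uniform_limitD by blast
      with yK show "\<forall>\<^sub>F n in sequentially. dist (F (r n) (y n) - g (y n)) 0 < e"
        by eventually_elim (simp add: dist_norm)
    qed
    from tendsto_add[OF this gy] have "(\<lambda>n. F (r n) (y n)) \<longlonglongrightarrow> g z" by simp
    moreover have "F (r n) (y n) = f (r n) z" for n using s0[of "r n"] by (simp add: F_def y_def)
    ultimately show "(\<lambda>n. f (r n) z) \<longlonglongrightarrow> g z" by simp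
  qed
  define H where "H n z = indicator (ball 0 (s (r n))) z * ennreal ((cmod (f (r n) z))\<^sup>2 * exp (- 2 * \<psi> z))" for n z
  have Hm: "H n \<in> borel_measurable lborel" for n
  proof -
    have "(\<lambda>z. indicator (ball 0 (s (r n))) z * ((cmod (f (r n) z))\<^sup>2 * exp (- 2 * \<psi> z))) \<in> borel_measurable borel"
      using s(2)[of "r n"] by (intro weighted_density_measurable holomorphic_on_imp_continuous_on f c) simp
    then have "(\<lambda>z. ennreal (indicator (ball 0 (s (r n))) z * ((cmod (f (r n) z))\<^sup>2 * exp (- 2 * \<psi> z)))) \<in> borel_measurable lborel"
      by simp
    moreover have "H n = (\<lambda>z. ennreal (indicator (ball 0 (s (r n))) z * ((cmod (f (r n) z))\<^sup>2 * exp (- 2 * \<psi> z))))"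
    proof
      fix z show "H n z = ennreal (indicator (ball 0 (s (r n))) z * ((cmod (f (r n) z))\<^sup>2 * exp (- 2 * \<psi> z)))"
        unfolding H_def by (cases "z \<in> ball 0 (s (r n))") auto
    qed
    ultimately show ?thesis by (simp only:)
  qed
  have "(\<integral>\<^sup>+z. indicator disc z * ennreal ((cmod (g z))\<^sup>2 * exp (- 2 * \<psi> z)) \<partial>lborel) \<le> (\<integral>\<^sup>+z. liminf (\<lambda>n. H n z) \<partial>lborel)"
  proof (rule nn_integral_mono)
    fix z
    show "indicator disc z * ennreal ((cmod (g z))\<^sup>2 * exp (- 2 * \<psi> z)) \<le> liminf (\<lambda>n. H n z)"
    proof (cases "z \<in> disc")
      case True
      have "(\<lambda>n. ennreal ((cmod (f (r n) z))\<^sup>2 * exp (- 2 * \<psi> z))) \<longlonglongrightarrow> ennreal ((cmod (g z))\<^sup>2 * exp (- 2 * \<psi> z))"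
        by (intro tendsto_ennrealI tendsto_intros lim True)
      then have "(\<lambda>n. H n z) \<longlonglongrightarrow> ennreal ((cmod (g z))\<^sup>2 * exp (- 2 * \<psi> z))"
        by (rule Lim_transform_eventually) (use ev[OF True] in \<open>auto elim!: eventually_mono simp: H_def\<close>)
      from lim_imp_Liminf[OF _ this] show ?thesis using True by simp
    qed simp
  qed
  also have "\<dots> \<le> liminf (\<lambda>n. \<integral>\<^sup>+z. H n z \<partial>lborel)" by (rule nn_integral_liminf[OF Hm])
  also have "\<dots> \<le> ennreal C"
    using bd by (intro Liminf_le always_eventually allI) (simp_all add: H_def)
  finally have "(\<integral>\<^sup>+z. indicator disc z * ennreal ((cmod (g z))\<^sup>2 * exp (- 2 * \<psi> z)) \<partial>lborel) \<le> ennreal C" .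
  from AL2I[OF c gr(1) C this] show ?thesis using lim by (intro that[OF gr(2)])
qed

context lipschitz_weight
begin

definition eval_const :: real where "eval_const = sqrt (4 * exp 6 * pi) / rad"

lemma eval_const_pos: "eval_const > 0"
  using rad by (simp add: eval_const_def)

lemma AL2_point_evaluation:
  assumes f: "f \<in> AL2 \<psi>" and w: "w \<in> disc"
  shows "cmod (f w) \<le> eval_const * (exp (\<psi> w) / \<tau> w) * L2norm \<psi> f"
proof -
  have hol: "f holomorphic_on disc" using f by (simp add: AL2_def)
  note L = local_disc[OF w]
  have tw: "\<tau> w > 0" by (rule tau_pos[OF w])
  define B where "B = cball w (rad * \<tau> w)"
  let ?F = "\<lambda>z. (cmod (f z))\<^sup>2 * exp (- 2 * \<psi> z)"
  have N0: "L2norm \<psi> f \<ge> 0"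
  proof -
    have "0 \<le> integral disc ?F" by (intro integral_nonneg) (use f in \<open>auto simp: AL2_def\<close>)
    then show ?thesis by (simp add: L2norm_def)
  qed
  have "(LINT z|lborel. indicator B z * ?F z) \<le> (LINT z|lborel. indicator disc z * ?F z)"
  proof (rule integral_mono[OF _ AL2_lebesgue(1)[OF psi_cont f]])
    have "continuous_on B f" "continuous_on B \<psi>"
      using holomorphic_on_imp_continuous_on[OF hol] psi_cont L(1) continuous_on_subset unfolding B_def by blast+
    then have "integrable lborel (\<lambda>z. indicator B z *\<^sub>R ?F z)"
      by (intro borel_integrable_compact continuous_intros) (simp_all add: B_def)
    then show "integrable lborel (\<lambda>z. indicator B z * ?F z)" by simp
    show "indicator B z * ?F z \<le> indicator disc z * ?F z" for z
      using L(1) by (auto simp: B_def indicator_def)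
  qed
  also have "\<dots> = pi * (L2norm \<psi> f)\<^sup>2" by (rule AL2_lebesgue(2)[OF psi_cont f])
  finally have "exp 6 * (LINT z|lborel. indicator B z * ?F z) \<le> exp 6 * (pi * (L2norm \<psi> f)\<^sup>2)" by (rule mult_left_mono) simp
  with point_evaluation[OF w open_ball L(1) hol]
  have "(rad * \<tau> w)\<^sup>2 / 4 * ?F w \<le> exp 6 * (pi * (L2norm \<psi> f)\<^sup>2)" unfolding B_def by (rule order_trans)
  moreover have "F \<le> 4 * E / P" if "P / 4 * F \<le> E" "P > 0" for E F P :: real using that by (simp add: field_simps)
  ultimately have "?F w \<le> 4 * (exp 6 * (pi * (L2norm \<psi> f)\<^sup>2)) / (rad * \<tau> w)\<^sup>2" using zero_less_power[OF L(2), of 2] by blast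
  then have "exp (2 * \<psi> w) * ?F w \<le> exp (2 * \<psi> w) * (4 * (exp 6 * (pi * (L2norm \<psi> f)\<^sup>2)) / (rad * \<tau> w)\<^sup>2)"
    by (rule mult_left_mono) simp
  also have "exp (2 * \<psi> w) * ?F w = (cmod (f w))\<^sup>2" by (simp add: exp_add[symmetric])
  also have "exp (2 * \<psi> w) * (4 * (exp 6 * (pi * (L2norm \<psi> f)\<^sup>2)) / (rad * \<tau> w)\<^sup>2) = (eval_const * (exp (\<psi> w) / \<tau> w) * L2norm \<psi> f)\<^sup>2"
  proof -
    have "exp (2 * \<psi> w) = (exp (\<psi> w))\<^sup>2" by (simp add: power2_eq_square exp_add[symmetric])
    then show ?thesis by (simp add: eval_const_def power_mult_distrib power_divide)
  qed
  finally show ?thesis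
    by (rule power2_le_imp_le) (use eval_const_pos tw N0 in \<open>simp add: mult_nonneg_nonneg\<close>)
qed

lemma peak_const_nonneg: "peak_const \<ge> 0"
  unfolding peak_const_def by (intro add_nonneg_nonneg mult_nonneg_nonneg) auto

text \<open>The bounds on the discs of radius s n do not depend on n; pointwise convergence at w
  preserves the lower bound in the limit.\<close>

lemma peak_function:
  assumes w: "w \<in> disc"
  obtains f where "f \<in> AL2 \<psi>" "exp (\<psi> w - 1) \<le> cmod (f w)" "pi * (L2norm \<psi> f)\<^sup>2 \<le> peak_const * (\<tau> w)\<^sup>2"
proof -
  have w1: "1 - cmod w > 0" using w by simp
  \<comment> \<open>The summand 2 keeps s n at least 1/2, as \<open>exhaustion_limit\<close>
    requires, and strictly above cmod w already for n = 0.\<close>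
  define s where "s n = 1 - (1 - cmod w) / (real n + 2)" for n
  have s: "1 / 2 \<le> s n" "s n < 1" "cmod w < s n" for n
  proof -
    define D where "D = (1 - cmod w) / (real n + 2)"
    have "D \<le> (1 - cmod w) / 2" unfolding D_def using w1 by (intro divide_left_mono) auto
    then have D: "2 * D \<le> 1 - cmod w" by simp
    have D0: "D > 0" unfolding D_def using w1 by simp
    have sD: "s n = 1 - D" by (simp add: s_def D_def)
    have "1 \<le> 2 * s n" using D sD norm_ge_zero[of w] by linarith
    then show "1 / 2 \<le> s n" by simp
    show "s n < 1" using D0 sD by linarith
    show "cmod w < s n" using D sD w1 by linarith
  qed
  have sl: "s \<longlonglongrightarrow> 1"
  proof -
    have "(\<lambda>n. (1 - cmod w) * inverse (real (Suc (Suc n)))) \<longlonglongrightarrow> (1 - cmod w) * 0"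
      by (intro tendsto_mult tendsto_const LIMSEQ_Suc[OF LIMSEQ_inverse_real_of_nat])
    then have "(\<lambda>n. 1 - (1 - cmod w) * inverse (real (Suc (Suc n)))) \<longlonglongrightarrow> 1 - (1 - cmod w) * 0"
      by (intro tendsto_diff tendsto_const)
    moreover have "s = (\<lambda>n. 1 - (1 - cmod w) * inverse (real (Suc (Suc n))))"
      by (simp add: s_def divide_inverse add.commute fun_eq_iff)
    ultimately show ?thesis by (simp only: mult_zero_right diff_zero)
  qed
  define P where "P n f \<longleftrightarrow> f holomorphic_on ball 0 (s n) \<and> exp (\<psi> w - 1) \<le> cmod (f w) \<and>
    (\<integral>\<^sup>+z. indicator (ball 0 (s n)) z * ennreal ((cmod (f z))\<^sup>2 * exp (- 2 * \<psi> z)) \<partial>lborel) \<le> ennreal (peak_const * (\<tau> w)\<^sup>2)" for n f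
  have "\<exists>f. P n f" for n
  proof (rule peak_on_subdisc[OF w s(3)[of n] s(2)[of n]])
    fix f assume "f holomorphic_on ball 0 (s n)" "exp (\<psi> w - 1) \<le> cmod (f w)"
      "(\<integral>\<^sup>+z. indicator (ball 0 (s n)) z * ennreal ((cmod (f z))\<^sup>2 * exp (- 2 * \<psi> z)) \<partial>lborel) \<le> ennreal (peak_const * (\<tau> w)\<^sup>2)"
    then have "P n f" unfolding P_def by (intro conjI)
    then show "\<exists>f. P n f" by blast
  qed
  then obtain f where fP: "\<And>n. P n (f n)" by metis
  have f: "f n holomorphic_on ball 0 (s n)" "exp (\<psi> w - 1) \<le> cmod (f n w)"
    "(\<integral>\<^sup>+z. indicator (ball 0 (s n)) z * ennreal ((cmod (f n z))\<^sup>2 * exp (- 2 * \<psi> z)) \<partial>lborel) \<le> ennreal (peak_const * (\<tau> w)\<^sup>2)" for n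
    using fP[of n] unfolding P_def by simp_all
  have C0: "peak_const * (\<tau> w)\<^sup>2 \<ge> 0" using peak_const_nonneg by simp
  obtain g r where gr: "strict_mono (r :: nat \<Rightarrow> nat)" "g \<in> AL2 \<psi>" "pi * (L2norm \<psi> g)\<^sup>2 \<le> peak_const * (\<tau> w)\<^sup>2"
    "\<And>z. z \<in> disc \<Longrightarrow> (\<lambda>n. f (r n) z) \<longlonglongrightarrow> g z"
    by (rule exhaustion_limit[OF s(1) s(2) sl psi_cont C0 f(1) f(3)]) (assumption | rule that)+
  have "exp (\<psi> w - 1) \<le> cmod (g w)"
    by (rule LIMSEQ_le_const[OF tendsto_norm[OF gr(4)[OF w]]]) (intro exI[of _ 0] allI impI f(2))
  then show ?thesis by (rule that[OF gr(2) _ gr(3)])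
qed

end

section \<open>Volterra-composition operators\<close>

text \<open>On the convex disc the holomorphic integrand has a primitive G, and the integral along
  the segment from 0 is G z - G 0.\<close>

lemma Volterra_derivative:
  assumes \<phi>: "\<phi> holomorphic_on disc" "\<phi> ` disc \<subseteq> disc" and g: "g holomorphic_on disc" and f: "f holomorphic_on disc"
    and z: "z \<in> disc"
  shows "(Volterra \<phi> g f has_field_derivative f (\<phi> z) * deriv g z) (at z)"
proof -
  define k where "k t = f (\<phi> t) * deriv g t" for t
  have "k holomorphic_on disc"
    unfolding k_def using \<phi>(2)
    by (intro holomorphic_on_mult holomorphic_deriv g open_ball holomorphic_on_compose_gen[OF \<phi>(1) f, unfolded o_def])
  then obtain G where G: "\<And>x. x \<in> disc \<Longrightarrow> (G has_field_derivative k x) (at x within disc)"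
    using holomorphic_convex_primitive'[OF convex_ball open_ball] by metis
  have V: "Volterra \<phi> g f x = G x - G 0" if "x \<in> disc" for x
  proof -
    have "closed_segment 0 x \<subseteq> disc" using that by (intro closed_segment_subset) auto
    then have "(k has_contour_integral (G (pathfinish (linepath 0 x)) - G (pathstart (linepath 0 x)))) (linepath 0 x)"
      by (intro contour_integral_primitive[OF G]) auto
    then show ?thesis unfolding Volterra_def k_def[symmetric] using contour_integral_unique by fastforce
  qed
  have "(G has_field_derivative k z) (at z)" using G[OF z] z at_within_open[OF z open_ball] by simp
  then have "((\<lambda>x. G x - G 0) has_field_derivative k z) (at z)" by (auto intro!: derivative_eq_intros)
  then have "(Volterra \<phi> g f has_field_derivative k z) (at z)"
    by (rule has_field_derivative_transform_within_open[OF _ open_ball z]) (simp add: V)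
  then show ?thesis by (simp add: k_def)
qed

lemma Volterra_0: "Volterra \<phi> g f 0 = 0"
  by (simp add: Volterra_def)

lemma tendsto_to_boundary_iff:
  "(Q \<longlongrightarrow> (0::real)) to_boundary \<longleftrightarrow> (\<forall>e>0. \<exists>b<1. \<forall>z. b < cmod z \<and> cmod z < 1 \<longrightarrow> \<bar>Q z\<bar> < e)"
proof -
  have ev: "eventually P to_boundary \<longleftrightarrow> (\<exists>b<1. \<forall>z. b < cmod z \<and> cmod z < 1 \<longrightarrow> P z)" for P
  proof
    assume "eventually P to_boundary"
    then obtain R where R: "eventually R (at_left 1)" "\<And>z. R (cmod z) \<Longrightarrow> P z"
      unfolding eventually_filtercomap by auto
    obtain b where "b < 1" "\<And>y. b < y \<Longrightarrow> y < 1 \<Longrightarrow> R y" using R(1) unfolding eventually_at_left_field by auto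
    then show "\<exists>b<1. \<forall>z. b < cmod z \<and> cmod z < 1 \<longrightarrow> P z" using R(2) by blast
  next
    assume "\<exists>b<1. \<forall>z. b < cmod z \<and> cmod z < 1 \<longrightarrow> P z"
    then obtain b where b: "b < 1" "\<forall>z. b < cmod z \<and> cmod z < 1 \<longrightarrow> P z" by auto
    show "eventually P to_boundary"
      unfolding eventually_filtercomap eventually_at_left_field
      by (rule exI[of _ "\<lambda>y. b < y \<and> y < 1"]) (use b in auto)
  qed
  show ?thesis unfolding tendsto_iff ev by (simp add: dist_real_def)
qed

lemma bounded_image_le:
  fixes f :: "'a \<Rightarrow> real"
  assumes "bounded (f ` A)"
  shows "\<exists>B. \<forall>x\<in>A. f x \<le> B"
  using bounded_imp_bdd_above[OF assms] unfolding bdd_above_def by blast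

lemma Bloch_le_Bnorm:
  assumes "F \<in> Bloch psi" "z \<in> disc"
  shows "exp (-2 * psi z) * cmod (deriv F z) \<le> Bnorm psi F"
proof -
  have "exp (-2 * psi z) * cmod (deriv F z) \<le> (SUP z\<in>disc. exp (-2 * psi z) * cmod (deriv F z))"
    using assms by (intro cSUP_upper) (auto simp: Bloch_def)
  then show ?thesis by (simp add: Bnorm_def add_increasing)
qed

lemma Bnorm_le:
  assumes "\<And>z. z \<in> disc \<Longrightarrow> exp (-2 * psi z) * cmod (deriv F z) \<le> M" "cmod (F 0) \<le> N"
  shows "Bnorm psi F \<le> N + M"
proof -
  have "(SUP z\<in>disc. exp (-2 * psi z) * cmod (deriv F z)) \<le> M"
    by (rule cSUP_least) (use assms(1) in auto)
  then show ?thesis using assms(2) by (simp add: Bnorm_def add_mono)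
qed

lemma deriv_diff_disc:
  assumes "F holomorphic_on disc" "H holomorphic_on disc" "z \<in> disc"
  shows "deriv (\<lambda>z. F z - H z) z = deriv F z - deriv H z"
  using assms by (intro deriv_diff) (auto simp: holomorphic_on_imp_differentiable_at)

lemma Bloch_diff:
  assumes F: "F \<in> Bloch psi" and H: "H \<in> Bloch psi"
  shows "(\<lambda>z. F z - H z) \<in> Bloch psi"
proof -
  have hol: "F holomorphic_on disc" "H holomorphic_on disc" using F H by (auto simp: Bloch_def)
  have "exp (-2 * psi z) * cmod (deriv (\<lambda>z. F z - H z) z) \<le> Bnorm psi F + Bnorm psi H" if z: "z \<in> disc" for z
  proof -
    have "exp (-2 * psi z) * cmod (deriv F z - deriv H z) \<le> exp (-2 * psi z) * (cmod (deriv F z) + cmod (deriv H z))"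
      by (intro mult_left_mono norm_triangle_ineq4) simp
    then show ?thesis unfolding deriv_diff_disc[OF hol z]
      using Bloch_le_Bnorm[OF F z] Bloch_le_Bnorm[OF H z] by (simp only: distrib_left)
  qed
  then have "bdd_above ((\<lambda>z. exp (-2 * psi z) * cmod (deriv (\<lambda>z. F z - H z) z)) ` disc)"
    by (intro bdd_aboveI2)
  then show ?thesis using hol by (auto simp: Bloch_def intro!: holomorphic_intros)
qed

lemma Bloch_le_diff:
  assumes F: "F \<in> Bloch psi" and H: "H \<in> Bloch psi" and z: "z \<in> disc"
  shows "exp (-2 * psi z) * cmod (deriv F z) \<le> Bnorm psi (\<lambda>z. F z - H z) + exp (-2 * psi z) * cmod (deriv H z)"
proof -
  have hol: "F holomorphic_on disc" "H holomorphic_on disc" using F H by (auto simp: Bloch_def)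
  have "cmod (deriv F z) \<le> cmod (deriv F z - deriv H z) + cmod (deriv H z)" by norm
  then have "exp (-2 * psi z) * cmod (deriv F z) \<le> exp (-2 * psi z) * (cmod (deriv F z - deriv H z) + cmod (deriv H z))"
    by (rule mult_left_mono) simp
  moreover have "exp (-2 * psi z) * cmod (deriv F z - deriv H z) \<le> Bnorm psi (\<lambda>z. F z - H z)"
    using Bloch_le_Bnorm[OF Bloch_diff[OF F H] z] unfolding deriv_diff_disc[OF hol z] .
  ultimately show ?thesis by (simp only: distrib_left)
qed

lemma AL2_scale:
  assumes f: "f \<in> AL2 psi"
  shows "(\<lambda>z. of_real c * f z) \<in> AL2 psi" "L2norm psi (\<lambda>z. of_real c * f z) = \<bar>c\<bar> * L2norm psi f"
proof -
  have e: "(cmod (of_real c * f z))\<^sup>2 * exp (-2 * psi z) = c\<^sup>2 *\<^sub>R ((cmod (f z))\<^sup>2 * exp (-2 * psi z))" for z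
    by (simp add: norm_mult power_mult_distrib)
  have i: "(\<lambda>z. (cmod (f z))\<^sup>2 * exp (-2 * psi z)) integrable_on disc" using f by (simp add: AL2_def)
  show "(\<lambda>z. of_real c * f z) \<in> AL2 psi"
    using f integrable_cmul[OF i, of "c\<^sup>2"] unfolding AL2_def mem_Collect_eq e by (auto intro!: holomorphic_intros)
  show "L2norm psi (\<lambda>z. of_real c * f z) = \<bar>c\<bar> * L2norm psi f"
    unfolding L2norm_def e integral_cmul by (simp add: real_sqrt_mult real_sqrt_divide)
qed

text \<open>\<open>laplacian\<close> iterates one-variable derivatives along horizontal and vertical
  lines, so the second derivative is evaluated on the directions 1 and \<i> by the chain rule along
  these lines.\<close>

lemma C2_on_data:
  assumes "C2_on disc psi"
  obtains px py pxx pxy pyx pyy where "C2_data disc psi px py pxx pxy pyx pyy"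
    "\<And>z. z \<in> disc \<Longrightarrow> laplacian psi z = pxx z + pyy z"
proof -
  obtain f1 :: "complex \<Rightarrow> (complex \<Rightarrow>\<^sub>L real)" and f2 :: "complex \<Rightarrow> (complex \<Rightarrow>\<^sub>L (complex \<Rightarrow>\<^sub>L real))"
    where ff: "(\<forall>z\<in>disc. (psi has_derivative blinfun_apply (f1 z)) (at z)) \<and>
      (\<forall>z\<in>disc. (f1 has_derivative blinfun_apply (f2 z)) (at z)) \<and> continuous_on disc f2"
    using assms unfolding C2_on_def by (elim exE)
  note f = ff[THEN conjunct1, THEN bspec] ff[THEN conjunct2, THEN conjunct1, THEN bspec] ff[THEN conjunct2, THEN conjunct2]
  have split: "L t = Re t *\<^sub>R L 1 + Im t *\<^sub>R L \<i>" if "linear L" for L :: "complex \<Rightarrow> 'x::real_vector" and t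
  proof -
    have "t = Re t *\<^sub>R 1 + Im t *\<^sub>R \<i>" by (simp add: complex_eq_iff)
    then have "L t = L (Re t *\<^sub>R 1 + Im t *\<^sub>R \<i>)" by simp
    then show ?thesis using that by (simp add: linear_add linear_scale)
  qed
  have lin: "linear (blinfun_apply A)" for A :: "complex \<Rightarrow>\<^sub>L 'x::real_normed_vector"
    by (rule bounded_linear.linear[OF blinfun.bounded_linear_right])
  have d1: "pderivs psi (f1 z 1) (f1 z \<i>) z" if "z \<in> disc" for z
    using f(1)[OF that] by (rule has_derivative_eq_rhs) (rule ext, rule split[OF lin])
  have d2: "pderivs (\<lambda>z. f1 z v) (f2 z 1 v) (f2 z \<i> v) z" if "z \<in> disc" for z v
  proof -
    have "((\<lambda>z. f1 z v) has_derivative (\<lambda>t. f2 z t v)) (at z)"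
      by (rule bounded_linear.has_derivative[OF blinfun.bounded_linear_left f(2)[OF that]])
    then show ?thesis
    proof (rule has_derivative_eq_rhs, intro ext)
      fix t
      show "f2 z t v = Re t *\<^sub>R f2 z 1 v + Im t *\<^sub>R f2 z \<i> v"
        using split[OF lin, of "f2 z" t] by (simp add: blinfun.add_left blinfun.scaleR_left)
    qed
  qed
  have c: "continuous_on disc (\<lambda>z. f2 z u v)" for u v
    by (intro continuous_intros f(3))
  show ?thesis
  proof (rule that)
    show "C2_data disc psi (\<lambda>z. f1 z 1) (\<lambda>z. f1 z \<i>) (\<lambda>z. f2 z 1 1) (\<lambda>z. f2 z \<i> 1) (\<lambda>z. f2 z 1 \<i>) (\<lambda>z. f2 z \<i> \<i>)"
      unfolding C2_data_def by (intro conjI ballI d1 d2 c)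
    fix z assume z: "z \<in> disc"
    have line: "deriv (\<lambda>t. deriv (\<lambda>s. psi (P s)) t) t0 = f2 z v v"
      if P: "\<And>s. P s = z + of_real (s - t0) * v" for P :: "real \<Rightarrow> complex" and t0 v
    proof -
      have dP: "((\<lambda>s. h (P s)) has_real_derivative (Re v * hx + Im v * hy)) (at t)"
        if "pderivs h hx hy (P t)" for h :: "complex \<Rightarrow> real" and hx hy t
      proof -
        have "(P has_derivative (\<lambda>s. of_real s * v)) (at t)" unfolding P[abs_def] by (auto intro!: derivative_eq_intros)
        from has_derivative_compose[OF this that] show ?thesis unfolding has_field_derivative_def
          by (rule has_derivative_eq_rhs) (auto simp: fun_eq_iff algebra_simps)
      qed
      have P0: "P t0 = z" by (simp add: P)
      have cP: "continuous_on UNIV P" unfolding P[abs_def] by (intro continuous_intros)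
      \<comment> \<open>The outer \<open>deriv\<close> needs the inner derivative on a neighbourhood
        of t0, which the open set of parameters with P t in the disc supplies.\<close>
      have op: "open (P -` disc)" using cP continuous_on_open_vimage[OF open_UNIV] by auto
      have t0: "t0 \<in> P -` disc" using P0 z by simp
      have e: "deriv (\<lambda>s. psi (P s)) t = f1 (P t) v" if "t \<in> P -` disc" for t
        using DERIV_imp_deriv[OF dP[OF d1]] that split[OF lin, of "f1 (P t)" v] by simp
      have "((\<lambda>t. f1 (P t) v) has_real_derivative f2 z v v) (at t0)"
        using dP[OF d2[of "P t0" v]] P0 z split[OF lin, of "f2 z" v] by (simp add: blinfun.add_left blinfun.scaleR_left)
      then have "((\<lambda>t. deriv (\<lambda>s. psi (P s)) t) has_real_derivative f2 z v v) (at t0)"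
        by (rule has_field_derivative_transform_within_open[OF _ op t0]) (simp add: e)
      then show ?thesis by (rule DERIV_imp_deriv)
    qed
    show "laplacian psi z = f2 z 1 1 + f2 z \<i> \<i>"
      unfolding laplacian_def
      using line[of "\<lambda>s. Complex s (Im z)" "Re z" 1] line[of "\<lambda>s. Complex (Re z) s" "Im z" \<i>]
      by (simp add: complex_eq_iff)
  qed
qed

context lipschitz_weight
begin

lemma tau_continuous: "continuous_on disc \<tau>"
proof (rule continuous_on_iff[THEN iffD2], intro ballI allI impI)
  fix z e assume z: "z \<in> disc" and e: "(e::real) > 0"
  show "\<exists>d>0. \<forall>x\<in>disc. dist x z < d \<longrightarrow> dist (\<tau> x) (\<tau> z) < e"
  proof (intro exI[of _ "e / C1"] conjI ballI impI)
    show "e / C1 > 0" using e C1 by simp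
    fix x assume x: "x \<in> disc" "dist x z < e / C1"
    have "dist (\<tau> x) (\<tau> z) \<le> C1 * dist x z" using lip[OF x(1) z] by (simp add: dist_norm)
    also have "\<dots> < e" using x(2) C1 by (simp add: field_simps)
    finally show "dist (\<tau> x) (\<tau> z) < e" .
  qed
qed

context
  fixes \<phi> g :: "complex \<Rightarrow> complex"
  assumes \<phi>: "\<phi> holomorphic_on disc" "\<phi> ` disc \<subseteq> disc" and g: "g holomorphic_on disc"
begin

text \<open>The expression of the theorem with 1 / \<tau> for the square root of the Laplacian,
  grouped so that the middle factor is the size of point evaluation at \<phi> z.\<close>

definition symbol :: "complex \<Rightarrow> real" where
  "symbol z = exp (- 2 * \<psi> z) * (exp (\<psi> (\<phi> z)) / \<tau> (\<phi> z)) * cmod (deriv g z)"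

lemma \<phi>_disc: "z \<in> disc \<Longrightarrow> \<phi> z \<in> disc"
  using \<phi>(2) by blast

lemma symbol_nonneg: "z \<in> disc \<Longrightarrow> symbol z \<ge> 0"
  unfolding symbol_def using tau_pos[OF \<phi>_disc] by (simp add: less_imp_le)

lemma Volterra_holomorphic:
  assumes "f holomorphic_on disc"
  shows "Volterra \<phi> g f holomorphic_on disc" "z \<in> disc \<Longrightarrow> deriv (Volterra \<phi> g f) z = f (\<phi> z) * deriv g z"
proof -
  show "Volterra \<phi> g f holomorphic_on disc"
    unfolding holomorphic_on_open[OF open_ball] by (intro ballI exI, rule Volterra_derivative[OF \<phi> g assms])
  show "deriv (Volterra \<phi> g f) z = f (\<phi> z) * deriv g z" if "z \<in> disc"
    by (rule DERIV_imp_deriv[OF Volterra_derivative[OF \<phi> g assms that]])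
qed

lemma AL2_holomorphic: "f \<in> AL2 \<psi> \<Longrightarrow> f holomorphic_on disc"
  by (simp add: AL2_def)

lemma L2norm_nonneg: "f \<in> AL2 \<psi> \<Longrightarrow> L2norm \<psi> f \<ge> 0"
  unfolding L2norm_def AL2_def by (auto intro!: mult_nonneg_nonneg integral_nonneg simp del: times_divide_eq_left)

text \<open>If V is unbounded, unit vectors F n have images of norm above n, whereas a subsequence
  of the images stays within distance 1 of a fixed h.\<close>

lemma compact_imp_bounded_operator:
  assumes comp: "compact_AL2_B0 \<psi> (Volterra \<phi> g)"
  shows "bounded_AL2_B0 \<psi> (Volterra \<phi> g)"
proof (rule ccontr)
  let ?V = "Volterra \<phi> g"
  have B0: "?V f \<in> Bloch0 \<psi>" if "f \<in> AL2 \<psi>" for f using comp that by (simp add: compact_AL2_B0_def)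
  have B: "?V f \<in> Bloch \<psi>" if "f \<in> AL2 \<psi>" for f using B0[OF that] by (simp add: Bloch0_def)
  assume "\<not> bounded_AL2_B0 \<psi> ?V"
  then have "\<exists>f\<in>AL2 \<psi>. \<not> Bnorm \<psi> (?V f) \<le> real n * L2norm \<psi> f" for n :: nat
    using B0 unfolding bounded_AL2_B0_def by blast
  then obtain f where f: "\<And>n. f n \<in> AL2 \<psi>" "\<And>n::nat. Bnorm \<psi> (?V (f n)) > real n * L2norm \<psi> (f n)"
    by (metis not_le)
  \<comment> \<open>A function of norm 0 vanishes on the disc by point evaluation, so its image has
    norm at most 0, against the choice of f n.\<close>
  have L: "L2norm \<psi> (f n) > 0" for n
  proof (rule ccontr)
    assume "\<not> L2norm \<psi> (f n) > 0"
    then have L0: "L2norm \<psi> (f n) = 0" using L2norm_nonneg[OF f(1)[of n]] by simp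
    have "f n w = 0" if "w \<in> disc" for w using AL2_point_evaluation[OF f(1)[of n] that] L0 by simp
    then have "Bnorm \<psi> (?V (f n)) \<le> 0 + 0"
      using Volterra_holomorphic(2)[OF AL2_holomorphic[OF f(1)[of n]]] \<phi>_disc by (intro Bnorm_le) (auto simp: Volterra_0)
    then show False using f(2)[of n] L0 by simp
  qed
  define F where "F n z = of_real (1 / L2norm \<psi> (f n)) * f n z" for n z
  have F: "F n \<in> AL2 \<psi>" "L2norm \<psi> (F n) = 1" for n
    using AL2_scale[OF f(1)[of n], of "1 / L2norm \<psi> (f n)"] L[of n] by (simp_all add: F_def[abs_def])
  have big: "Bnorm \<psi> (?V (F n)) > real n" for n
  proof -
    have "Bnorm \<psi> (?V (f n)) \<le> 0 + L2norm \<psi> (f n) * Bnorm \<psi> (?V (F n))"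
    proof (rule Bnorm_le)
      fix z assume z: "z \<in> disc"
      have "f n (\<phi> z) = of_real (L2norm \<psi> (f n)) * F n (\<phi> z)" using L[of n] by (simp add: F_def)
      then have "exp (-2 * \<psi> z) * cmod (deriv (?V (f n)) z) = L2norm \<psi> (f n) * (exp (-2 * \<psi> z) * cmod (deriv (?V (F n)) z))"
        unfolding Volterra_holomorphic(2)[OF AL2_holomorphic[OF f(1)] z] Volterra_holomorphic(2)[OF AL2_holomorphic[OF F(1)] z]
        using L[of n] by (simp add: norm_mult)
      also have "\<dots> \<le> L2norm \<psi> (f n) * Bnorm \<psi> (?V (F n))"
        using Bloch_le_Bnorm[OF B[OF F(1)[of n]] z] L[of n] by (intro mult_left_mono) auto
      finally show "exp (-2 * \<psi> z) * cmod (deriv (?V (f n)) z) \<le> L2norm \<psi> (f n) * Bnorm \<psi> (?V (F n))" .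
    qed (simp add: Volterra_0)
    then have "L2norm \<psi> (f n) * real n < L2norm \<psi> (f n) * Bnorm \<psi> (?V (F n))" using f(2)[of n] by (simp add: mult.commute)
    then show ?thesis using L[of n] by simp
  qed
  have "\<forall>n. F n \<in> AL2 \<psi> \<and> L2norm \<psi> (F n) \<le> 1" using F by simp
  then obtain r h where r: "strict_mono (r :: nat \<Rightarrow> nat)" and h: "h \<in> Bloch0 \<psi>"
    and lim: "(\<lambda>n. Bnorm \<psi> (\<lambda>z. ?V (F (r n)) z - h z)) \<longlonglongrightarrow> 0"
    using comp[unfolded compact_AL2_B0_def, THEN conjunct2, THEN spec[of _ F]] by blast
  have hB: "h \<in> Bloch \<psi>" using h by (simp add: Bloch0_def)
  have bd: "Bnorm \<psi> (?V (F n)) \<le> Bnorm \<psi> (\<lambda>z. ?V (F n) z - h z) + Bnorm \<psi> h" for n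
  proof -
    have "Bnorm \<psi> (?V (F n)) \<le> 0 + (Bnorm \<psi> (\<lambda>z. ?V (F n) z - h z) + Bnorm \<psi> h)"
    proof (rule Bnorm_le)
      fix z assume z: "z \<in> disc"
      show "exp (-2 * \<psi> z) * cmod (deriv (?V (F n)) z) \<le> Bnorm \<psi> (\<lambda>z. ?V (F n) z - h z) + Bnorm \<psi> h"
        using Bloch_le_diff[OF B[OF F(1)] hB z] Bloch_le_Bnorm[OF hB z] by (rule order_trans[OF _ add_left_mono])
    qed (simp add: Volterra_0)
    then show ?thesis by simp
  qed
  obtain N where N: "\<And>n. n \<ge> N \<Longrightarrow> Bnorm \<psi> (\<lambda>z. ?V (F (r n)) z - h z) < 1"
    using order_tendstoD(2)[OF lim, of 1] unfolding eventually_sequentially by auto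
  obtain M :: nat where M: "1 + Bnorm \<psi> h < real M" using reals_Archimedean2 by blast
  define n where "n = max N M"
  have "real M \<le> real (r n)" using seq_suble[OF r, of n] by (simp add: n_def)
  also have "\<dots> < Bnorm \<psi> (?V (F (r n)))" by (rule big)
  also have "\<dots> \<le> Bnorm \<psi> (\<lambda>z. ?V (F (r n)) z - h z) + Bnorm \<psi> h" by (rule bd)
  also have "\<dots> < 1 + Bnorm \<psi> h" using N[of n] by (simp add: n_def)
  finally show False using M by simp
qed

text \<open>Peak functions at \<open>\<phi> z\<^sub>n\<close> with \<open>|z\<^sub>n| \<longrightarrow> 1\<close> detect the size of the symbol.\<close>

lemma compact_imp_symbol_vanishes:
  assumes comp: "compact_AL2_B0 \<psi> (Volterra \<phi> g)"
  shows "\<forall>e>0. \<exists>b<1. \<forall>z. b < cmod z \<and> cmod z < 1 \<longrightarrow> symbol z < e"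
proof (rule ccontr)
  let ?V = "Volterra \<phi> g"
  have B: "?V f \<in> Bloch \<psi>" if "f \<in> AL2 \<psi>" for f using comp that by (simp add: compact_AL2_B0_def Bloch0_def)
  assume "\<not> ?thesis"
  then obtain e where e: "e > 0" and no_b: "\<not> (\<exists>b<1. \<forall>z. b < cmod z \<and> cmod z < 1 \<longrightarrow> symbol z < e)"
    by blast
  have bad: "\<exists>z. b < cmod z \<and> cmod z < 1 \<and> e \<le> symbol z" if "b < 1" for b
  proof (rule ccontr)
    assume "\<not> ?thesis"
    then have "\<forall>z. b < cmod z \<and> cmod z < 1 \<longrightarrow> symbol z < e" by (simp add: not_le)
    with no_b that show False by blast
  qed
  have "\<exists>z. 1 - 1 / (real n + 1) < cmod z \<and> cmod z < 1 \<and> e \<le> symbol z" for n :: nat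
    by (rule bad) simp
  then obtain z where z: "\<And>n::nat. 1 - 1 / (real n + 1) < cmod (z n)" "\<And>n. cmod (z n) < 1" "\<And>n. e \<le> symbol (z n)"
    by metis
  have zd: "z n \<in> disc" for n using z(2)[of n] by simp
  define w where "w n = \<phi> (z n)" for n
  have wd: "w n \<in> disc" for n using \<phi>_disc[OF zd] by (simp add: w_def)
  define P where "P n f \<longleftrightarrow> f \<in> AL2 \<psi> \<and> exp (\<psi> (w n) - 1) \<le> cmod (f (w n)) \<and>
    pi * (L2norm \<psi> f)\<^sup>2 \<le> peak_const * (\<tau> (w n))\<^sup>2" for n f
  have "\<exists>f. P n f" for n
  proof (rule peak_function[OF wd[of n]])
    fix f assume "f \<in> AL2 \<psi>" "exp (\<psi> (w n) - 1) \<le> cmod (f (w n))" "pi * (L2norm \<psi> f)\<^sup>2 \<le> peak_const * (\<tau> (w n))\<^sup>2"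
    then have "P n f" unfolding P_def by (intro conjI)
    then show "\<exists>f. P n f" by blast
  qed
  then obtain f where fP: "\<And>n. P n (f n)" by metis
  have f: "f n \<in> AL2 \<psi>" "exp (\<psi> (w n) - 1) \<le> cmod (f n (w n))" "pi * (L2norm \<psi> (f n))\<^sup>2 \<le> peak_const * (\<tau> (w n))\<^sup>2" for n
    using fP[of n] unfolding P_def by simp_all
  \<comment> \<open>The added 1 makes K positive whatever the value of
    \<open>peak_const\<close>.\<close>
  define K where "K = sqrt (peak_const + 1)"
  have K: "K > 0" "K\<^sup>2 = peak_const + 1" using peak_const_nonneg by (simp_all add: K_def)
  have tw: "\<tau> (w n) > 0" for n by (rule tau_pos[OF wd])
  have Lf: "L2norm \<psi> (f n) \<le> K * \<tau> (w n)" for n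
  proof (rule power2_le_imp_le)
    have "1 * (L2norm \<psi> (f n))\<^sup>2 \<le> pi * (L2norm \<psi> (f n))\<^sup>2" using pi_ge_two by (intro mult_right_mono) auto
    also have "\<dots> \<le> peak_const * (\<tau> (w n))\<^sup>2" by (rule f(3))
    also have "\<dots> \<le> K\<^sup>2 * (\<tau> (w n))\<^sup>2" unfolding K(2) by (intro mult_right_mono) auto
    finally show "(L2norm \<psi> (f n))\<^sup>2 \<le> (K * \<tau> (w n))\<^sup>2" by (simp add: power_mult_distrib)
    show "0 \<le> K * \<tau> (w n)" using K(1) tw[of n] by simp
  qed
  define F where "F n x = of_real (1 / (K * \<tau> (w n))) * f n x" for n x
  have F: "F n \<in> AL2 \<psi>" "L2norm \<psi> (F n) \<le> 1" for n
  proof -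
    have p: "K * \<tau> (w n) > 0" using K(1) tw[of n] by simp
    show "F n \<in> AL2 \<psi>" unfolding F_def[abs_def] by (rule AL2_scale(1)[OF f(1)])
    have "L2norm \<psi> (F n) = 1 / (K * \<tau> (w n)) * L2norm \<psi> (f n)"
      using AL2_scale(2)[OF f(1)[of n], of "1 / (K * \<tau> (w n))"] p by (simp add: F_def[abs_def])
    then show "L2norm \<psi> (F n) \<le> 1" using Lf[of n] p by simp
  qed
  \<comment> \<open>exp (-1) is the loss in the lower bound of the peak functions at w n, and K
    their normalisation.\<close>
  define c where "c = e * exp (-1) / K"
  have c: "c > 0" using e K(1) by (simp add: c_def)
  have low: "c \<le> exp (-2 * \<psi> (z n)) * cmod (deriv (?V (F n)) (z n))" for n
  proof -
    have "c \<le> symbol (z n) * exp (-1) / K"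
      unfolding c_def using z(3)[of n] K(1) by (intro divide_right_mono mult_right_mono) auto
    also have "\<dots> = exp (-2 * \<psi> (z n)) * (exp (\<psi> (w n) - 1) / (K * \<tau> (w n)) * cmod (deriv g (z n)))"
      by (simp add: symbol_def w_def exp_diff exp_minus field_simps)
    also have "\<dots> \<le> exp (-2 * \<psi> (z n)) * (cmod (f n (w n)) / (K * \<tau> (w n)) * cmod (deriv g (z n)))"
      using f(2)[of n] K(1) tw[of n] by (intro mult_left_mono mult_right_mono divide_right_mono) auto
    also have "cmod (f n (w n)) / (K * \<tau> (w n)) = cmod (F n (w n))"
      using K(1) tw[of n] by (simp add: F_def norm_mult norm_divide)
    finally show ?thesis unfolding Volterra_holomorphic(2)[OF AL2_holomorphic[OF F(1)] zd] by (simp add: norm_mult w_def)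
  qed
  have "\<forall>n. F n \<in> AL2 \<psi> \<and> L2norm \<psi> (F n) \<le> 1" using F by simp
  then obtain r h where r: "strict_mono (r :: nat \<Rightarrow> nat)" and h: "h \<in> Bloch0 \<psi>"
    and lim: "(\<lambda>n. Bnorm \<psi> (\<lambda>z. ?V (F (r n)) z - h z)) \<longlonglongrightarrow> 0"
    using comp[unfolded compact_AL2_B0_def, THEN conjunct2, THEN spec[of _ F]] by blast
  have hB: "h \<in> Bloch \<psi>" using h by (simp add: Bloch0_def)
  \<comment> \<open>At z (r n) the image has weighted derivative at least c. For large n both its
    distance to h and the weighted derivative of h near the boundary are below c/2, a
    contradiction.\<close>
  obtain N where N: "\<And>n. n \<ge> N \<Longrightarrow> Bnorm \<psi> (\<lambda>z. ?V (F (r n)) z - h z) < c / 2"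
    using order_tendstoD(2)[OF lim, of "c / 2"] c unfolding eventually_sequentially by auto
  have "((\<lambda>z. exp (-2 * \<psi> z) * cmod (deriv h z)) \<longlongrightarrow> 0) to_boundary" using h by (simp add: Bloch0_def)
  from this[unfolded tendsto_to_boundary_iff, rule_format, OF half_gt_zero[OF c]]
  obtain b where b: "b < 1" "\<And>x. b < cmod x \<Longrightarrow> cmod x < 1 \<Longrightarrow> \<bar>exp (-2 * \<psi> x) * cmod (deriv h x)\<bar> < c / 2" by blast
  obtain M :: nat where M: "1 / (1 - b) < real M" using reals_Archimedean2 by blast
  define n where "n = max N M"
  have "real M \<le> real (r n)" using seq_suble[OF r, of n] by (simp add: n_def)
  then have "1 / (1 - b) < real (r n) + 1" using M by linarith
  then have "1 / (real (r n) + 1) < 1 - b" using b(1) by (simp add: field_simps)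
  then have "b < cmod (z (r n))" using z(1)[of "r n"] by linarith
  from b(2)[OF this z(2)] have hs: "exp (-2 * \<psi> (z (r n))) * cmod (deriv h (z (r n))) < c / 2" by simp
  have "c \<le> Bnorm \<psi> (\<lambda>z. ?V (F (r n)) z - h z) + exp (-2 * \<psi> (z (r n))) * cmod (deriv h (z (r n)))"
    using low[of "r n"] Bloch_le_diff[OF B[OF F(1)] hB zd] by (rule order_trans)
  also have "\<dots> < c / 2 + c / 2" using N[of n] hs by (intro add_strict_mono) (simp_all add: n_def)
  finally show False by simp
qed

text \<open>Point evaluation bounds make the unit ball a normal family; let f be a locally uniform
  limit. Where |z| <= b, the points \<phi> z lie in a compact set and uniform convergence applies.
  Where |z| > b, the pointwise bound m combined with the small symbol controls the difference
  without any convergence.\<close>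

lemma symbol_vanishes_imp_compact:
  assumes B0: "\<And>f. f \<in> AL2 \<psi> \<Longrightarrow> Volterra \<phi> g f \<in> Bloch0 \<psi>"
    and van: "\<And>e. e > 0 \<Longrightarrow> \<exists>b<1. \<forall>z. b < cmod z \<and> cmod z < 1 \<longrightarrow> symbol z < e"
  shows "compact_AL2_B0 \<psi> (Volterra \<phi> g)"
  unfolding compact_AL2_B0_def
proof (intro conjI ballI B0 allI impI)
  let ?V = "Volterra \<phi> g"
  fix F :: "nat \<Rightarrow> complex \<Rightarrow> complex" assume F: "\<forall>n. F n \<in> AL2 \<psi> \<and> L2norm \<psi> (F n) \<le> 1"
  define m where "m w = eval_const * (exp (\<psi> w) / \<tau> w)" for w
  have m0: "m w > 0" if "w \<in> disc" for w using eval_const_pos tau_pos[OF that] by (simp add: m_def)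
  have mF: "cmod (F n w) \<le> m w" if "w \<in> disc" for n w
  proof -
    have "cmod (F n w) \<le> m w * L2norm \<psi> (F n)" using AL2_point_evaluation[OF _ that, of "F n"] F by (simp add: m_def)
    also have "\<dots> \<le> m w * 1" using F m0[OF that] by (intro mult_left_mono) auto
    finally show ?thesis by simp
  qed
  have Fh: "F n holomorphic_on disc" for n using F AL2_holomorphic by blast
  have cm: "continuous_on disc m" unfolding m_def
    by (intro continuous_intros psi_cont tau_continuous ballI) (metis tau_pos less_irrefl)
  have bdm: "\<exists>B. \<forall>w\<in>K. m w \<le> B" if K: "compact K" "K \<subseteq> disc" for K
  proof -
    have "bounded (m ` K)"
      using compact_continuous_image[OF continuous_on_subset[OF cm K(2)] K(1)] by (rule compact_imp_bounded)
    then show ?thesis by (rule bounded_image_le)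
  qed
  obtain f r where f: "f holomorphic_on disc" and r: "strict_mono (r :: nat \<Rightarrow> nat)"
     and pt: "\<And>x. x \<in> disc \<Longrightarrow> (\<lambda>n. F (r n) x) \<longlonglongrightarrow> f x"
     and ul: "\<And>K. compact K \<Longrightarrow> K \<subseteq> disc \<Longrightarrow> uniform_limit K (F \<circ> r) f sequentially"
  proof (rule Montel[OF open_ball, of "range F" 0 1 F])
    show "h holomorphic_on disc" if "h \<in> range F" for h using that Fh by blast
    show "\<exists>B. \<forall>h\<in>range F. \<forall>z\<in>K. cmod (h z) \<le> B" if K: "compact K" "K \<subseteq> disc" for K
    proof -
      obtain B where B: "\<forall>w\<in>K. m w \<le> B" using bdm[OF K] by blast
      have "cmod (F n z) \<le> B" if "z \<in> K" for n z
        by (rule order_trans[OF mF]) (use B K(2) that in auto)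
      then show ?thesis by (intro exI[of _ B]) auto
    qed
    show "range F \<subseteq> range F" by simp
  qed (assumption | rule that)+
  have mf: "cmod (f w) \<le> m w" if "w \<in> disc" for w
    by (rule LIMSEQ_le_const2[OF tendsto_norm[OF pt[OF that]]]) (use mF[OF that] in blast)
  note dV = Volterra_holomorphic(2)[OF f]
  have msym: "exp (-2 * \<psi> z) * (m (\<phi> z) * cmod (deriv g z)) = eval_const * symbol z" for z
    by (simp add: m_def symbol_def)
  define q where "q z = exp (-2 * \<psi> z) * cmod (deriv g z)" for z
  have cq: "continuous_on disc q" unfolding q_def
    by (intro continuous_intros psi_cont holomorphic_on_imp_continuous_on holomorphic_deriv g open_ball)
  have fle: "exp (-2 * \<psi> z) * cmod (deriv (?V f) z) \<le> eval_const * symbol z" if z: "z \<in> disc" for z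
  proof -
    have "cmod (f (\<phi> z)) * cmod (deriv g z) \<le> m (\<phi> z) * cmod (deriv g z)" using mf[OF \<phi>_disc[OF z]] by (intro mult_right_mono) auto
    then show ?thesis unfolding dV[OF z] norm_mult msym[symmetric] by (intro mult_left_mono) auto
  qed
  \<comment> \<open>The limit f enters through its pointwise bound \<open>mf\<close>, so the decay
    of the derivative of \<open>?V f\<close> is read off from the symbol instead of from B0.\<close>
  have "?V f \<in> Bloch0 \<psi>"
  proof -
    obtain b where b: "b < 1" "\<And>z. b < cmod z \<Longrightarrow> cmod z < 1 \<Longrightarrow> symbol z < 1" using van[of 1] by auto
    have "continuous_on (cball 0 b) (\<lambda>z. eval_const * symbol z)"
    proof -
      have sub: "cball (0::complex) b \<subseteq> disc" using b(1) by auto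
      have "continuous_on disc (\<lambda>z. m (\<phi> z))"
        using \<phi> by (intro continuous_on_compose2[OF cm holomorphic_on_imp_continuous_on]) auto
      then have "continuous_on disc (\<lambda>z. q z * m (\<phi> z))" by (intro continuous_intros cq)
      then have "continuous_on disc (\<lambda>z. eval_const * symbol z)" unfolding msym[symmetric] q_def by (simp add: mult_ac)
      then show ?thesis using sub continuous_on_subset by blast
    qed
    then have "bounded ((\<lambda>z. eval_const * symbol z) ` cball 0 b)"
      using compact_continuous_image compact_cball compact_imp_bounded by blast
    then obtain B where "\<forall>z\<in>cball 0 b. eval_const * symbol z \<le> B" using bounded_image_le by blast
    then have B: "eval_const * symbol z \<le> B" if "cmod z \<le> b" for z using that by simp
    have "exp (-2 * \<psi> z) * cmod (deriv (?V f) z) \<le> max B eval_const" if z: "z \<in> disc" for z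
    proof (cases "cmod z \<le> b")
      case True then show ?thesis using fle[OF z] B[OF True] by simp
    next
      case False
      have "eval_const * symbol z \<le> eval_const * 1"
        using b(2)[of z] False z eval_const_pos by (intro mult_left_mono) auto
      then show ?thesis using fle[OF z] by simp
    qed
    then have "?V f \<in> Bloch \<psi>" using Volterra_holomorphic(1)[OF f] by (auto simp: Bloch_def intro!: bdd_aboveI2)
    moreover have "((\<lambda>z. exp (-2 * \<psi> z) * cmod (deriv (?V f) z)) \<longlongrightarrow> 0) to_boundary"
      unfolding tendsto_to_boundary_iff
    proof (intro allI impI)
      fix e :: real assume "e > 0"
      then have "e / eval_const > 0" using eval_const_pos by simp
      then obtain b where b: "b < 1" "\<And>z. b < cmod z \<Longrightarrow> cmod z < 1 \<Longrightarrow> symbol z < e / eval_const" using van by blast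
      show "\<exists>b<1. \<forall>z. b < cmod z \<and> cmod z < 1 \<longrightarrow> \<bar>exp (-2 * \<psi> z) * cmod (deriv (?V f) z)\<bar> < e"
      proof (intro exI[of _ b] conjI allI impI)
        fix z assume z: "b < cmod z \<and> cmod z < 1"
        have "eval_const * symbol z < e" using b(2)[of z] z eval_const_pos by (simp add: field_simps)
        then show "\<bar>exp (-2 * \<psi> z) * cmod (deriv (?V f) z)\<bar> < e" using fle[of z] z by simp
      qed (rule b)
    qed
    ultimately show ?thesis by (simp add: Bloch0_def)
  qed
  moreover have "(\<lambda>n. Bnorm \<psi> (\<lambda>z. ?V (F (r n)) z - ?V f z)) \<longlonglongrightarrow> 0"
  proof (rule tendstoI)
    fix e :: real assume e: "e > 0"
    \<comment> \<open>The difference F (r n) - f is bounded by 2 m, so near the boundary the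
      weighted derivative is at most 2 * \<open>eval_const\<close> * symbol, which is then at most
      e/2.\<close>
    have "e / (4 * eval_const) > 0" using e eval_const_pos by simp
    then obtain b where b: "b < 1" "\<And>z. b < cmod z \<Longrightarrow> cmod z < 1 \<Longrightarrow> symbol z < e / (4 * eval_const)" using van by blast
    have sub: "cball (0::complex) b \<subseteq> disc" using b(1) by auto
    have "bounded (q ` cball 0 b)"
      using compact_continuous_image[OF continuous_on_subset[OF cq sub] compact_cball] by (rule compact_imp_bounded)
    then obtain Q where "\<forall>z\<in>cball 0 b. q z \<le> Q" using bounded_image_le by blast
    then have Q: "q z \<le> Q" if "cmod z \<le> b" for z using that by simp
    \<comment> \<open>The absolute value and the added 1 guard against Q <= 0, which can occur when
      \<open>cball 0 b\<close> is empty.\<close>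
    define e' where "e' = e / (2 * (\<bar>Q\<bar> + 1))"
    have e': "e' > 0" "\<bar>Q\<bar> * e' \<le> e / 2" using e by (auto simp: e'_def field_simps)
    have K: "compact (\<phi> ` cball 0 b)" "\<phi> ` cball 0 b \<subseteq> disc"
      using compact_continuous_image[OF continuous_on_subset[OF holomorphic_on_imp_continuous_on[OF \<phi>(1)] sub] compact_cball]
        \<phi>_disc sub by auto
    from uniform_limitD[OF ul[OF K] e'(1)]
    show "\<forall>\<^sub>F n in sequentially. dist (Bnorm \<psi> (\<lambda>z. ?V (F (r n)) z - ?V f z)) 0 < e"
    proof (rule eventually_mono)
      fix n assume n: "\<forall>x\<in>\<phi> ` cball 0 b. dist ((F \<circ> r) n x) (f x) < e'"
      have der: "deriv (\<lambda>z. ?V (F (r n)) z - ?V f z) z = (F (r n) (\<phi> z) - f (\<phi> z)) * deriv g z" if z: "z \<in> disc" for z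
        using deriv_diff_disc[OF Volterra_holomorphic(1)[OF Fh] Volterra_holomorphic(1)[OF f] z]
          Volterra_holomorphic(2)[OF Fh z] dV[OF z] by (simp add: algebra_simps)
      have le: "exp (-2 * \<psi> z) * cmod (deriv (\<lambda>z. ?V (F (r n)) z - ?V f z) z) \<le> e / 2" if z: "z \<in> disc" for z
      proof (cases "cmod z \<le> b")
        case True
        have "cmod (F (r n) (\<phi> z) - f (\<phi> z)) \<le> e'" using n True by (force simp: dist_norm)
        moreover have "q z \<le> \<bar>Q\<bar>" using Q[OF True] by simp
        ultimately have "q z * cmod (F (r n) (\<phi> z) - f (\<phi> z)) \<le> \<bar>Q\<bar> * e'"
          by (intro mult_mono) auto
        then show ?thesis unfolding der[OF z] norm_mult using e'(2) by (simp add: q_def mult_ac)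
      next
        case False
        have "cmod (F (r n) (\<phi> z) - f (\<phi> z)) \<le> 2 * m (\<phi> z)"
          using norm_triangle_ineq4[of "F (r n) (\<phi> z)" "f (\<phi> z)"] mF[OF \<phi>_disc[OF z], of "r n"] mf[OF \<phi>_disc[OF z]] by linarith
        then have "exp (-2 * \<psi> z) * (cmod (F (r n) (\<phi> z) - f (\<phi> z)) * cmod (deriv g z)) \<le> exp (-2 * \<psi> z) * (2 * m (\<phi> z) * cmod (deriv g z))"
          by (intro mult_left_mono mult_right_mono) auto
        also have "\<dots> = 2 * (eval_const * symbol z)" unfolding msym[symmetric] by simp
        also have "\<dots> \<le> e / 2" using b(2)[of z] False z eval_const_pos by (simp add: field_simps)
        finally show ?thesis unfolding der[OF z] norm_mult .
      qed
      have up: "Bnorm \<psi> (\<lambda>z. ?V (F (r n)) z - ?V f z) \<le> 0 + e / 2"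
        by (rule Bnorm_le[OF le]) (simp_all add: Volterra_0)
      \<comment> \<open>Nonnegativity of \<open>Bnorm\<close> needs the supremum to be over a
        bounded set, which \<open>le\<close> provides; the value at z = 0 then bounds it from
        below.\<close>
      have "0 \<le> exp (-2 * \<psi> 0) * cmod (deriv (\<lambda>z. ?V (F (r n)) z - ?V f z) 0)" by simp
      also have "\<dots> \<le> (SUP z\<in>disc. exp (-2 * \<psi> z) * cmod (deriv (\<lambda>z. ?V (F (r n)) z - ?V f z) z))"
        by (intro cSUP_upper bdd_aboveI2[of _ _ "e / 2"] le) auto
      finally have "Bnorm \<psi> (\<lambda>z. ?V (F (r n)) z - ?V f z) \<ge> 0" unfolding Bnorm_def by simp
      then show "dist (Bnorm \<psi> (\<lambda>z. ?V (F (r n)) z - ?V f z)) 0 < e" using up e by simp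
    qed
  qed
  ultimately show "\<exists>r h. strict_mono r \<and> h \<in> Bloch0 \<psi> \<and> (\<lambda>n. Bnorm \<psi> (\<lambda>z. ?V (F (r n)) z - h z)) \<longlonglongrightarrow> 0"
    using r by blast
qed

end

end

theorem theorem3p4:
  fixes psi :: "complex \<Rightarrow> real" and \<phi> g :: "complex \<Rightarrow> complex"
  assumes "classD psi"
    and "standing_density psi"
    and "\<phi> holomorphic_on disc" and "\<phi> ` disc \<subseteq> disc"
    and "g holomorphic_on disc"
  shows "compact_AL2_B0 psi (Volterra \<phi> g) \<longleftrightarrow>
           bounded_AL2_B0 psi (Volterra \<phi> g) \<and>
           ((\<lambda>z. exp (psi (\<phi> z) - 2 * psi z) * sqrt (laplacian psi (\<phi> z)) * cmod (deriv g z))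
              \<longlongrightarrow> 0) to_boundary"
proof -
  have c2: "C2_on disc psi" and lap: "\<And>z. z \<in> disc \<Longrightarrow> laplacian psi z > 0"
    using assms(1) by (auto simp: classD_def)
  obtain C1 where C1: "C1 > 0" "\<And>z \<xi>. z \<in> disc \<Longrightarrow> \<xi> \<in> disc \<Longrightarrow> \<bar>tau psi z - tau psi \<xi>\<bar> \<le> C1 * cmod (z - \<xi>)"
    using assms(1) unfolding classD_def by blast
  obtain C2 where C2: "C2 > 0" "\<And>z. z \<in> disc \<Longrightarrow> tau psi z \<le> C2 * (1 - cmod z)"
    using assms(1) unfolding classD_def by blast
  obtain px py pxx pxy pyx pyy where p: "C2_data disc psi px py pxx pxy pyx pyy"
    "\<And>z. z \<in> disc \<Longrightarrow> laplacian psi z = pxx z + pyy z"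
    by (rule C2_on_data[OF c2]) (assumption | rule that)+
  interpret lipschitz_weight psi px py pxx pxy pyx pyy "tau psi" C1 C2
  proof
    show "C2_data disc psi px py pxx pxy pyx pyy" by (rule p)
    show "0 < pxx z + pyy z" if "z \<in> disc" for z using lap[OF that] p(2)[OF that] by simp
    show "tau psi z = 1 / sqrt (pxx z + pyy z)" if "z \<in> disc" for z using p(2)[OF that] by (simp add: tau_def)
  qed (use C1 C2 in auto)
  define Q where "Q z = exp (psi (\<phi> z) - 2 * psi z) * sqrt (laplacian psi (\<phi> z)) * cmod (deriv g z)" for z
  have Q: "Q z = symbol \<phi> g z" if z: "z \<in> disc" for z
  proof -
    have "\<phi> z \<in> disc" using assms(4) z by blast
    then have "sqrt (laplacian psi (\<phi> z)) > 0" using lap by simp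
    then show ?thesis
      by (simp add: Q_def symbol_def[OF assms(3-5)] tau_def exp_diff exp_minus field_simps)
  qed
  have van: "(Q \<longlongrightarrow> 0) to_boundary \<longleftrightarrow> (\<forall>e>0. \<exists>b<1. \<forall>z. b < cmod z \<and> cmod z < 1 \<longrightarrow> symbol \<phi> g z < e)"
  proof -
    have "\<bar>Q z\<bar> = symbol \<phi> g z" if "cmod z < 1" for z
      using Q[of z] symbol_nonneg[OF assms(3-5), of z] that by simp
    then have "(b < cmod z \<and> cmod z < 1 \<longrightarrow> \<bar>Q z\<bar> < e) \<longleftrightarrow> (b < cmod z \<and> cmod z < 1 \<longrightarrow> symbol \<phi> g z < e)" for b z e
      by auto
    then show ?thesis unfolding tendsto_to_boundary_iff by simp
  qed
  show ?thesis unfolding Q_def[symmetric] van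
  proof
    assume "compact_AL2_B0 psi (Volterra \<phi> g)"
    then show "bounded_AL2_B0 psi (Volterra \<phi> g) \<and> (\<forall>e>0. \<exists>b<1. \<forall>z. b < cmod z \<and> cmod z < 1 \<longrightarrow> symbol \<phi> g z < e)"
      using compact_imp_bounded_operator[OF assms(3-5)] compact_imp_symbol_vanishes[OF assms(3-5)] by blast
  next
    assume a: "bounded_AL2_B0 psi (Volterra \<phi> g) \<and> (\<forall>e>0. \<exists>b<1. \<forall>z. b < cmod z \<and> cmod z < 1 \<longrightarrow> symbol \<phi> g z < e)"
    then have "Volterra \<phi> g f \<in> Bloch0 psi" if "f \<in> AL2 psi" for f using that by (auto simp: bounded_AL2_B0_def)
    then show "compact_AL2_B0 psi (Volterra \<phi> g)"
      using a by (intro symbol_vanishes_imp_compact[OF assms(3-5)]) auto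
  qed
qed

end
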